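(* Let $(\mathcal{C},T,\Sigma)$ be a Krull–Schmidt right triangulated category such that whenever $B\xrightarrow{g}C\xrightarrow{h}TA\xrightarrow{-Tf}TB$ is a right triangle (for morphisms $f:A\to B$, $g:B\to C$, $h:C\to TA$), then $A\xrightarrow{f}B\xrightarrow{g}C\xrightarrow{h}TA$ is a right triangle. Let $\mathcal{D}\subseteq\mathcal{Z}$ be subcategories of $\mathcal{C}$ such that $\mathcal{D}$ is factor-through-epic, $\mathcal{Z}$ is extension-closed, and $(\mathcal{Z},\mathcal{Z})$ is a $\mathcal{D}$-mutation pair. If the restriction $T|_{\mathcal{Z}}:\mathcal{Z}\to T\mathcal{Z}$ of the shift functor is full (i.e. $\mathrm{Hom}_{\mathcal{C}}(X,Y)\to\mathrm{Hom}_{\mathcal{C}}(TX,TY)$, $f\mapsto Tf$, is surjective for all $X,Y\in\mathcal{Z}$), then the right triangulated category $\mathcal{Z}/\mathcal{D}$ (with the shift functor $\sigma$ and the right triangles described in the context) is a triangulated category.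
   Context: Right triangulated category. Let $\mathcal{C}$ be an additive category and $T$ an additive endofunctor of $\mathcal{C}$. A sextuple is a diagram $A\xrightarrow{f}B\xrightarrow{g}C\xrightarrow{h}TA$; a morphism of sextuples from $(A,B,C,f,g,h)$ to $(A',B',C',f',g',h')$ is a triple $(a,b,c)$ with $bf=f'a$, $cg=g'b$, $(Ta)h=h'c$; it is an isomorphism if $a,b,c$ are. A class $\Sigma$ of sextuples, whose elements are called right triangles, is a right triangulation (and $(\mathcal{C},T,\Sigma)$ a right triangulated category with shift functor $T$) if: TR(0) $\Sigma$ is closed under isomorphisms. TR(1) $0\to A\xrightarrow{1}A\to 0$ is a right triangle for every $A$. TR(2) Every morphism $f:A\to B$ extends to a right triangle $A\xrightarrow{f}B\xrightarrow{g}C\xrightarrow{h}TA$. TR(3) If $A\xrightarrow{f}B\xrightarrow{g}C\xrightarrow{h}TA$ is a right triangle, so is $B\xrightarrow{g}C\xrightarrow{h}TA\xrightarrow{-Tf}TB$. TR(4) Given right triangles $(A,B,C,f,g,h)$, $(A',B',C',f',g',h')$ and $a:A\to A'$, $b:B\to B'$ with $bf=f'a$, there is $c:C\to C'$ such that $(a,b,c)$ is a morphism of right triangles. TR(5) (octahedral axiom) Given right triangles $X\xrightarrow{a}Y\xrightarrow{b}Z\xrightarrow{c}TX$, $Y\xrightarrow{d}U\xrightarrow{e}V\xrightarrow{f}TY$, $X\xrightarrow{da}U\xrightarrow{g}W\xrightarrow{h}TX$, there are $l:Z\to W$, $i:W\to V$ with $lb=gd$, $hl=c$, $ig=e$, $fi=(Ta)h$,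 and $Z\xrightarrow{l}W\xrightarrow{i}V\xrightarrow{(Tb)f}TZ$ a right triangle. A right triangulated category is a triangulated category if its shift functor is an equivalence. Conventions. Krull–Schmidt: every object is isomorphic to a finite direct sum of objects with local endomorphism rings. Subcategories are full and closed under isomorphisms, direct sums and direct summands. $\mathcal{Z}$ is extension-closed if for every right triangle $A\to B\to C\to TA$ with $A,C\in\mathcal{Z}$ we have $B\in\mathcal{Z}$. A morphism $f:A\to B$ is $\mathcal{D}$-epic if $\mathrm{Hom}_{\mathcal{C}}(D,A)\to\mathrm{Hom}_{\mathcal{C}}(D,B)$, $u\mapsto fu$, is surjective for all $D\in\mathcal{D}$; it is $\mathcal{D}$-monic if $\mathrm{Hom}_{\mathcal{C}}(B,D)\to\mathrm{Hom}_{\mathcal{C}}(A,D)$, $u\mapsto uf$, is surjective for all $D\in\mathcal{D}$. $f:A\to B$ is a right $\mathcal{D}$-approximation of $B$ if $A\in\mathcal{D}$ and $f$ is $\mathcal{D}$-epic; it is a left $\mathcal{D}$-approximation of $A$ if $B\in\mathcal{D}$ and $f$ is $\mathcal{D}$-monic. Mutation. Let $\mathcal{X},\mathcal{Y}\supseteq\mathcal{D}$ be subcategories. $\mu^{-1}(\mathcal{X};\mathcal{D})$ is the subcategory of objects $Y\in\mathcal{C}$ such that $Y\in\mathcal{D}$ or there is a right triangle $X\xrightarrow{f}D\xrightarrow{g}Y\xrightarrow{h}TX$ with $X\in\mathcal{X}$, $D\in\mathcal{D}$, $f$ a left $\mathcal{D}$-approximation and $g$ a right $\mathcal{D}$-approximation.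 $\mu(\mathcal{Y};\mathcal{D})$ is the subcategory of objects $X\in\mathcal{C}$ such that $X\in\mathcal{D}$ or there is a right triangle $X\xrightarrow{f}D\xrightarrow{g}Y\xrightarrow{h}TX$ with $Y\in\mathcal{Y}$, $D\in\mathcal{D}$, $f$ a left and $g$ a right $\mathcal{D}$-approximation. $(\mathcal{X},\mathcal{Y})$ is a $\mathcal{D}$-mutation pair if $\mu^{-1}(\mathcal{X};\mathcal{D})=\mathcal{Y}$ and $\mu(\mathcal{Y};\mathcal{D})=\mathcal{X}$. $[\mathcal{D}](X,Y)$ is the subgroup of $\mathrm{Hom}_{\mathcal{C}}(X,Y)$ of morphisms factoring through an object of $\mathcal{D}$. $\mathcal{D}$ is factor-through-epic if for all objects $X,Y\in\mathcal{C}$, all $n>0$ and all $f\in[T^n\mathcal{D}](TX,TY)$ there is $f'\in[T^{n-1}\mathcal{D}](X,Y)$ with $Tf'=f$. The quotient category $\mathcal{Z}/\mathcal{D}$ has the objects of $\mathcal{Z}$ and morphism groups $\mathrm{Hom}_{\mathcal{Z}}(X,Y)/[\mathcal{D}](X,Y)$; the class of $f$ is denoted $\overline f$. The functor $\sigma$. For each $M\in\mathcal{Z}$ fix a right triangle $M\xrightarrow{\alpha_M}D_M\xrightarrow{\beta_M}\sigma M\xrightarrow{\gamma_M}TM$ with $\sigma M\in\mathcal{Z}$, $D_M\in\mathcal{D}$, $\alpha_M$ a left and $\beta_M$ a right $\mathcal{D}$-approximation (it exists since $\mathcal{Z}=\mu(\mathcal{Z};\mathcal{D})$); for $M\in\mathcal{D}$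 take $M\xrightarrow{1}M\to0\to TM$. For $\mu:M\to N$ in $\mathcal{Z}$ choose $g:D_M\to D_N$ and $\mu':\sigma M\to\sigma N$ such that $(\mu,g,\mu')$ is a morphism between the fixed right triangles of $M$ and $N$; put $\sigma(\overline\mu)=\overline{\mu'}$. Right triangles in $\mathcal{Z}/\mathcal{D}$. Let $M\xrightarrow{\mu}N\xrightarrow{\gamma}P\xrightarrow{\varphi}TM$ be a right triangle in $\mathcal{C}$ with $M,N,P\in\mathcal{Z}$ and $\mu$ $\mathcal{D}$-monic. Then there are $n:N\to D_M$ and $\pi:P\to\sigma M$ such that $(1_M,n,\pi)$ is a morphism of right triangles from it to the fixed right triangle of $M$. This gives the sextuple $M\xrightarrow{\overline\mu}N\xrightarrow{\overline\gamma}P\xrightarrow{\overline\pi}\sigma M$ in $\mathcal{Z}/\mathcal{D}$. The right triangles in $\mathcal{Z}/\mathcal{D}$ are the sextuples (with respect to $\sigma$) isomorphic to sextuples arising this way. *)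

theory Defs
  imports "HOL-Algebra.Ring"
begin

section \<open>Additive categories\<close>

record ('o, 'm) addcat =
  Ob :: "'o set"
  Mor :: "'o \<Rightarrow> 'o \<Rightarrow> 'm set"
  idm :: "'o \<Rightarrow> 'm"
  cmp :: "'m \<Rightarrow> 'm \<Rightarrow> 'm" (infixl "\<cdot>\<index>" 70)
  addm :: "'m \<Rightarrow> 'm \<Rightarrow> 'm" (infixl "\<boxplus>\<index>" 65)
  zerom :: "'o \<Rightarrow> 'o \<Rightarrow> 'm"

definition hom_group :: "('o, 'm) addcat \<Rightarrow> 'o \<Rightarrow> 'o \<Rightarrow> 'm monoid" where
  "hom_group C X Y = \<lparr>carrier = Mor C X Y, monoid.mult = addm C, one = zerom C X Y\<rparr>"

definition negm :: "('o, 'm) addcat \<Rightarrow> 'o \<Rightarrow> 'o \<Rightarrow> 'm \<Rightarrow> 'm" where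
  "negm C X Y f = m_inv (hom_group C X Y) f"

definition end_ring :: "('o, 'm) addcat \<Rightarrow> 'o \<Rightarrow> 'm ring" where
  "end_ring C X = \<lparr>carrier = Mor C X X, monoid.mult = cmp C, one = idm C X,
     zero = zerom C X X, add = addm C\<rparr>"

text \<open>Morphism sets for distinct pairs of objects are disjoint, so that composition and
  addition need not be annotated with objects. Note the order \<open>g \<cdot> f\<close>: first \<open>f\<close>, then \<open>g\<close>.\<close>

locale preadditive_category =
  fixes C :: "('o, 'm) addcat" (structure)
  assumes mor_disjoint:
    "\<lbrakk>X \<in> Ob C; Y \<in> Ob C; X' \<in> Ob C; Y' \<in> Ob C; f \<in> Mor C X Y; f \<in> Mor C X' Y'\<rbrakk>
      \<Longrightarrow> X = X' \<and> Y = Y'"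
    and id_mor: "X \<in> Ob C \<Longrightarrow> idm C X \<in> Mor C X X"
    and cmp_mor: "\<lbrakk>X \<in> Ob C; Y \<in> Ob C; Z \<in> Ob C; f \<in> Mor C X Y; g \<in> Mor C Y Z\<rbrakk>
      \<Longrightarrow> g \<cdot> f \<in> Mor C X Z"
    and cmp_id_right: "\<lbrakk>X \<in> Ob C; Y \<in> Ob C; f \<in> Mor C X Y\<rbrakk> \<Longrightarrow> f \<cdot> idm C X = f"
    and cmp_id_left: "\<lbrakk>X \<in> Ob C; Y \<in> Ob C; f \<in> Mor C X Y\<rbrakk> \<Longrightarrow> idm C Y \<cdot> f = f"
    and cmp_assoc: "\<lbrakk>X \<in> Ob C; Y \<in> Ob C; Z \<in> Ob C; W \<in> Ob C;
        f \<in> Mor C X Y; g \<in> Mor C Y Z; h \<in> Mor C Z W\<rbrakk>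
      \<Longrightarrow> (h \<cdot> g) \<cdot> f = h \<cdot> (g \<cdot> f)"
    and hom_comm_group: "\<lbrakk>X \<in> Ob C; Y \<in> Ob C\<rbrakk> \<Longrightarrow> comm_group (hom_group C X Y)"
    and cmp_add_right: "\<lbrakk>X \<in> Ob C; Y \<in> Ob C; Z \<in> Ob C;
        f \<in> Mor C X Y; f' \<in> Mor C X Y; g \<in> Mor C Y Z\<rbrakk>
      \<Longrightarrow> g \<cdot> (f \<boxplus> f') = g \<cdot> f \<boxplus> g \<cdot> f'"
    and cmp_add_left: "\<lbrakk>X \<in> Ob C; Y \<in> Ob C; Z \<in> Ob C;
        f \<in> Mor C X Y; g \<in> Mor C Y Z; g' \<in> Mor C Y Z\<rbrakk>
      \<Longrightarrow> (g \<boxplus> g') \<cdot> f = g \<cdot> f \<boxplus> g' \<cdot> f"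

definition iso_mor :: "('o, 'm) addcat \<Rightarrow> 'o \<Rightarrow> 'o \<Rightarrow> 'm \<Rightarrow> bool" where
  "iso_mor C X Y f \<longleftrightarrow> f \<in> Mor C X Y \<and>
     (\<exists>g \<in> Mor C Y X. g \<cdot>\<^bsub>C\<^esub> f = idm C X \<and> f \<cdot>\<^bsub>C\<^esub> g = idm C Y)"

definition isomorphic :: "('o, 'm) addcat \<Rightarrow> 'o \<Rightarrow> 'o \<Rightarrow> bool" where
  "isomorphic C X Y \<longleftrightarrow> (\<exists>f. iso_mor C X Y f)"

definition zero_object :: "('o, 'm) addcat \<Rightarrow> 'o \<Rightarrow> bool" where
  "zero_object C X \<longleftrightarrow> X \<in> Ob C \<and>
     (\<forall>Y \<in> Ob C. (\<exists>!f. f \<in> Mor C X Y) \<and> (\<exists>!f. f \<in> Mor C Y X))"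

text \<open>\<open>S\<close> is the direct sum of \<open>X 0, \<dots>, X (n - 1)\<close> with injections \<open>i\<close> and projections \<open>p\<close>;
  the empty direct sum (\<open>n = 0\<close>) is a zero object.\<close>

definition direct_sum ::
  "('o, 'm) addcat \<Rightarrow> nat \<Rightarrow> (nat \<Rightarrow> 'o) \<Rightarrow> 'o \<Rightarrow> (nat \<Rightarrow> 'm) \<Rightarrow> (nat \<Rightarrow> 'm) \<Rightarrow> bool" where
  "direct_sum C n X S i p \<longleftrightarrow> S \<in> Ob C \<and>
     (\<forall>k<n. X k \<in> Ob C \<and> i k \<in> Mor C (X k) S \<and> p k \<in> Mor C S (X k)) \<and>
     (\<forall>j<n. \<forall>k<n. p j \<cdot>\<^bsub>C\<^esub> i k = (if j = k then idm C (X k) else zerom C (X k) (X j))) \<and>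
     finsum (end_ring C S) (\<lambda>k. i k \<cdot>\<^bsub>C\<^esub> p k) {..<n} = idm C S"

locale additive_category = preadditive_category +
  assumes has_direct_sums: "\<And>n X. (\<And>k. k < n \<Longrightarrow> X k \<in> Ob C) \<Longrightarrow> \<exists>S i p. direct_sum C n X S i p"

definition local_ring :: "'a ring \<Rightarrow> bool" where
  "local_ring R \<longleftrightarrow> ring R \<and> \<one>\<^bsub>R\<^esub> \<noteq> \<zero>\<^bsub>R\<^esub> \<and>
     (\<forall>a \<in> carrier R. \<forall>b \<in> carrier R.
        a \<notin> Units R \<longrightarrow> b \<notin> Units R \<longrightarrow> a \<oplus>\<^bsub>R\<^esub> b \<notin> Units R)"

definition krull_schmidt :: "('o, 'm) addcat \<Rightarrow> bool" where
  "krull_schmidt C \<longleftrightarrow> (\<forall>X \<in> Ob C. \<exists>n Xs S i p. direct_sum C n Xs S i p \<and>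
     (\<forall>k<n. local_ring (end_ring C (Xs k))) \<and> isomorphic C X S)"

text \<open>Full subcategories are given by their sets of objects.\<close>

definition subcategory :: "('o, 'm) addcat \<Rightarrow> 'o set \<Rightarrow> bool" where
  "subcategory C Z \<longleftrightarrow> Z \<subseteq> Ob C \<and>
     (\<forall>X \<in> Z. \<forall>Y \<in> Ob C. isomorphic C X Y \<longrightarrow> Y \<in> Z) \<and>
     (\<forall>n X S i p. direct_sum C n X S i p \<longrightarrow> (S \<in> Z \<longleftrightarrow> (\<forall>k<n. X k \<in> Z)))"


section \<open>Endofunctors\<close>

record ('o, 'm) endo =
  fob :: "'o \<Rightarrow> 'o"
  fmor :: "'m \<Rightarrow> 'm"

definition endofunctor :: "('o, 'm) addcat \<Rightarrow> ('o, 'm) endo \<Rightarrow> bool" where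
  "endofunctor C T \<longleftrightarrow>
     (\<forall>X \<in> Ob C. fob T X \<in> Ob C \<and> fmor T (idm C X) = idm C (fob T X)) \<and>
     (\<forall>X \<in> Ob C. \<forall>Y \<in> Ob C. \<forall>f \<in> Mor C X Y. fmor T f \<in> Mor C (fob T X) (fob T Y)) \<and>
     (\<forall>X \<in> Ob C. \<forall>Y \<in> Ob C. \<forall>Z \<in> Ob C. \<forall>f \<in> Mor C X Y. \<forall>g \<in> Mor C Y Z.
        fmor T (g \<cdot>\<^bsub>C\<^esub> f) = fmor T g \<cdot>\<^bsub>C\<^esub> fmor T f)"

definition additive_endofunctor :: "('o, 'm) addcat \<Rightarrow> ('o, 'm) endo \<Rightarrow> bool" where
  "additive_endofunctor C T \<longleftrightarrow> endofunctor C T \<and>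
     (\<forall>X \<in> Ob C. \<forall>Y \<in> Ob C. \<forall>f \<in> Mor C X Y. \<forall>g \<in> Mor C X Y.
        fmor T (f \<boxplus>\<^bsub>C\<^esub> g) = fmor T f \<boxplus>\<^bsub>C\<^esub> fmor T g)"

definition id_endo :: "('o, 'm) endo" where
  "id_endo = \<lparr>fob = (\<lambda>X. X), fmor = (\<lambda>f. f)\<rparr>"

definition comp_endo :: "('o, 'm) endo \<Rightarrow> ('o, 'm) endo \<Rightarrow> ('o, 'm) endo" where
  "comp_endo G F = \<lparr>fob = fob G \<circ> fob F, fmor = fmor G \<circ> fmor F\<rparr>"

definition naturally_isomorphic ::
  "('o, 'm) addcat \<Rightarrow> ('o, 'm) endo \<Rightarrow> ('o, 'm) endo \<Rightarrow> bool" where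
  "naturally_isomorphic C F G \<longleftrightarrow> (\<exists>\<eta>.
     (\<forall>X \<in> Ob C. iso_mor C (fob F X) (fob G X) (\<eta> X)) \<and>
     (\<forall>X \<in> Ob C. \<forall>Y \<in> Ob C. \<forall>f \<in> Mor C X Y.
        \<eta> Y \<cdot>\<^bsub>C\<^esub> fmor F f = fmor G f \<cdot>\<^bsub>C\<^esub> \<eta> X))"

definition equivalence_endo :: "('o, 'm) addcat \<Rightarrow> ('o, 'm) endo \<Rightarrow> bool" where
  "equivalence_endo C F \<longleftrightarrow> endofunctor C F \<and> (\<exists>G. endofunctor C G \<and>
     naturally_isomorphic C (comp_endo G F) id_endo \<and>
     naturally_isomorphic C (comp_endo F G) id_endo)"


section \<open>Right triangulated categories\<close>

text \<open>\<open>(A, B, X, f, g, h)\<close> stands for the diagram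
  \<open>A \<longrightarrow> B \<longrightarrow> X \<longrightarrow> T A\<close> with maps \<open>f\<close>, \<open>g\<close>, \<open>h\<close>.\<close>

type_synonym ('o, 'm) sextuple = "'o \<times> 'o \<times> 'o \<times> 'm \<times> 'm \<times> 'm"

fun is_sextuple :: "('o, 'm) addcat \<Rightarrow> ('o, 'm) endo \<Rightarrow> ('o, 'm) sextuple \<Rightarrow> bool" where
  "is_sextuple C T (A, B, X, f, g, h) \<longleftrightarrow> A \<in> Ob C \<and> B \<in> Ob C \<and> X \<in> Ob C \<and>
     f \<in> Mor C A B \<and> g \<in> Mor C B X \<and> h \<in> Mor C X (fob T A)"

fun sextuple_mor :: "('o, 'm) addcat \<Rightarrow> ('o, 'm) endo \<Rightarrow>
  ('o, 'm) sextuple \<Rightarrow> ('o, 'm) sextuple \<Rightarrow> 'm \<times> 'm \<times> 'm \<Rightarrow> bool" where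
  "sextuple_mor C T (A, B, X, f, g, h) (A', B', X', f', g', h') (a, b, c) \<longleftrightarrow>
     a \<in> Mor C A A' \<and> b \<in> Mor C B B' \<and> c \<in> Mor C X X' \<and>
     b \<cdot>\<^bsub>C\<^esub> f = f' \<cdot>\<^bsub>C\<^esub> a \<and> c \<cdot>\<^bsub>C\<^esub> g = g' \<cdot>\<^bsub>C\<^esub> b \<and> fmor T a \<cdot>\<^bsub>C\<^esub> h = h' \<cdot>\<^bsub>C\<^esub> c"

fun sextuple_iso :: "('o, 'm) addcat \<Rightarrow> ('o, 'm) endo \<Rightarrow>
  ('o, 'm) sextuple \<Rightarrow> ('o, 'm) sextuple \<Rightarrow> 'm \<times> 'm \<times> 'm \<Rightarrow> bool" where
  "sextuple_iso C T (A, B, X, f, g, h) (A', B', X', f', g', h') (a, b, c) \<longleftrightarrow>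
     sextuple_mor C T (A, B, X, f, g, h) (A', B', X', f', g', h') (a, b, c) \<and>
     iso_mor C A A' a \<and> iso_mor C B B' b \<and> iso_mor C X X' c"

locale right_triangulated_category = additive_category C
  for C :: "('o, 'm) addcat" (structure) +
  fixes T :: "('o, 'm) endo" and \<Sigma> :: "('o, 'm) sextuple set"
  assumes shift_additive: "additive_endofunctor C T"
    and sextuples: "t \<in> \<Sigma> \<Longrightarrow> is_sextuple C T t"
    and TR0: "\<lbrakk>t \<in> \<Sigma>; is_sextuple C T t'; sextuple_iso C T t t' u\<rbrakk> \<Longrightarrow> t' \<in> \<Sigma>"
    and TR1: "\<lbrakk>zero_object C N; A \<in> Ob C\<rbrakk>
      \<Longrightarrow> (N, A, A, zerom C N A, idm C A, zerom C A (fob T N)) \<in> \<Sigma>"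
    and TR2: "\<lbrakk>A \<in> Ob C; B \<in> Ob C; f \<in> Mor C A B\<rbrakk> \<Longrightarrow> \<exists>X g h. (A, B, X, f, g, h) \<in> \<Sigma>"
    and TR3: "(A, B, X, f, g, h) \<in> \<Sigma>
      \<Longrightarrow> (B, X, fob T A, g, h, negm C (fob T A) (fob T B) (fmor T f)) \<in> \<Sigma>"
    and TR4: "\<lbrakk>(A, B, X, f, g, h) \<in> \<Sigma>; (A', B', X', f', g', h') \<in> \<Sigma>;
        a \<in> Mor C A A'; b \<in> Mor C B B'; b \<cdot> f = f' \<cdot> a\<rbrakk>
      \<Longrightarrow> \<exists>c. sextuple_mor C T (A, B, X, f, g, h) (A', B', X', f', g', h') (a, b, c)"
    and TR5: "\<lbrakk>(X, Y, Z, a, b, c) \<in> \<Sigma>; (Y, U, V, d, e, f) \<in> \<Sigma>; (X, U, W, d \<cdot> a, g, h) \<in> \<Sigma>\<rbrakk>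
      \<Longrightarrow> \<exists>l \<in> Mor C Z W. \<exists>i \<in> Mor C W V.
            l \<cdot> b = g \<cdot> d \<and> h \<cdot> l = c \<and> i \<cdot> g = e \<and> f \<cdot> i = fmor T a \<cdot> h \<and>
            (Z, W, V, l, i, fmor T b \<cdot> f) \<in> \<Sigma>"

locale triangulated_category = right_triangulated_category +
  assumes shift_equivalence: "equivalence_endo C T"

definition extension_closed :: "('o, 'm) sextuple set \<Rightarrow> 'o set \<Rightarrow> bool" where
  "extension_closed \<Sigma> Z \<longleftrightarrow>
     (\<forall>A B X f g h. (A, B, X, f, g, h) \<in> \<Sigma> \<longrightarrow> A \<in> Z \<longrightarrow> X \<in> Z \<longrightarrow> B \<in> Z)"


section \<open>Approximations and mutation pairs\<close>

definition rel_epic :: "('o, 'm) addcat \<Rightarrow> 'o set \<Rightarrow> 'o \<Rightarrow> 'o \<Rightarrow> 'm \<Rightarrow> bool" where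
  "rel_epic C D A B f \<longleftrightarrow> f \<in> Mor C A B \<and>
     (\<forall>E \<in> D. \<forall>v \<in> Mor C E B. \<exists>u \<in> Mor C E A. f \<cdot>\<^bsub>C\<^esub> u = v)"

definition rel_monic :: "('o, 'm) addcat \<Rightarrow> 'o set \<Rightarrow> 'o \<Rightarrow> 'o \<Rightarrow> 'm \<Rightarrow> bool" where
  "rel_monic C D A B f \<longleftrightarrow> f \<in> Mor C A B \<and>
     (\<forall>E \<in> D. \<forall>v \<in> Mor C A E. \<exists>u \<in> Mor C B E. u \<cdot>\<^bsub>C\<^esub> f = v)"

definition right_approx :: "('o, 'm) addcat \<Rightarrow> 'o set \<Rightarrow> 'o \<Rightarrow> 'o \<Rightarrow> 'm \<Rightarrow> bool" where
  "right_approx C D A B f \<longleftrightarrow> A \<in> D \<and> rel_epic C D A B f"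

definition left_approx :: "('o, 'm) addcat \<Rightarrow> 'o set \<Rightarrow> 'o \<Rightarrow> 'o \<Rightarrow> 'm \<Rightarrow> bool" where
  "left_approx C D A B f \<longleftrightarrow> B \<in> D \<and> rel_monic C D A B f"

definition approx_triangle ::
  "('o, 'm) addcat \<Rightarrow> ('o, 'm) sextuple set \<Rightarrow> 'o set \<Rightarrow> 'o \<Rightarrow> 'o \<Rightarrow> 'o \<Rightarrow> 'm \<Rightarrow> 'm \<Rightarrow> 'm \<Rightarrow> bool"
  where
  "approx_triangle C \<Sigma> D X E Y f g h \<longleftrightarrow>
     (X, E, Y, f, g, h) \<in> \<Sigma> \<and> left_approx C D X E f \<and> right_approx C D E Y g"

definition inv_mutation ::
  "('o, 'm) addcat \<Rightarrow> ('o, 'm) sextuple set \<Rightarrow> 'o set \<Rightarrow> 'o set \<Rightarrow> 'o set" where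
  "inv_mutation C \<Sigma> \<X> D = {Y \<in> Ob C. Y \<in> D \<or>
     (\<exists>X \<in> \<X>. \<exists>E f g h. approx_triangle C \<Sigma> D X E Y f g h)}"

definition mutation ::
  "('o, 'm) addcat \<Rightarrow> ('o, 'm) sextuple set \<Rightarrow> 'o set \<Rightarrow> 'o set \<Rightarrow> 'o set" where
  "mutation C \<Sigma> \<Y> D = {X \<in> Ob C. X \<in> D \<or>
     (\<exists>Y \<in> \<Y>. \<exists>E f g h. approx_triangle C \<Sigma> D X E Y f g h)}"

definition mutation_pair ::
  "('o, 'm) addcat \<Rightarrow> ('o, 'm) sextuple set \<Rightarrow> 'o set \<Rightarrow> 'o set \<Rightarrow> 'o set \<Rightarrow> bool" where
  "mutation_pair C \<Sigma> D \<X> \<Y> \<longleftrightarrow> inv_mutation C \<Sigma> \<X> D = \<Y> \<and> mutation C \<Sigma> \<Y> D = \<X>"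

text \<open>The morphisms \<open>X \<longrightarrow> Y\<close> factoring through an object of \<open>D\<close>.\<close>

definition fac :: "('o, 'm) addcat \<Rightarrow> 'o set \<Rightarrow> 'o \<Rightarrow> 'o \<Rightarrow> 'm set" where
  "fac C D X Y = {g \<cdot>\<^bsub>C\<^esub> f | f g E. E \<in> D \<and> f \<in> Mor C X E \<and> g \<in> Mor C E Y}"

definition factor_through_epic :: "('o, 'm) addcat \<Rightarrow> ('o, 'm) endo \<Rightarrow> 'o set \<Rightarrow> bool" where
  "factor_through_epic C T D \<longleftrightarrow> (\<forall>X \<in> Ob C. \<forall>Y \<in> Ob C. \<forall>n>0.
     \<forall>f \<in> fac C ((fob T ^^ n) ` D) (fob T X) (fob T Y).
       \<exists>f' \<in> fac C ((fob T ^^ (n - 1)) ` D) X Y. fmor T f' = f)"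


section \<open>The quotient category\<close>

text \<open>The class of \<open>f\<close> modulo the morphisms factoring through \<open>D\<close>; the objects \<open>X\<close> and \<open>Y\<close>
  are determined by \<open>f\<close>.\<close>

definition cls :: "('o, 'm) addcat \<Rightarrow> 'o set \<Rightarrow> 'm \<Rightarrow> 'm set" where
  "cls C D f = {f \<boxplus>\<^bsub>C\<^esub> d | d X Y. X \<in> Ob C \<and> Y \<in> Ob C \<and> f \<in> Mor C X Y \<and> d \<in> fac C D X Y}"

definition quotient_cat :: "('o, 'm) addcat \<Rightarrow> 'o set \<Rightarrow> 'o set \<Rightarrow> ('o, 'm set) addcat" where
  "quotient_cat C Z D = \<lparr>Ob = Z,
     Mor = (\<lambda>X Y. cls C D ` Mor C X Y),
     idm = (\<lambda>X. cls C D (idm C X)),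
     cmp = (\<lambda>G F. \<Union>g \<in> G. \<Union>f \<in> F. cls C D (g \<cdot>\<^bsub>C\<^esub> f)),
     addm = (\<lambda>F G. \<Union>f \<in> F. \<Union>g \<in> G. cls C D (f \<boxplus>\<^bsub>C\<^esub> g)),
     zerom = (\<lambda>X Y. cls C D (zerom C X Y))\<rparr>"

text \<open>A choice, for every \<open>M\<close> in \<open>Z\<close>, of a right triangle
  \<open>M \<longrightarrow> D\<^sub>M \<longrightarrow> \<sigma> M \<longrightarrow> T M\<close>; the components \<open>capx\<close>, \<open>cone\<close>, \<open>calpha\<close>, \<open>cbeta\<close>, \<open>cgamma\<close>
  are \<open>D\<^sub>M\<close>, \<open>\<sigma> M\<close> and the three maps.\<close>

record ('o, 'm) cone_choice =
  capx :: "'o \<Rightarrow> 'o"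
  cone :: "'o \<Rightarrow> 'o"
  calpha :: "'o \<Rightarrow> 'm"
  cbeta :: "'o \<Rightarrow> 'm"
  cgamma :: "'o \<Rightarrow> 'm"

definition chosen :: "('o, 'm) cone_choice \<Rightarrow> 'o \<Rightarrow> ('o, 'm) sextuple" where
  "chosen S M = (M, capx S M, cone S M, calpha S M, cbeta S M, cgamma S M)"

definition valid_choice :: "('o, 'm) addcat \<Rightarrow> ('o, 'm) sextuple set \<Rightarrow> 'o set \<Rightarrow> 'o set \<Rightarrow>
  ('o, 'm) cone_choice \<Rightarrow> bool" where
  "valid_choice C \<Sigma> Z D S \<longleftrightarrow>
     (\<forall>M \<in> Z. cone S M \<in> Z \<and>
        approx_triangle C \<Sigma> D M (capx S M) (cone S M) (calpha S M) (cbeta S M) (cgamma S M)) \<and>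
     (\<forall>M \<in> D. capx S M = M \<and> calpha S M = idm C M \<and> zero_object C (cone S M))"

definition sigma :: "('o, 'm) addcat \<Rightarrow> ('o, 'm) endo \<Rightarrow> 'o set \<Rightarrow> 'o set \<Rightarrow>
  ('o, 'm) cone_choice \<Rightarrow> ('o, 'm set) endo" where
  "sigma C T Z D S = \<lparr>fob = cone S,
     fmor = (\<lambda>F. THE G. \<exists>M \<in> Z. \<exists>N \<in> Z. \<exists>m \<in> Mor C M N. \<exists>g m'.
        F = cls C D m \<and> sextuple_mor C T (chosen S M) (chosen S N) (m, g, m') \<and>
        G = cls C D m')\<rparr>"

definition standard_triangles :: "('o, 'm) addcat \<Rightarrow> ('o, 'm) endo \<Rightarrow> ('o, 'm) sextuple set \<Rightarrow>
  'o set \<Rightarrow> 'o set \<Rightarrow> ('o, 'm) cone_choice \<Rightarrow> ('o, 'm set) sextuple set" where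
  "standard_triangles C T \<Sigma> Z D S =
     {(M, N, P, cls C D m, cls C D c, cls C D q) | M N P m c w n q.
        M \<in> Z \<and> N \<in> Z \<and> P \<in> Z \<and> (M, N, P, m, c, w) \<in> \<Sigma> \<and> rel_monic C D M N m \<and>
        sextuple_mor C T (M, N, P, m, c, w) (chosen S M) (idm C M, n, q)}"

definition quotient_triangles :: "('o, 'm) addcat \<Rightarrow> ('o, 'm) endo \<Rightarrow> ('o, 'm) sextuple set \<Rightarrow>
  'o set \<Rightarrow> 'o set \<Rightarrow> ('o, 'm) cone_choice \<Rightarrow> ('o, 'm set) sextuple set" where
  "quotient_triangles C T \<Sigma> Z D S =
     {t. is_sextuple (quotient_cat C Z D) (sigma C T Z D S) t \<and>
        (\<exists>t' \<in> standard_triangles C T \<Sigma> Z D S. \<exists>u.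
           sextuple_iso (quotient_cat C Z D) (sigma C T Z D S) t' t u)}"

end

theory Submission
  imports Defs
begin

text \<open>
  The rotation hypothesis makes \<open>T\<close> faithful, and together with fullness on \<open>Z\<close> this gives weak
  kernels: in a right triangle \<open>A \<rightarrow> B \<rightarrow> X \<rightarrow> T A\<close> with \<open>B\<close> in \<open>Z\<close>, a map from an object of \<open>Z\<close>
  to \<open>X\<close> that vanishes in \<open>T A\<close> lifts to \<open>B\<close>. Hence two maps into \<open>\<sigma> M\<close> that agree after
  \<open>\<gamma>\<^sub>M\<close> are equal modulo \<open>D\<close>, so every commutativity condition in \<open>Z/D\<close> can be checked in \<open>C\<close> after
  composing with \<open>\<gamma>\<close>.

  A map \<open>f : M \<rightarrow> N\<close> is replaced by the \<open>D\<close>-monic map \<open>(f, \<alpha>\<^sub>M) : M \<rightarrow> N \<oplus> D\<^sub>M\<close>, which has the same class.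
  By the octahedral axiom its cone \<open>P\<close> sits in a right triangle \<open>N \<rightarrow> P \<rightarrow> \<sigma> M \<rightarrow> T N\<close> whose last
  map is \<open>- T f \<cdot> \<gamma>\<^sub>M\<close>; thus \<open>P\<close> lies in \<open>Z\<close>, and this triangle is the rotated one. Standard
  triangles in \<open>Z/D\<close> are exact at the third object, so two triangles on the same map are isomorphic
  and the rotation and octahedral axioms need only be checked on these representatives.

  The functor \<open>\<sigma>\<close> is full and faithful because \<open>T\<close> is so on \<open>Z\<close>, and it is essentially surjective
  because every object of \<open>Z\<close> is the third term of an approximation triangle.
\<close>

section \<open>Calculus in preadditive categories\<close>

text \<open>A right triangulation is exact on one side only: a map that kills the preceding map
  factors onward, whereas lifting problems are solved only after applying \<open>T\<close>.
  Cancelling this \<open>T\<close> is what rotation and fullness achieve, so lifts are available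
  only between objects of \<open>Z\<close>. Two triangles on the same map cannot be compared by the
  five lemma, as no long exact Hom sequence of \<open>Z/D\<close> is at hand. Instead, a
  self-comparison \<open>e\<close> over identities differs from 1 by some \<open>n\<close> with
  \<open>n \<cdot> g = 0\<close> and \<open>h \<cdot> n = 0\<close>; exactness at the third object
  makes \<open>n\<close> square to zero, and \<open>1 - n\<close> inverts \<open>e\<close>. Passing
  to a \<open>D\<close>-monic map replaces \<open>N\<close> by \<open>N \<oplus> D\<^sub>M\<close>,
  which is isomorphic to \<open>N\<close> in \<open>Z/D\<close> but need not be so in
  \<open>C\<close>; hence the octahedral axiom has to be transported along isomorphisms of the
  second and third objects of a composable pair. Since a map into \<open>\<sigma> N\<close> is
  determined modulo \<open>D\<close> by its composite with \<gamma>, the middle component of a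
  morphism of chosen triangles can be forgotten: \<sigma> is handled through the relation
  \<open>\<gamma> \<cdot> m' = T m \<cdot> \<gamma>\<close>.\<close>

context preadditive_category
begin

text \<open>Morphism sets of distinct pairs of objects are disjoint, so a morphism determines its
  source and target. Reading them off with \<open>dom\<close> and \<open>cod\<close> lets the
  simplifier settle the typing of composites without guessing objects.\<close>

definition arr :: "'m \<Rightarrow> bool" where
  "arr f \<longleftrightarrow> (\<exists>X \<in> Ob C. \<exists>Y \<in> Ob C. f \<in> Mor C X Y)"

definition dom :: "'m \<Rightarrow> 'o" where
  "dom f = (THE X. X \<in> Ob C \<and> (\<exists>Y \<in> Ob C. f \<in> Mor C X Y))"

definition cod :: "'m \<Rightarrow> 'o" where
  "cod f = (THE Y. Y \<in> Ob C \<and> (\<exists>X \<in> Ob C. f \<in> Mor C X Y))"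

definition neg :: "'m \<Rightarrow> 'm" where
  "neg f = negm C (dom f) (cod f) f"

definition minusm :: "'m \<Rightarrow> 'm \<Rightarrow> 'm" (infixl "\<boxminus>" 65) where
  "f \<boxminus> g = f \<boxplus> neg g"

lemma dom_eq: "\<lbrakk>X \<in> Ob C; Y \<in> Ob C; f \<in> Mor C X Y\<rbrakk> \<Longrightarrow> dom f = X"
  unfolding dom_def using mor_disjoint by (intro the_equality) blast+

lemma cod_eq: "\<lbrakk>X \<in> Ob C; Y \<in> Ob C; f \<in> Mor C X Y\<rbrakk> \<Longrightarrow> cod f = Y"
  unfolding cod_def using mor_disjoint by (intro the_equality) blast+

lemma mor_iff [simp]:
  "\<lbrakk>X \<in> Ob C; Y \<in> Ob C\<rbrakk> \<Longrightarrow> f \<in> Mor C X Y \<longleftrightarrow> arr f \<and> dom f = X \<and> cod f = Y"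
  using dom_eq cod_eq unfolding arr_def by blast

lemma arr_obj [simp]: "arr f \<Longrightarrow> dom f \<in> Ob C" "arr f \<Longrightarrow> cod f \<in> Ob C"
  using dom_eq cod_eq unfolding arr_def by blast+

lemma arr_mor: "arr f \<Longrightarrow> f \<in> Mor C (dom f) (cod f)"
  by simp

lemma id_arr [simp]:
  assumes "X \<in> Ob C" shows "arr (idm C X)" "dom (idm C X) = X" "cod (idm C X) = X"
  using id_mor [OF assms] assms by simp_all

lemma cmp_arr [simp]:
  assumes "arr f" "arr g" "dom g = cod f"
  shows "arr (g \<cdot> f)" "dom (g \<cdot> f) = dom f" "cod (g \<cdot> f) = cod g"
  using cmp_mor [of "dom f" "cod f" "cod g" f g] assms by simp_all

lemma id_cmp [simp]: "\<lbrakk>arr f; X = dom f\<rbrakk> \<Longrightarrow> f \<cdot> idm C X = f"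
  "\<lbrakk>arr f; X = cod f\<rbrakk> \<Longrightarrow> idm C X \<cdot> f = f"
  using cmp_id_right [of "dom f" "cod f" f] cmp_id_left [of "dom f" "cod f" f] by simp_all

lemma assoc [simp]:
  "\<lbrakk>arr f; arr g; arr h; dom g = cod f; dom h = cod g\<rbrakk> \<Longrightarrow> (h \<cdot> g) \<cdot> f = h \<cdot> (g \<cdot> f)"
  using cmp_assoc [of "dom f" "cod f" "cod g" "cod h" f g h] by simp

lemma hom_group_simps [simp]:
  "carrier (hom_group C X Y) = Mor C X Y"
  "monoid.mult (hom_group C X Y) = addm C"
  "one (hom_group C X Y) = zerom C X Y"
  by (simp_all add: hom_group_def)

lemma zero_arr [simp]:
  assumes "X \<in> Ob C" "Y \<in> Ob C"
  shows "arr (zerom C X Y)" "dom (zerom C X Y) = X" "cod (zerom C X Y) = Y"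
proof -
  interpret G: comm_group "hom_group C X Y" using assms by (rule hom_comm_group)
  show "arr (zerom C X Y)" "dom (zerom C X Y) = X" "cod (zerom C X Y) = Y"
    using G.one_closed assms by simp_all
qed

lemma add_arr [simp]:
  assumes "arr f" "arr g" "dom f = dom g" "cod f = cod g"
  shows "arr (f \<boxplus> g)" "dom (f \<boxplus> g) = dom g" "cod (f \<boxplus> g) = cod g"
proof -
  interpret G: comm_group "hom_group C (dom g) (cod g)" using assms by (intro hom_comm_group) auto
  show "arr (f \<boxplus> g)" "dom (f \<boxplus> g) = dom g" "cod (f \<boxplus> g) = cod g"
    using G.m_closed [of f g] assms by simp_all
qed

lemma negm_eq [simp]: "\<lbrakk>arr f; dom f = X; cod f = Y\<rbrakk> \<Longrightarrow> negm C X Y f = neg f"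
  by (simp add: neg_def)

lemma neg_arr [simp]:
  assumes "arr f" shows "arr (neg f)" "dom (neg f) = dom f" "cod (neg f) = cod f"
proof -
  interpret G: comm_group "hom_group C (dom f) (cod f)" using assms by (intro hom_comm_group) auto
  show "arr (neg f)" "dom (neg f) = dom f" "cod (neg f) = cod f"
    using G.inv_closed [of f] assms by (simp_all add: neg_def negm_def del: negm_eq)
qed

lemma add_zero [simp]:
  assumes "arr f"
  shows "\<lbrakk>X = dom f; Y = cod f\<rbrakk> \<Longrightarrow> f \<boxplus> zerom C X Y = f"
    "\<lbrakk>X = dom f; Y = cod f\<rbrakk> \<Longrightarrow> zerom C X Y \<boxplus> f = f"
proof -
  interpret G: comm_group "hom_group C (dom f) (cod f)" using assms by (intro hom_comm_group) auto
  show "\<lbrakk>X = dom f; Y = cod f\<rbrakk> \<Longrightarrow> f \<boxplus> zerom C X Y = f"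
    "\<lbrakk>X = dom f; Y = cod f\<rbrakk> \<Longrightarrow> zerom C X Y \<boxplus> f = f"
    using G.r_one [of f] G.l_one [of f] assms by simp_all
qed

lemma add_neg [simp]:
  assumes "arr f"
  shows "f \<boxplus> neg f = zerom C (dom f) (cod f)" "neg f \<boxplus> f = zerom C (dom f) (cod f)"
proof -
  interpret G: comm_group "hom_group C (dom f) (cod f)" using assms by (intro hom_comm_group) auto
  show "f \<boxplus> neg f = zerom C (dom f) (cod f)" "neg f \<boxplus> f = zerom C (dom f) (cod f)"
    using G.r_inv [of f] G.l_inv [of f] assms by (simp_all add: neg_def negm_def del: negm_eq)
qed

lemma add_comm:
  assumes "arr f" "arr g" "dom f = dom g" "cod f = cod g"
  shows "f \<boxplus> g = g \<boxplus> f"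
proof -
  interpret G: comm_group "hom_group C (dom g) (cod g)" using assms by (intro hom_comm_group) auto
  show ?thesis using G.m_comm [of f g] assms by simp
qed

lemma add_assoc:
  assumes "arr f" "arr g" "arr h" "dom f = dom g" "cod f = cod g" "dom g = dom h" "cod g = cod h"
  shows "(f \<boxplus> g) \<boxplus> h = f \<boxplus> (g \<boxplus> h)"
proof -
  interpret G: comm_group "hom_group C (dom h) (cod h)" using assms by (intro hom_comm_group) auto
  show ?thesis using G.m_assoc [of f g h] assms by simp
qed

lemma add_left_comm:
  assumes "arr f" "arr g" "arr h" "dom f = dom g" "cod f = cod g" "dom g = dom h" "cod g = cod h"
  shows "f \<boxplus> (g \<boxplus> h) = g \<boxplus> (f \<boxplus> h)"
proof -
  have "f \<boxplus> (g \<boxplus> h) = (f \<boxplus> g) \<boxplus> h" using assms by (intro add_assoc [symmetric]) auto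
  also have "f \<boxplus> g = g \<boxplus> f" using assms by (intro add_comm) auto
  also have "(g \<boxplus> f) \<boxplus> h = g \<boxplus> (f \<boxplus> h)" using assms by (intro add_assoc) auto
  finally show ?thesis .
qed

lemma add_neg_left [simp]:
  assumes "arr f" "arr g" "dom f = dom g" "cod f = cod g"
  shows "f \<boxplus> (neg f \<boxplus> g) = g" "neg f \<boxplus> (f \<boxplus> g) = g"
  using assms by (simp_all flip: add_assoc)

lemma add_left_cancel:
  assumes "arr f" "arr g" "arr h" "dom f = dom g" "cod f = cod g" "dom g = dom h" "cod g = cod h"
  shows "f \<boxplus> g = f \<boxplus> h \<longleftrightarrow> g = h"
proof
  assume "f \<boxplus> g = f \<boxplus> h"
  then have "neg f \<boxplus> (f \<boxplus> g) = neg f \<boxplus> (f \<boxplus> h)" by simp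
  then show "g = h" using assms by simp
qed simp

lemma neg_unique:
  assumes "arr f" "arr g" "dom f = dom g" "cod f = cod g" "f \<boxplus> g = zerom C (dom f) (cod f)"
  shows "g = neg f"
proof -
  have "f \<boxplus> g = f \<boxplus> neg f" using assms by simp
  then show ?thesis by (subst (asm) add_left_cancel) (use assms in auto)
qed

lemma neg_neg [simp]: "arr f \<Longrightarrow> neg (neg f) = f"
  by (rule neg_unique [symmetric]) simp_all

lemma neg_zero [simp]: "\<lbrakk>X \<in> Ob C; Y \<in> Ob C\<rbrakk> \<Longrightarrow> neg (zerom C X Y) = zerom C X Y"
  by (rule neg_unique [symmetric]) simp_all

lemma neg_add [simp]:
  assumes "arr f" "arr g" "dom f = dom g" "cod f = cod g"
  shows "neg (f \<boxplus> g) = neg f \<boxplus> neg g"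
proof (rule neg_unique [symmetric])
  have "(f \<boxplus> g) \<boxplus> (neg f \<boxplus> neg g) = f \<boxplus> (neg f \<boxplus> (g \<boxplus> neg g))"
    using assms by (simp add: add_assoc add_left_comm [of g "neg f"])
  then show "(f \<boxplus> g) \<boxplus> (neg f \<boxplus> neg g) = zerom C (dom (f \<boxplus> g)) (cod (f \<boxplus> g))"
    using assms by simp
qed (use assms in simp_all)

lemma cmp_add [simp]:
  "\<lbrakk>arr f; arr f'; arr g; dom f = dom f'; cod f = cod f'; dom g = cod f'\<rbrakk>
    \<Longrightarrow> g \<cdot> (f \<boxplus> f') = g \<cdot> f \<boxplus> g \<cdot> f'"
  "\<lbrakk>arr f; arr g; arr g'; dom g = dom g'; cod g = cod g'; dom g' = cod f\<rbrakk>
    \<Longrightarrow> (g \<boxplus> g') \<cdot> f = g \<cdot> f \<boxplus> g' \<cdot> f"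
  using cmp_add_right [of "dom f'" "cod f'" "cod g" f f' g]
    cmp_add_left [of "dom f" "cod f" "cod g'" f g g'] by simp_all

lemma cmp_zero [simp]:
  assumes "arr g"
  shows "\<lbrakk>X \<in> Ob C; Y = dom g\<rbrakk> \<Longrightarrow> g \<cdot> zerom C X Y = zerom C X (cod g)"
    "\<lbrakk>Y \<in> Ob C; X = cod g\<rbrakk> \<Longrightarrow> zerom C X Y \<cdot> g = zerom C (dom g) Y"
proof -
  have idem: "z = zerom C (dom z) (cod z)" if "arr z" "z \<boxplus> z = z" for z
    using that add_left_cancel [of z z "zerom C (dom z) (cod z)"] by simp
  show "g \<cdot> zerom C X Y = zerom C X (cod g)" if "X \<in> Ob C" "Y = dom g"
    using idem [of "g \<cdot> zerom C X Y"] assms that by (simp flip: cmp_add)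
  show "zerom C X Y \<cdot> g = zerom C (dom g) Y" if "Y \<in> Ob C" "X = cod g"
    using idem [of "zerom C X Y \<cdot> g"] assms that by (simp del: cmp_add flip: cmp_add(2))
qed

lemma cmp_neg [simp]:
  assumes "arr f" "arr g" "dom g = cod f"
  shows "g \<cdot> neg f = neg (g \<cdot> f)" "neg g \<cdot> f = neg (g \<cdot> f)"
proof -
  show "g \<cdot> neg f = neg (g \<cdot> f)" by (rule neg_unique) (use assms in \<open>simp_all flip: cmp_add\<close>)
  show "neg g \<cdot> f = neg (g \<cdot> f)"
    by (rule neg_unique) (use assms in \<open>simp_all del: cmp_add flip: cmp_add(2)\<close>)
qed

lemma minus_arr [simp]:
  assumes "arr f" "arr g" "dom f = dom g" "cod f = cod g"
  shows "arr (f \<boxminus> g)" "dom (f \<boxminus> g) = dom g" "cod (f \<boxminus> g) = cod g"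
  using assms by (simp_all add: minusm_def)

lemma cmp_minus [simp]:
  "\<lbrakk>arr f; arr f'; arr g; dom f = dom f'; cod f = cod f'; dom g = cod f'\<rbrakk>
    \<Longrightarrow> g \<cdot> (f \<boxminus> f') = g \<cdot> f \<boxminus> g \<cdot> f'"
  "\<lbrakk>arr f; arr g; arr g'; dom g = dom g'; cod g = cod g'; dom g' = cod f\<rbrakk>
    \<Longrightarrow> (g \<boxminus> g') \<cdot> f = g \<cdot> f \<boxminus> g' \<cdot> f"
  by (simp_all add: minusm_def)

lemma minus_self [simp]: "arr f \<Longrightarrow> f \<boxminus> f = zerom C (dom f) (cod f)"
  by (simp add: minusm_def)

lemma minus_eq_iff:
  assumes "arr f" "arr g" "arr h" "dom f = dom g" "cod f = cod g" "dom g = dom h" "cod g = cod h"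
  shows "f \<boxminus> g = h \<longleftrightarrow> f = h \<boxplus> g"
proof
  assume "f \<boxminus> g = h"
  then have "h \<boxplus> g = f \<boxplus> (neg g \<boxplus> g)"
    using assms by (simp add: minusm_def add_assoc [symmetric] del: add_neg)
  then show "f = h \<boxplus> g" using assms by simp
next
  assume "f = h \<boxplus> g"
  then show "f \<boxminus> g = h" using assms by (simp add: minusm_def add_assoc)
qed

lemma minus_eq_zero_iff [simp]:
  assumes "arr f" "arr g" "dom f = dom g" "cod f = cod g" "X = dom g" "Y = cod g"
  shows "f \<boxminus> g = zerom C X Y \<longleftrightarrow> f = g"
  unfolding assms(5,6) using assms(1-4) by (subst minus_eq_iff) auto

lemma add_minus [simp]:
  assumes "arr f" "arr g" "dom f = dom g" "cod f = cod g"
  shows "f \<boxplus> (g \<boxminus> f) = g" "(g \<boxminus> f) \<boxplus> f = g"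
proof -
  show "(g \<boxminus> f) \<boxplus> f = g"
    by (rule sym, rule minus_eq_iff [THEN iffD1]) (use assms in auto)
  then show "f \<boxplus> (g \<boxminus> f) = g" using assms add_comm [of f "g \<boxminus> f"] by simp
qed

text \<open>Composites are kept associated to the right, where an equation for
  \<open>g \<cdot> f\<close> does not match inside a longer word; this form applies it
  there.\<close>

lemma cmp_reassoc:
  assumes "g \<cdot> f = u" "arr f" "arr g" "arr x" "dom g = cod f" "dom f = cod x"
  shows "g \<cdot> (f \<cdot> x) = u \<cdot> x"
  using assms assoc [of x f g] by simp

lemma ring_end_ring:
  assumes "X \<in> Ob C" shows "ring (end_ring C X)"
proof (rule ringI)
  show "abelian_group (end_ring C X)"
  proof (rule abelian_groupI)
    show "\<exists>y \<in> carrier (end_ring C X). y \<oplus>\<^bsub>end_ring C X\<^esub> x = \<zero>\<^bsub>end_ring C X\<^esub>"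
      if "x \<in> carrier (end_ring C X)" for x
      using that assms by (intro bexI [of _ "neg x"]) (auto simp: end_ring_def)
    show "x \<oplus>\<^bsub>end_ring C X\<^esub> y = y \<oplus>\<^bsub>end_ring C X\<^esub> x"
      if "x \<in> carrier (end_ring C X)" "y \<in> carrier (end_ring C X)" for x y
      using that assms add_comm [of x y] by (simp add: end_ring_def)
  qed (use assms in \<open>auto simp: end_ring_def add_assoc\<close>)
  show "monoid (end_ring C X)"
    by (rule monoidI) (use assms in \<open>auto simp: end_ring_def\<close>)
qed (use assms in \<open>auto simp: end_ring_def\<close>)

section \<open>Isomorphisms, zero objects and equivalences\<close>

lemma iso_morI:
  assumes "arr f" "arr g" "dom g = cod f" "cod g = dom f" "g \<cdot> f = idm C (dom f)"
    "f \<cdot> g = idm C (cod f)" "X = dom f" "Y = cod f"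
  shows "iso_mor C X Y f"
  using assms unfolding iso_mor_def by auto

lemma iso_morE:
  assumes "iso_mor C X Y f" "X \<in> Ob C" "Y \<in> Ob C"
  obtains g where "arr f" "dom f = X" "cod f = Y" "arr g" "dom g = Y" "cod g = X"
    "g \<cdot> f = idm C X" "f \<cdot> g = idm C Y"
  using assms unfolding iso_mor_def by auto

lemma iso_id [simp]: "X \<in> Ob C \<Longrightarrow> iso_mor C X X (idm C X)"
  by (rule iso_morI [where g = "idm C X"]) auto

lemma iso_cmp:
  assumes "iso_mor C X Y f" "iso_mor C Y W g" "X \<in> Ob C" "Y \<in> Ob C" "W \<in> Ob C"
  shows "iso_mor C X W (g \<cdot> f)"
proof -
  obtain f' where f: "arr f" "dom f = X" "cod f = Y" "arr f'" "dom f' = Y" "cod f' = X"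
    "f' \<cdot> f = idm C X" "f \<cdot> f' = idm C Y" using assms by (elim iso_morE) auto
  obtain g' where g: "arr g" "dom g = Y" "cod g = W" "arr g'" "dom g' = W" "cod g' = Y"
    "g' \<cdot> g = idm C Y" "g \<cdot> g' = idm C W" using assms by (elim iso_morE) auto
  show ?thesis
    using f g by (intro iso_morI [where g = "f' \<cdot> g'"])
      (simp_all add: cmp_reassoc [OF g(7)] cmp_reassoc [OF f(8)])
qed

text \<open>Computing \<open>g \<cdot> f \<cdot> h\<close> in two ways identifies both inverses.
  \<open>tri_five\<close> inverts \<open>c' \<cdot> c\<close> and \<open>c \<cdot> c'\<close>
  separately and so needs this form.\<close>

lemma iso_two_sided:
  assumes "arr f" "arr g" "arr h" "dom g = cod f" "cod g = dom f" "dom h = cod f" "cod h = dom f"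
    "g \<cdot> f = idm C (dom f)" "f \<cdot> h = idm C (cod f)" "X = dom f" "Y = cod f"
  shows "iso_mor C X Y f"
proof -
  have "g = g \<cdot> (f \<cdot> h)" using assms by (simp del: assoc)
  also have "\<dots> = (g \<cdot> f) \<cdot> h" using assms(1-7) by simp
  also have "\<dots> = h" using assms by (simp del: assoc)
  finally show ?thesis using assms by (intro iso_morI [where g = g]) auto
qed

lemma zero_object_arr:
  assumes "zero_object C N" "arr f"
  shows "dom f = N \<Longrightarrow> f = zerom C N (cod f)" "cod f = N \<Longrightarrow> f = zerom C (dom f) N"
proof -
  have N: "N \<in> Ob C" using assms by (simp add: zero_object_def)
  show "f = zerom C N (cod f)" if "dom f = N"
  proof -
    have "\<exists>!g. g \<in> Mor C N (cod f)" using assms by (simp add: zero_object_def del: mor_iff)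
    moreover have "f \<in> Mor C N (cod f)" "zerom C N (cod f) \<in> Mor C N (cod f)"
      using assms N that by simp_all
    ultimately show ?thesis by blast
  qed
  show "f = zerom C (dom f) N" if "cod f = N"
  proof -
    have "\<exists>!g. g \<in> Mor C (dom f) N" using assms by (simp add: zero_object_def del: mor_iff)
    moreover have "f \<in> Mor C (dom f) N" "zerom C (dom f) N \<in> Mor C (dom f) N"
      using assms N that by simp_all
    ultimately show ?thesis by blast
  qed
qed

lemma iso_zero_objects:
  assumes "zero_object C N" "zero_object C N'"
  shows "iso_mor C N N' (zerom C N N')"
proof -
  have N: "N \<in> Ob C" "N' \<in> Ob C" using assms by (auto simp: zero_object_def)
  have "idm C N = zerom C N N" "idm C N' = zerom C N' N'"
    using zero_object_arr(1) [OF assms(1), of "idm C N"] zero_object_arr(1) [OF assms(2), of "idm C N'"] N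
    by auto
  then show ?thesis using N by (intro iso_morI [where g = "zerom C N' N"]) auto
qed

lemma zero_objectI:
  assumes "X \<in> Ob C" "idm C X = zerom C X X"
  shows "zero_object C X"
proof -
  have "f = zerom C X (cod f)" if "arr f" "dom f = X" for f
  proof -
    have "f = f \<cdot> idm C X" using that by simp
    also have "\<dots> = zerom C X (cod f)" using that assms by (simp del: id_cmp)
    finally show ?thesis .
  qed
  moreover have "f = zerom C (dom f) X" if "arr f" "cod f = X" for f
  proof -
    have "f = idm C X \<cdot> f" using that by simp
    also have "\<dots> = zerom C (dom f) X" using that assms by (simp del: id_cmp)
    finally show ?thesis .
  qed
  ultimately show ?thesis
    unfolding zero_object_def
  proof (intro conjI ballI assms(1), goal_cases)
    case (1 Y)
    then show ?case using assms by (intro ex1I [of _ "zerom C X Y"]) auto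
  next
    case (2 Y)
    then show ?case using assms by (intro ex1I [of _ "zerom C Y X"]) auto
  qed
qed

text \<open>Write \<open>k'\<close> as \<open>k' \<cdot> x \<cdot> x'\<close>, replace
  \<open>k' \<cdot> x\<close> by \<open>y \<cdot> k\<close> and cancel \<open>y' \<cdot> y\<close>;
  one-sided inverses suffice.\<close>

lemma square_inverse:
  assumes "y \<cdot> k = k' \<cdot> x" "y' \<cdot> y = idm C (dom y)" "x \<cdot> x' = idm C (cod x)"
    "arr x" "arr y" "arr x'" "arr y'" "arr k" "arr k'" "dom k = dom x" "cod k = dom y"
    "dom k' = cod x" "cod k' = cod y" "dom x' = cod x" "cod x' = dom x" "dom y' = cod y"
    "cod y' = dom y"
  shows "y' \<cdot> k' = k \<cdot> x'"
proof -
  have "y' \<cdot> k' = y' \<cdot> (k' \<cdot> (x \<cdot> x'))" using assms by simp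
  also have "\<dots> = y' \<cdot> ((y \<cdot> k) \<cdot> x')" unfolding assms(1) using assms(4-) by simp
  also have "\<dots> = (y' \<cdot> y) \<cdot> (k \<cdot> x')" using assms(4-) by simp
  also have "\<dots> = k \<cdot> x'" unfolding assms(2) using assms(4-) by simp
  finally show ?thesis .
qed

text \<open>The quasi-inverse is chosen on objects by surjectivity and on morphisms by fullness;
  identities between chosen morphisms are checked after applying \<open>F\<close>.\<close>

lemma equivalence_endoI:
  assumes F: "endofunctor C F"
    and full: "\<And>X Y g. \<lbrakk>X \<in> Ob C; Y \<in> Ob C; arr g; dom g = fob F X; cod g = fob F Y\<rbrakk>
      \<Longrightarrow> \<exists>f. arr f \<and> dom f = X \<and> cod f = Y \<and> fmor F f = g"
    and faithful: "\<And>f f'. \<lbrakk>arr f; arr f'; dom f = dom f'; cod f = cod f'; fmor F f = fmor F f'\<rbrakk>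
      \<Longrightarrow> f = f'"
    and surj: "\<And>Y. Y \<in> Ob C \<Longrightarrow> \<exists>X \<in> Ob C. isomorphic C (fob F X) Y"
  shows "equivalence_endo C F"
proof -
  have Fob [simp]: "fob F X \<in> Ob C" "fmor F (idm C X) = idm C (fob F X)" if "X \<in> Ob C" for X
    using F that unfolding endofunctor_def by auto
  have Farr [simp]: "arr (fmor F f)" "dom (fmor F f) = fob F (dom f)" "cod (fmor F f) = fob F (cod f)"
    if "arr f" for f
  proof -
    have "fmor F f \<in> Mor C (fob F (dom f)) (fob F (cod f))"
      using F arr_mor [OF that] arr_obj [OF that] unfolding endofunctor_def by blast
    then show "arr (fmor F f)" "dom (fmor F f) = fob F (dom f)" "cod (fmor F f) = fob F (cod f)"
      using that by simp_all
  qed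
  have Fcmp [simp]: "fmor F (g \<cdot> f) = fmor F g \<cdot> fmor F f" if "arr f" "arr g" "dom g = cod f" for f g
  proof -
    have "g \<in> Mor C (cod f) (cod g)" using arr_mor [of g] that by simp
    then show ?thesis
      using F arr_mor [of f] that arr_obj [of f] arr_obj [of g] unfolding endofunctor_def by blast
  qed
  obtain G0 where G0: "\<forall>Y \<in> Ob C. G0 Y \<in> Ob C \<and> isomorphic C (fob F (G0 Y)) Y"
    using bchoice [of "Ob C" "\<lambda>Y X. X \<in> Ob C \<and> isomorphic C (fob F X) Y"] surj by blast
  then have G0_ob [simp]: "G0 Y \<in> Ob C" if "Y \<in> Ob C" for Y using that by blast
  obtain e where e_iso: "\<forall>Y \<in> Ob C. iso_mor C (fob F (G0 Y)) Y (e Y)"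
    using bchoice [of "Ob C" "\<lambda>Y e. iso_mor C (fob F (G0 Y)) Y e"] G0
    unfolding isomorphic_def by blast
  have "\<forall>Y \<in> Ob C. \<exists>g. arr g \<and> dom g = Y \<and> cod g = fob F (G0 Y) \<and>
      g \<cdot> e Y = idm C (fob F (G0 Y)) \<and> e Y \<cdot> g = idm C Y"
  proof
    fix Y assume Y: "Y \<in> Ob C"
    with e_iso have "iso_mor C (fob F (G0 Y)) Y (e Y)" by blast
    then show "\<exists>g. arr g \<and> dom g = Y \<and> cod g = fob F (G0 Y) \<and>
      g \<cdot> e Y = idm C (fob F (G0 Y)) \<and> e Y \<cdot> g = idm C Y"
      by (rule iso_morE) (use Y in auto)
  qed
  then obtain e' where e'_inv: "\<forall>Y \<in> Ob C. arr (e' Y) \<and> dom (e' Y) = Y \<and> cod (e' Y) = fob F (G0 Y) \<and>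
      e' Y \<cdot> e Y = idm C (fob F (G0 Y)) \<and> e Y \<cdot> e' Y = idm C Y"
    by (rule bchoice [THEN exE])
  have e [simp]: "arr (e Y)" "dom (e Y) = fob F (G0 Y)" "cod (e Y) = Y" if "Y \<in> Ob C" for Y
    using e_iso that unfolding iso_mor_def by auto
  have e' [simp]: "arr (e' Y)" "dom (e' Y) = Y" "cod (e' Y) = fob F (G0 Y)"
    "e' Y \<cdot> e Y = idm C (fob F (G0 Y))" "e Y \<cdot> e' Y = idm C Y" if "Y \<in> Ob C" for Y
    using e'_inv that by blast+
  \<comment> \<open>The quasi-inverse sends \<open>f\<close> to a preimage of its conjugate by the
    isomorphisms \<open>e\<close>, which is what makes \<open>e\<close> natural.\<close>
  have "\<exists>g. arr g \<and> dom g = G0 (dom f) \<and> cod g = G0 (cod f) \<and>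
      fmor F g = e' (cod f) \<cdot> (f \<cdot> e (dom f))" if "arr f" for f
    using full [of "G0 (dom f)" "G0 (cod f)" "e' (cod f) \<cdot> (f \<cdot> e (dom f))"] that by simp
  then have "\<forall>f \<in> Collect arr. \<exists>g. arr g \<and> dom g = G0 (dom f) \<and> cod g = G0 (cod f) \<and>
      fmor F g = e' (cod f) \<cdot> (f \<cdot> e (dom f))" by blast
  then obtain L where "\<forall>f \<in> Collect arr. arr (L f) \<and> dom (L f) = G0 (dom f) \<and>
      cod (L f) = G0 (cod f) \<and> fmor F (L f) = e' (cod f) \<cdot> (f \<cdot> e (dom f))"
    by (rule bchoice [THEN exE])
  then have L [simp]: "arr (L f)" "dom (L f) = G0 (dom f)" "cod (L f) = G0 (cod f)"
    "fmor F (L f) = e' (cod f) \<cdot> (f \<cdot> e (dom f))" if "arr f" for f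
    using that by blast+
  define G where "G = \<lparr>fob = G0, fmor = L\<rparr>"
  have re: "e Y \<cdot> (e' Y \<cdot> x) = x" if "arr x" "Y = cod x" for x Y
    using cmp_reassoc [of "e (cod x)" "e' (cod x)" "idm C (cod x)" x] that by simp
  have "L (idm C X) = idm C (G0 X)" if "X \<in> Ob C" for X
    by (rule faithful) (use that in simp_all)
  moreover have "L (g \<cdot> f) = L g \<cdot> L f" if "arr f" "arr g" "dom g = cod f" for f g
    by (rule faithful) (use that in \<open>simp_all add: re\<close>)
  ultimately have G: "endofunctor C G"
    unfolding endofunctor_def G_def by simp
  \<comment> \<open>The other natural isomorphism at \<open>X\<close> is a preimage of
    \<open>e\<close> at \<open>fob F X\<close>; a preimage of \<open>e'\<close> inverts it.\<close>
  have "\<forall>X \<in> Ob C. \<exists>n. arr n \<and> dom n = G0 (fob F X) \<and> cod n = X \<and> fmor F n = e (fob F X)"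
    using full by simp
  then obtain n where "\<forall>X \<in> Ob C. arr (n X) \<and> dom (n X) = G0 (fob F X) \<and> cod (n X) = X \<and>
      fmor F (n X) = e (fob F X)"
    by (rule bchoice [THEN exE])
  then have n [simp]: "arr (n X)" "dom (n X) = G0 (fob F X)" "cod (n X) = X"
    "fmor F (n X) = e (fob F X)" if "X \<in> Ob C" for X
    using that by blast+
  have "iso_mor C (G0 (fob F X)) X (n X)" if X: "X \<in> Ob C" for X
  proof -
    obtain n' where n': "arr n'" "dom n' = X" "cod n' = G0 (fob F X)" "fmor F n' = e' (fob F X)"
      using full [of X "G0 (fob F X)" "e' (fob F X)"] X by auto
    show ?thesis
    proof (rule iso_morI [where g = n'])
      show "n' \<cdot> n X = idm C (dom (n X))" by (rule faithful) (use X n' in simp_all)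
      show "n X \<cdot> n' = idm C (cod (n X))" by (rule faithful) (use X n' in simp_all)
    qed (use X n' in simp_all)
  qed
  moreover have "n (cod f) \<cdot> L (fmor F f) = f \<cdot> n (dom f)" if "arr f" for f
    by (rule faithful) (use that in \<open>simp_all add: re\<close>)
  ultimately have 1: "naturally_isomorphic C (comp_endo G F) id_endo"
    unfolding naturally_isomorphic_def comp_endo_def id_endo_def G_def
    by (intro exI [of _ n]) auto
  have 2: "naturally_isomorphic C (comp_endo F G) id_endo"
    unfolding naturally_isomorphic_def comp_endo_def id_endo_def G_def
    using e_iso by (intro exI [of _ e]) (auto simp: re)
  show ?thesis unfolding equivalence_endo_def using F G 1 2 by blast
qed

end


section \<open>Triangulations generated by standard triangles\<close>

text \<open>Both \<open>C\<close> with \<open>T\<close> and the quotient category with \<sigma> are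
  instances, so the algebra of sextuples is done once.\<close>

locale shifted_category = preadditive_category C
  for C :: "('o, 'm) addcat" (structure) +
  fixes T :: "('o, 'm) endo"
  assumes shift: "additive_endofunctor C T"
begin

lemma T_ob [simp]: "X \<in> Ob C \<Longrightarrow> fob T X \<in> Ob C"
  and T_id [simp]: "X \<in> Ob C \<Longrightarrow> fmor T (idm C X) = idm C (fob T X)"
  using shift unfolding additive_endofunctor_def endofunctor_def by auto

lemma T_arr [simp]:
  assumes "arr f"
  shows "arr (fmor T f)" "dom (fmor T f) = fob T (dom f)" "cod (fmor T f) = fob T (cod f)"
proof -
  have "fmor T f \<in> Mor C (fob T (dom f)) (fob T (cod f))"
    using shift arr_mor [OF assms] arr_obj [OF assms]
    unfolding additive_endofunctor_def endofunctor_def by blast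
  then show "arr (fmor T f)" "dom (fmor T f) = fob T (dom f)" "cod (fmor T f) = fob T (cod f)"
    using assms by simp_all
qed

lemma T_cmp [simp]:
  assumes "arr f" "arr g" "dom g = cod f" shows "fmor T (g \<cdot> f) = fmor T g \<cdot> fmor T f"
proof -
  have "g \<in> Mor C (cod f) (cod g)" using arr_mor [of g] assms by simp
  then show ?thesis
    using shift arr_mor [of f] assms arr_obj [of f] arr_obj [of g]
    unfolding additive_endofunctor_def endofunctor_def by blast
qed

lemma T_add [simp]:
  assumes "arr f" "arr g" "dom f = dom g" "cod f = cod g"
  shows "fmor T (f \<boxplus> g) = fmor T f \<boxplus> fmor T g"
proof -
  have "f \<in> Mor C (dom g) (cod g)" using arr_mor [of f] assms by simp
  then show ?thesis
    using shift arr_mor [of g] assms arr_obj [of g] unfolding additive_endofunctor_def by blast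
qed

lemma T_zero [simp]:
  assumes "X \<in> Ob C" "Y \<in> Ob C"
  shows "fmor T (zerom C X Y) = zerom C (fob T X) (fob T Y)"
proof -
  let ?z = "fmor T (zerom C X Y)"
  have "?z \<boxplus> ?z = fmor T (zerom C X Y \<boxplus> zerom C X Y)"
    using assms by (intro T_add [symmetric]) auto
  then have "?z \<boxplus> ?z = ?z \<boxplus> zerom C (fob T X) (fob T Y)" using assms by simp
  then show ?thesis by (subst (asm) add_left_cancel) (use assms in auto)
qed

lemma T_neg [simp]:
  assumes "arr f" shows "fmor T (neg f) = neg (fmor T f)"
proof (rule neg_unique)
  show "fmor T f \<boxplus> fmor T (neg f) = zerom C (dom (fmor T f)) (cod (fmor T f))"
    using assms by (simp flip: T_add)
qed (use assms in simp_all)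

lemma T_minus [simp]:
  "\<lbrakk>arr f; arr g; dom f = dom g; cod f = cod g\<rbrakk> \<Longrightarrow> fmor T (f \<boxminus> g) = fmor T f \<boxminus> fmor T g"
  by (simp add: minusm_def)

section \<open>Sextuples and their morphisms\<close>

lemma is_sextuple_iff [simp]:
  "is_sextuple C T (A, B, X, f, g, h) \<longleftrightarrow> A \<in> Ob C \<and> B \<in> Ob C \<and> X \<in> Ob C \<and>
    arr f \<and> dom f = A \<and> cod f = B \<and> arr g \<and> dom g = B \<and> cod g = X \<and>
    arr h \<and> dom h = X \<and> cod h = fob T A"
  by auto

declare is_sextuple.simps [simp del]

lemma sextuple_mor_comp:
  assumes "is_sextuple C T t" "is_sextuple C T t'" "is_sextuple C T t''"
    "sextuple_mor C T t t' (a, b, c)" "sextuple_mor C T t' t'' (a', b', c')"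
  shows "sextuple_mor C T t t'' (a' \<cdot> a, b' \<cdot> b, c' \<cdot> c)"
proof -
  obtain A B X f g h where t: "t = (A, B, X, f, g, h)" by (cases t)
  obtain A' B' X' f' g' h' where t': "t' = (A', B', X', f', g', h')" by (cases t')
  obtain A'' B'' X'' f'' g'' h'' where t'': "t'' = (A'', B'', X'', f'', g'', h'')" by (cases t'')
  have eqs: "b \<cdot> f = f' \<cdot> a" "c \<cdot> g = g' \<cdot> b" "fmor T a \<cdot> h = h' \<cdot> c"
    "b' \<cdot> f' = f'' \<cdot> a'" "c' \<cdot> g' = g'' \<cdot> b'" "fmor T a' \<cdot> h' = h'' \<cdot> c'"
    using assms by (simp_all add: t t' t'')
  show ?thesis using assms
    by (simp add: t t' t'' eqs cmp_reassoc [OF eqs(4)] cmp_reassoc [OF eqs(5)] cmp_reassoc [OF eqs(6)])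
qed

lemma sextuple_iso_iff:
  "sextuple_iso C T t t' (a, b, c) \<longleftrightarrow> sextuple_mor C T t t' (a, b, c) \<and>
    iso_mor C (fst t) (fst t') a \<and> iso_mor C (fst (snd t)) (fst (snd t')) b \<and>
    iso_mor C (fst (snd (snd t))) (fst (snd (snd t'))) c"
  by (cases t; cases t') auto

lemma sextuple_iso_comp:
  assumes "is_sextuple C T t" "is_sextuple C T t'" "is_sextuple C T t''"
    "sextuple_iso C T t t' u" "sextuple_iso C T t' t'' u'"
  shows "\<exists>u''. sextuple_iso C T t t'' u''"
proof -
  obtain a b c where u: "u = (a, b, c)" by (cases u)
  obtain a' b' c' where u': "u' = (a', b', c')" by (cases u')
  have "sextuple_iso C T t t'' (a' \<cdot> a, b' \<cdot> b, c' \<cdot> c)"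
    using assms sextuple_mor_comp [OF assms(1-3)]
    by (cases t; cases t'; cases t'') (auto simp: sextuple_iso_iff u u' intro: iso_cmp)
  then show ?thesis ..
qed

lemma sextuple_mor_inverse:
  assumes s: "is_sextuple C T (A, B, X, f, g, h)" "is_sextuple C T (A', B', X', f', g', h')"
    and m: "sextuple_mor C T (A, B, X, f, g, h) (A', B', X', f', g', h') (a, b, c)"
    and i: "a' \<in> Mor C A' A" "a' \<cdot> a = idm C A" "a \<cdot> a' = idm C A'"
      "b' \<in> Mor C B' B" "b' \<cdot> b = idm C B" "b \<cdot> b' = idm C B'"
      "c' \<in> Mor C X' X" "c' \<cdot> c = idm C X" "c \<cdot> c' = idm C X'"
  shows "sextuple_mor C T (A', B', X', f', g', h') (A, B, X, f, g, h) (a', b', c')"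
proof -
  have T: "fmor T a' \<cdot> fmor T a = idm C (fob T A)" "fmor T a \<cdot> fmor T a' = idm C (fob T A')"
    using s m i by (simp_all flip: T_cmp)
  have "b' \<cdot> f' = f \<cdot> a'" by (rule square_inverse [of b f f' a]) (use s m i in simp_all)
  moreover have "c' \<cdot> g' = g \<cdot> b'" by (rule square_inverse [of c g g' b]) (use s m i in simp_all)
  moreover have "fmor T a' \<cdot> h' = h \<cdot> c'" by (rule square_inverse [of "fmor T a" h h' c]) (use s m i T in simp_all)
  ultimately show ?thesis using s i by simp
qed

lemma sextuple_isoE:
  assumes "sextuple_iso C T (A, B, X, f, g, h) (A', B', X', f', g', h') (a, b, c)"
    "is_sextuple C T (A, B, X, f, g, h)" "is_sextuple C T (A', B', X', f', g', h')"
  obtains a' b' c' where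
    "sextuple_iso C T (A', B', X', f', g', h') (A, B, X, f, g, h) (a', b', c')"
    "a' \<cdot> a = idm C A" "a \<cdot> a' = idm C A'" "b' \<cdot> b = idm C B" "b \<cdot> b' = idm C B'"
    "c' \<cdot> c = idm C X" "c \<cdot> c' = idm C X'"
proof -
  have m: "sextuple_mor C T (A, B, X, f, g, h) (A', B', X', f', g', h') (a, b, c)"
    and i: "iso_mor C A A' a" "iso_mor C B B' b" "iso_mor C X X' c"
    using assms(1) by simp_all
  obtain a' where a': "a' \<in> Mor C A' A" "a' \<cdot> a = idm C A" "a \<cdot> a' = idm C A'"
    using i(1) unfolding iso_mor_def by blast
  obtain b' where b': "b' \<in> Mor C B' B" "b' \<cdot> b = idm C B" "b \<cdot> b' = idm C B'"
    using i(2) unfolding iso_mor_def by blast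
  obtain c' where c': "c' \<in> Mor C X' X" "c' \<cdot> c = idm C X" "c \<cdot> c' = idm C X'"
    using i(3) unfolding iso_mor_def by blast
  have "sextuple_mor C T (A', B', X', f', g', h') (A, B, X, f, g, h) (a', b', c')"
    by (rule sextuple_mor_inverse [OF assms(2,3) m a' b' c'])
  moreover have "iso_mor C A' A a'" "iso_mor C B' B b'" "iso_mor C X' X c'"
    using m a' b' c' unfolding iso_mor_def sextuple_mor.simps by blast+
  ultimately have "sextuple_iso C T (A', B', X', f', g', h') (A, B, X, f, g, h) (a', b', c')"
    by simp
  then show ?thesis by (rule that [OF _ a'(2,3) b'(2,3) c'(2,3)])
qed

end

text \<open>The two conditions on \<open>std\<close> make a triangle depend on its first map only up
  to isomorphism: \<open>std_mor\<close> supplies comparison maps, and \<open>std_exact\<close>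
  makes self-comparisons invertible.\<close>

locale triangle_presentation = shifted_category C T
  for C :: "('o, 'm) addcat" (structure) and T :: "('o, 'm) endo" +
  fixes std :: "('o, 'm) sextuple set"
  assumes std_sextuple: "t \<in> std \<Longrightarrow> is_sextuple C T t"
    and std_mor: "\<lbrakk>(A, B, X, f, g, h) \<in> std; (A', B', X', f', g', h') \<in> std;
        a \<in> Mor C A A'; b \<in> Mor C B B'; b \<cdot> f = f' \<cdot> a\<rbrakk>
      \<Longrightarrow> \<exists>c. sextuple_mor C T (A, B, X, f, g, h) (A', B', X', f', g', h') (a, b, c)"
    and std_exact: "\<lbrakk>(A, B, X, f, g, h) \<in> std; arr u; dom u = X; u \<cdot> g = zerom C B (cod u)\<rbrakk>
      \<Longrightarrow> \<exists>x. arr x \<and> dom x = fob T A \<and> cod x = cod u \<and> u = x \<cdot> h"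
begin

definition tri :: "('o, 'm) sextuple set" where
  "tri = {t. is_sextuple C T t \<and> (\<exists>t' \<in> std. \<exists>u. sextuple_iso C T t' t u)}"

lemma tri_sextuple: "t \<in> tri \<Longrightarrow> is_sextuple C T t"
  by (simp add: tri_def)

lemma std_tri:
  assumes "t \<in> std" shows "t \<in> tri"
proof -
  obtain A B X f g h where t: "t = (A, B, X, f, g, h)" by (cases t)
  have "sextuple_iso C T t t (idm C A, idm C B, idm C X)"
    using std_sextuple [OF assms] by (simp add: t)
  then show ?thesis using assms std_sextuple [OF assms] unfolding tri_def by blast
qed

lemma tri_iso: "\<lbrakk>t \<in> tri; is_sextuple C T t'; sextuple_iso C T t t' u\<rbrakk> \<Longrightarrow> t' \<in> tri"
  using sextuple_iso_comp std_sextuple unfolding tri_def by blast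

lemma triE:
  assumes "(A, B, X, f, g, h) \<in> tri"
  obtains A' B' X' f' g' h' a b c a' b' c' where "(A', B', X', f', g', h') \<in> std"
    "sextuple_mor C T (A', B', X', f', g', h') (A, B, X, f, g, h) (a, b, c)"
    "sextuple_mor C T (A, B, X, f, g, h) (A', B', X', f', g', h') (a', b', c')"
    "a' \<cdot> a = idm C A'" "a \<cdot> a' = idm C A" "b' \<cdot> b = idm C B'" "b \<cdot> b' = idm C B"
    "c' \<cdot> c = idm C X'" "c \<cdot> c' = idm C X"
proof -
  obtain A' B' X' f' g' h' a b c where std: "(A', B', X', f', g', h') \<in> std"
    and u: "sextuple_iso C T (A', B', X', f', g', h') (A, B, X, f, g, h) (a, b, c)"
    using assms unfolding tri_def by auto
  note s = std_sextuple [OF std] tri_sextuple [OF assms]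
  obtain a' b' c' where u': "sextuple_iso C T (A, B, X, f, g, h) (A', B', X', f', g', h') (a', b', c')"
    and i: "a' \<cdot> a = idm C A'" "a \<cdot> a' = idm C A" "b' \<cdot> b = idm C B'" "b \<cdot> b' = idm C B"
    "c' \<cdot> c = idm C X'" "c \<cdot> c' = idm C X"
    by (rule sextuple_isoE [OF u s])
  show ?thesis by (rule that [OF std _ _ i]) (use u u' in \<open>simp_all only: sextuple_iso.simps\<close>)
qed

text \<open>The square is conjugated into standard representatives, completed there by
  \<open>std_mor\<close> and conjugated back.\<close>

lemma tri_mor:
  assumes t1: "(A, B, X, f, g, h) \<in> tri" and t2: "(A', B', X', f', g', h') \<in> tri"
    and a: "a \<in> Mor C A A'" and b: "b \<in> Mor C B B'" and eq: "b \<cdot> f = f' \<cdot> a"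
  shows "\<exists>c. sextuple_mor C T (A, B, X, f, g, h) (A', B', X', f', g', h') (a, b, c)"
proof -
  note ob = tri_sextuple [OF t1] tri_sextuple [OF t2]
  obtain A1 B1 X1 f1 g1 h1 a1 b1 c1 a1' b1' c1' where s1: "(A1, B1, X1, f1, g1, h1) \<in> std"
    and m1: "sextuple_mor C T (A1, B1, X1, f1, g1, h1) (A, B, X, f, g, h) (a1, b1, c1)"
    and n1: "sextuple_mor C T (A, B, X, f, g, h) (A1, B1, X1, f1, g1, h1) (a1', b1', c1')"
    and i1: "a1' \<cdot> a1 = idm C A1" "a1 \<cdot> a1' = idm C A" "b1' \<cdot> b1 = idm C B1" "b1 \<cdot> b1' = idm C B"
    by (rule triE [OF t1])
  obtain A2 B2 X2 f2 g2 h2 a2 b2 c2 a2' b2' c2' where s2: "(A2, B2, X2, f2, g2, h2) \<in> std"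
    and m2: "sextuple_mor C T (A2, B2, X2, f2, g2, h2) (A', B', X', f', g', h') (a2, b2, c2)"
    and n2: "sextuple_mor C T (A', B', X', f', g', h') (A2, B2, X2, f2, g2, h2) (a2', b2', c2')"
    and i2: "a2' \<cdot> a2 = idm C A2" "a2 \<cdot> a2' = idm C A'" "b2' \<cdot> b2 = idm C B2" "b2 \<cdot> b2' = idm C B'"
    by (rule triE [OF t2])
  note ob = ob std_sextuple [OF s1] std_sextuple [OF s2]
  have eqs: "b1 \<cdot> f1 = f \<cdot> a1" "b2' \<cdot> f' = f2 \<cdot> a2'" using m1 n2 by simp_all
  have "(b2' \<cdot> (b \<cdot> b1)) \<cdot> f1 = b2' \<cdot> ((b \<cdot> f) \<cdot> a1)"
    using ob m1 n2 b a by (simp add: eqs)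
  also have "\<dots> = f2 \<cdot> (a2' \<cdot> (a \<cdot> a1))"
    unfolding eq using ob m1 n2 b a by (simp add: cmp_reassoc [OF eqs(2)])
  finally have "(b2' \<cdot> (b \<cdot> b1)) \<cdot> f1 = f2 \<cdot> (a2' \<cdot> (a \<cdot> a1))" .
  then obtain c where
    "sextuple_mor C T (A1, B1, X1, f1, g1, h1) (A2, B2, X2, f2, g2, h2) (a2' \<cdot> (a \<cdot> a1), b2' \<cdot> (b \<cdot> b1), c)"
    using std_mor [OF s1 s2, of "a2' \<cdot> (a \<cdot> a1)" "b2' \<cdot> (b \<cdot> b1)"] ob m1 n2 a b by auto
  from sextuple_mor_comp [OF ob(1,3,4) n1 this]
  have "sextuple_mor C T (A, B, X, f, g, h) (A2, B2, X2, f2, g2, h2)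
    (a2' \<cdot> (a \<cdot> a1) \<cdot> a1', b2' \<cdot> (b \<cdot> b1) \<cdot> b1', c \<cdot> c1')" .
  from sextuple_mor_comp [OF ob(1,4,2) this m2]
  have "sextuple_mor C T (A, B, X, f, g, h) (A', B', X', f', g', h')
    (a2 \<cdot> (a2' \<cdot> (a \<cdot> a1) \<cdot> a1'), b2 \<cdot> (b2' \<cdot> (b \<cdot> b1) \<cdot> b1'), c2 \<cdot> (c \<cdot> c1'))" .
  moreover have "a2 \<cdot> (a2' \<cdot> (a \<cdot> a1) \<cdot> a1') = a" "b2 \<cdot> (b2' \<cdot> (b \<cdot> b1) \<cdot> b1') = b"
    using ob m1 n1 m2 n2 a b by (simp_all add: i1 i2 cmp_reassoc [OF i2(2)] cmp_reassoc [OF i2(4)])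
  ultimately show ?thesis by auto
qed

lemma tri_exact:
  assumes t: "(A, B, X, f, g, h) \<in> tri" and u: "arr u" "dom u = X" "u \<cdot> g = zerom C B (cod u)"
  shows "\<exists>x. arr x \<and> dom x = fob T A \<and> cod x = cod u \<and> u = x \<cdot> h"
proof -
  obtain A' B' X' f' g' h' a b c a' b' c' where s: "(A', B', X', f', g', h') \<in> std"
    and m: "sextuple_mor C T (A', B', X', f', g', h') (A, B, X, f, g, h) (a, b, c)"
    and n: "sextuple_mor C T (A, B, X, f, g, h) (A', B', X', f', g', h') (a', b', c')"
    and i: "c \<cdot> c' = idm C X"
    by (rule triE [OF t])
  note ob = tri_sextuple [OF t] std_sextuple [OF s]
  have eqs: "c \<cdot> g' = g \<cdot> b" "fmor T a' \<cdot> h = h' \<cdot> c'" using m n by simp_all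
  have "(u \<cdot> c) \<cdot> g' = u \<cdot> (g \<cdot> b)" using ob m u by (simp add: eqs)
  also have "\<dots> = zerom C B' (cod u)" using ob m u by (simp add: cmp_reassoc [OF u(3)])
  finally obtain x where x: "arr x" "dom x = fob T A'" "cod x = cod u" "u \<cdot> c = x \<cdot> h'"
    using std_exact [OF s, of "u \<cdot> c"] ob m u by auto
  have "u = (u \<cdot> c) \<cdot> c'" using ob m n u i by simp
  also have "\<dots> = (x \<cdot> fmor T a') \<cdot> h" unfolding x(4) using ob m n x(1-3) by (simp add: eqs)
  finally show ?thesis using ob n x by (intro exI [of _ "x \<cdot> fmor T a'"]) simp
qed

lemma tri_endo_iso:
  assumes t: "(A, B, X, f, g, h) \<in> tri"
    and m: "sextuple_mor C T (A, B, X, f, g, h) (A, B, X, f, g, h) (idm C A, idm C B, e)"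
  shows "iso_mor C X X e"
proof -
  note ob = tri_sextuple [OF t]
  define n where "n = e \<boxminus> idm C X"
  have n: "arr n" "dom n = X" "cod n = X" using ob m by (simp_all add: n_def)
  have e: "e = idm C X \<boxplus> n" "arr e" "dom e = X" "cod e = X" using ob m by (simp_all add: n_def)
  have "e \<cdot> g = g" "h \<cdot> e = h" using ob m by simp_all
  then have ng: "n \<cdot> g = zerom C B X" and hn: "h \<cdot> n = zerom C X (fob T A)"
    using ob m by (simp_all add: n_def)
  obtain x where x: "arr x" "dom x = fob T A" "cod x = X" "n = x \<cdot> h"
    using tri_exact [OF t, of n] n ng by auto
  have "n \<cdot> n = x \<cdot> (h \<cdot> n)" by (subst (1) x(4)) (use ob n x in simp)
  then have nn: "n \<cdot> n = zerom C X X" using ob x(1-3) by (simp add: hn)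
  show ?thesis
  proof (rule iso_morI [where g = "idm C X \<boxminus> n"])
    show "(idm C X \<boxminus> n) \<cdot> e = idm C (dom e)" "e \<cdot> (idm C X \<boxminus> n) = idm C (cod e)"
      unfolding e(3,4) using ob n by (simp_all add: e(1) nn minusm_def add_assoc)
  qed (use ob n e(2-4) in simp_all)
qed

text \<open>A comparison map \<open>c'\<close> in the opposite direction makes
  \<open>c' \<cdot> c\<close> and \<open>c \<cdot> c'\<close> self-comparisons over identities. Both
  are invertible by \<open>tri_endo_iso\<close>, so \<open>c\<close> has a left and a right
  inverse.\<close>

lemma tri_five:
  assumes t1: "(A, B, X, f, g, h) \<in> tri" and t2: "(A', B', X', f', g', h') \<in> tri"
    and m: "sextuple_mor C T (A, B, X, f, g, h) (A', B', X', f', g', h') (a, b, c)"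
    and a: "iso_mor C A A' a" and b: "iso_mor C B B' b"
  shows "iso_mor C X X' c"
proof -
  note ob = tri_sextuple [OF t1] tri_sextuple [OF t2]
  obtain a' where a': "arr a'" "dom a' = A'" "cod a' = A" "a' \<cdot> a = idm C A" "a \<cdot> a' = idm C A'"
    using a ob by (elim iso_morE) simp_all
  obtain b' where b': "arr b'" "dom b' = B'" "cod b' = B" "b' \<cdot> b = idm C B" "b \<cdot> b' = idm C B'"
    using b ob by (elim iso_morE) simp_all
  have "b' \<cdot> f' = f \<cdot> a'"
    by (rule square_inverse [of b f f' a]) (use ob m a' b' in simp_all)
  then obtain c' where
    m': "sextuple_mor C T (A', B', X', f', g', h') (A, B, X, f, g, h) (a', b', c')"
    using tri_mor [OF t2 t1, of a' b'] ob a' b' by auto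
  have "iso_mor C X X (c' \<cdot> c)"
    using sextuple_mor_comp [OF ob(1,2,1) m m'] by (intro tri_endo_iso [OF t1]) (simp only: a' b')
  then obtain k where k: "arr k" "dom k = X" "cod k = X" "k \<cdot> (c' \<cdot> c) = idm C X"
    using ob by (elim iso_morE) simp_all
  have "iso_mor C X' X' (c \<cdot> c')"
    using sextuple_mor_comp [OF ob(2,1,2) m' m] by (intro tri_endo_iso [OF t2]) (simp only: a' b')
  then obtain k' where k': "arr k'" "dom k' = X'" "cod k' = X'" "(c \<cdot> c') \<cdot> k' = idm C X'"
    using ob by (elim iso_morE) simp_all
  have c: "arr c" "dom c = X" "cod c = X'" "arr c'" "dom c' = X'" "cod c' = X"
    using ob m m' by simp_all
  show ?thesis
    by (rule iso_two_sided [where g = "k \<cdot> c'" and h = "c' \<cdot> k'"]) (use c k k' in simp_all)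
qed

lemma tri_iso_extend:
  assumes t1: "(A, B, X, f, g, h) \<in> tri" and t2: "(A', B', X', f', g', h') \<in> tri"
    and "iso_mor C A A' a" "iso_mor C B B' b" "b \<cdot> f = f' \<cdot> a"
  obtains c where "sextuple_iso C T (A, B, X, f, g, h) (A', B', X', f', g', h') (a, b, c)"
proof -
  have "a \<in> Mor C A A'" "b \<in> Mor C B B'" using assms by (simp_all add: iso_mor_def)
  then obtain c where c: "sextuple_mor C T (A, B, X, f, g, h) (A', B', X', f', g', h') (a, b, c)"
    using tri_mor [OF t1 t2 _ _ assms(5)] by blast
  show ?thesis using tri_five [OF t1 t2 c assms(3,4)] c assms(3,4) by (intro that [of c]) simp
qed

text \<open>It is enough that every map lies on one triangle whose rotation is a triangle: any other
  triangle on that map is isomorphic to it over identities, and the isomorphism rotates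
  along.\<close>

lemma tri_rotate:
  assumes cone: "\<And>f. arr f \<Longrightarrow> \<exists>X g h. (dom f, cod f, X, f, g, h) \<in> tri \<and>
      (cod f, X, fob T (dom f), g, h, neg (fmor T f)) \<in> tri"
    and t: "(A, B, X, f, g, h) \<in> tri"
  shows "(B, X, fob T A, g, h, neg (fmor T f)) \<in> tri"
proof -
  note ob = tri_sextuple [OF t]
  obtain X' g' h' where t': "(A, B, X', f, g', h') \<in> tri"
    and r: "(B, X', fob T A, g', h', neg (fmor T f)) \<in> tri"
    using cone [of f] ob by auto
  note ob = ob tri_sextuple [OF t']
  have i: "iso_mor C A A (idm C A)" "iso_mor C B B (idm C B)" "idm C B \<cdot> f = f \<cdot> idm C A"
    using ob by simp_all
  obtain c where c: "sextuple_iso C T (A, B, X', f, g', h') (A, B, X, f, g, h) (idm C A, idm C B, c)"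
    by (rule tri_iso_extend [OF t' t i(1,2) i(3)])
  have "sextuple_iso C T (B, X', fob T A, g', h', neg (fmor T f)) (B, X, fob T A, g, h, neg (fmor T f))
      (idm C B, c, idm C (fob T A))"
    using c ob by simp
  then show ?thesis by (rule tri_iso [OF r, rotated]) (use ob in simp)
qed

text \<open>Transport of an octahedron from an isomorphic composable pair: the isomorphisms
  \<open>y\<close> and \<open>u\<close> extend to the three cones.\<close>

lemma tri_octahedral:
  assumes t: "(X, Y, Z, a, b, c) \<in> tri" "(Y, U, V, d, e, f) \<in> tri" "(X, U, W, d \<cdot> a, g, h) \<in> tri"
    and t': "(X, Y', Z', a', b', c') \<in> tri" "(Y', U', V', d', e', f') \<in> tri"
      "(X, U', W', d' \<cdot> a', g', h') \<in> tri"
    and y: "iso_mor C Y Y' y" "a' = y \<cdot> a" and u: "iso_mor C U U' u" "u \<cdot> d = d' \<cdot> y"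
    and oct: "l' \<cdot> b' = g' \<cdot> d'" "h' \<cdot> l' = c'" "i' \<cdot> g' = e'" "f' \<cdot> i' = fmor T a' \<cdot> h'"
      "(Z', W', V', l', i', fmor T b' \<cdot> f') \<in> tri"
  shows "\<exists>l \<in> Mor C Z W. \<exists>i \<in> Mor C W V. l \<cdot> b = g \<cdot> d \<and> h \<cdot> l = c \<and> i \<cdot> g = e \<and>
    f \<cdot> i = fmor T a \<cdot> h \<and> (Z, W, V, l, i, fmor T b \<cdot> f) \<in> tri"
proof -
  note ob = t [THEN tri_sextuple] t' [THEN tri_sextuple] oct(5) [THEN tri_sextuple]
  have arr_yu: "arr y" "dom y = Y" "cod y = Y'" "arr u" "dom u = U" "cod u = U'"
    using y u ob by (auto elim!: iso_morE)
  have X: "iso_mor C X X (idm C X)" using ob by simp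
  have ya: "y \<cdot> a = a' \<cdot> idm C X" and uda: "u \<cdot> (d \<cdot> a) = d' \<cdot> a' \<cdot> idm C X"
    using ob arr_yu by (simp_all add: y(2) cmp_reassoc [OF u(2)])
  obtain z where z: "sextuple_iso C T (X, Y, Z, a, b, c) (X, Y', Z', a', b', c') (idm C X, y, z)"
    by (rule tri_iso_extend [OF t(1) t'(1) X y(1) ya])
  obtain v where v: "sextuple_iso C T (Y, U, V, d, e, f) (Y', U', V', d', e', f') (y, u, v)"
    by (rule tri_iso_extend [OF t(2) t'(2) y(1) u])
  obtain w where w: "sextuple_iso C T (X, U, W, d \<cdot> a, g, h) (X, U', W', d' \<cdot> a', g', h') (idm C X, u, w)"
    by (rule tri_iso_extend [OF t(3) t'(3) X u(1) uda])
  obtain x1 y1 z1 where zi: "sextuple_iso C T (X, Y', Z', a', b', c') (X, Y, Z, a, b, c) (x1, y1, z1)"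
    and zi': "x1 \<cdot> idm C X = idm C X" "idm C X \<cdot> x1 = idm C X" "y1 \<cdot> y = idm C Y"
      "y \<cdot> y1 = idm C Y'" "z1 \<cdot> z = idm C Z" "z \<cdot> z1 = idm C Z'"
    by (rule sextuple_isoE [OF z ob(1,4)])
  obtain y2 u1 v1 where vi: "sextuple_iso C T (Y', U', V', d', e', f') (Y, U, V, d, e, f) (y2, u1, v1)"
    and vi': "y2 \<cdot> y = idm C Y" "y \<cdot> y2 = idm C Y'" "u1 \<cdot> u = idm C U"
      "u \<cdot> u1 = idm C U'" "v1 \<cdot> v = idm C V" "v \<cdot> v1 = idm C V'"
    by (rule sextuple_isoE [OF v ob(2,5)])
  obtain x2 u2 w1 where wi: "sextuple_iso C T (X, U', W', d' \<cdot> a', g', h') (X, U, W, d \<cdot> a, g, h) (x2, u2, w1)"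
    and wi': "x2 \<cdot> idm C X = idm C X" "idm C X \<cdot> x2 = idm C X" "u2 \<cdot> u = idm C U"
      "u \<cdot> u2 = idm C U'" "w1 \<cdot> w = idm C W" "w \<cdot> w1 = idm C W'"
    by (rule sextuple_isoE [OF w ob(3,6)])
  have z1: "arr z1" "dom z1 = Z'" "cod z1 = Z" "arr y1" "dom y1 = Y'" "cod y1 = Y"
    using zi ob(1,4) by simp_all
  have z1eq: "z1 \<cdot> z = idm C Z" "z \<cdot> z1 = idm C Z'" "y1 \<cdot> y = idm C Y" "z1 \<cdot> b' = b \<cdot> y1"
    using zi zi' by (simp_all only: sextuple_iso.simps sextuple_mor.simps)
  have v1: "arr v1" "dom v1 = V'" "cod v1 = V" "arr y2" "dom y2 = Y'" "cod y2 = Y"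
    using vi ob(2,5) by simp_all
  have v1eq: "v1 \<cdot> v = idm C V" "v \<cdot> v1 = idm C V'" "y2 \<cdot> y = idm C Y" "y \<cdot> y2 = idm C Y'"
      "fmor T y2 \<cdot> f' = f \<cdot> v1"
    using vi vi' by (simp_all only: sextuple_iso.simps sextuple_mor.simps)
  have w1: "arr w1" "dom w1 = W'" "cod w1 = W" "arr x2" "dom x2 = X" "cod x2 = X"
    using wi ob(3,6) by simp_all
  \<comment> \<open>\<open>x2\<close> is the inverse of an identity, so the first component
    disappears from the last square.\<close>
  have "x2 = idm C X" using wi'(1) w1 by simp
  moreover have "fmor T x2 \<cdot> h' = h \<cdot> w1"
    using wi by (simp only: sextuple_iso.simps sextuple_mor.simps)
  ultimately have w1eq: "w1 \<cdot> w = idm C W" "w \<cdot> w1 = idm C W'" "h \<cdot> w1 = h'"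
    using ob(6) wi'(5,6) by simp_all
  have zvw: "arr z" "dom z = Z" "cod z = Z'" "arr v" "dom v = V" "cod v = V'"
    "arr w" "dom w = W" "cod w = W'"
    using z v w ob by simp_all
  have sq: "z \<cdot> b = b' \<cdot> y" "c' \<cdot> z = c" "e' \<cdot> u = v \<cdot> e" "w \<cdot> g = g' \<cdot> u" "h' \<cdot> w = h"
    using z v w ob by simp_all
  note sq' = sq(4) [symmetric] u(2) [symmetric]
  \<comment> \<open>These inverses of \<open>y\<close> come from two different triangles; the map
    \<open>fmor T b \<cdot> f\<close> meets both, so they must be identified.\<close>
  have y12: "y1 = y2"
    using z1 v1 arr_yu ob cmp_reassoc [OF z1eq(3), of y2] v1eq(4) by simp
  \<comment> \<open>\<open>l'\<close> and \<open>i'\<close> are conjugated by the comparison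
    isomorphisms \<open>z\<close>, \<open>w\<close> and \<open>v\<close> of the cones.\<close>
  define l where "l = w1 \<cdot> (l' \<cdot> z)"
  define i where "i = v1 \<cdot> (i' \<cdot> w)"
  have li: "arr l" "dom l = Z" "cod l = W" "arr i" "dom i = W" "cod i = V"
    using ob z1 v1 w1 zvw by (simp_all add: l_def i_def)
  have "l \<cdot> b = g \<cdot> d"
    using ob z1 v1 w1 zvw arr_yu
    by (simp add: l_def sq(1) cmp_reassoc [OF oct(1)] sq' cmp_reassoc [OF sq'(1)] cmp_reassoc [OF w1eq(1)])
  moreover have "h \<cdot> l = c"
    using ob z1 v1 w1 zvw arr_yu
    by (simp add: l_def cmp_reassoc [OF w1eq(3)] cmp_reassoc [OF oct(2)] sq)
  moreover have "i \<cdot> g = e"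
    using ob z1 v1 w1 zvw arr_yu
    by (simp add: i_def sq cmp_reassoc [OF oct(3)] cmp_reassoc [OF v1eq(1)])
  moreover have "f \<cdot> i = fmor T a \<cdot> h"
  proof -
    have Ty: "fmor T y2 \<cdot> fmor T y = idm C (fob T Y)"
      using ob v1 arr_yu by (simp add: v1eq flip: T_cmp)
    show ?thesis
      using ob z1 v1 w1 zvw arr_yu
      by (simp add: i_def cmp_reassoc [OF v1eq(5) [symmetric]] cmp_reassoc [OF oct(4)] sq y(2)
          cmp_reassoc [OF Ty])
  qed
  moreover have "(Z, W, V, l, i, fmor T b \<cdot> f) \<in> tri"
  proof (rule tri_iso [OF oct(5)])
    have "fmor T z1 \<cdot> fmor T b' = fmor T b \<cdot> fmor T y2"
      using ob z1 v1 arr_yu by (simp add: z1eq y12 flip: T_cmp)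
    note Tz = cmp_reassoc [OF this]
    have "iso_mor C Z' Z z1" by (rule iso_morI [of _ z]) (use z1 zvw z1eq in simp_all)
    moreover have "iso_mor C W' W w1" by (rule iso_morI [of _ w]) (use w1 zvw w1eq in simp_all)
    moreover have "iso_mor C V' V v1" by (rule iso_morI [of _ v]) (use v1 zvw v1eq in simp_all)
    ultimately show "sextuple_iso C T (Z', W', V', l', i', fmor T b' \<cdot> f')
        (Z, W, V, l, i, fmor T b \<cdot> f) (z1, w1, v1)"
      using ob z1 v1 w1 zvw arr_yu by (simp add: l_def i_def z1eq w1eq v1eq Tz)
  qed (use ob li in simp)
  moreover have "l \<in> Mor C Z W" "i \<in> Mor C W V" using ob li by simp_all
  ultimately show ?thesis by blast
qed

text \<open>One choice of the three cones is enough here; \<open>tri_octahedral\<close> passes from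
  it to any other choice.\<close>

definition octahedron :: "'o \<Rightarrow> 'o \<Rightarrow> 'o \<Rightarrow> 'm \<Rightarrow> 'm \<Rightarrow> bool" where
  "octahedron X Y U a d \<longleftrightarrow> (\<exists>Z b c V e f W g h l i. (X, Y, Z, a, b, c) \<in> tri \<and>
    (Y, U, V, d, e, f) \<in> tri \<and> (X, U, W, d \<cdot> a, g, h) \<in> tri \<and>
    l \<cdot> b = g \<cdot> d \<and> h \<cdot> l = c \<and> i \<cdot> g = e \<and> f \<cdot> i = fmor T a \<cdot> h \<and>
    (Z, W, V, l, i, fmor T b \<cdot> f) \<in> tri)"

text \<open>The premise on composable pairs may change the second and third objects up to
  isomorphism but keeps the first: this is the freedom used when maps are made
  \<open>D\<close>-monic.\<close>

lemma right_triangulatedI: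
  assumes add: "additive_category C"
    and zero: "zero_object C N"
      "\<And>A. A \<in> Ob C \<Longrightarrow> (N, A, A, zerom C N A, idm C A, zerom C A (fob T N)) \<in> tri"
    and cone: "\<And>f. arr f \<Longrightarrow> \<exists>X g h. (dom f, cod f, X, f, g, h) \<in> tri \<and>
      (cod f, X, fob T (dom f), g, h, neg (fmor T f)) \<in> tri"
    and oct: "\<And>a d. \<lbrakk>arr a; arr d; dom d = cod a\<rbrakk> \<Longrightarrow> \<exists>Y U y u d'. iso_mor C (cod a) Y y \<and>
      iso_mor C (cod d) U u \<and> u \<cdot> d = d' \<cdot> y \<and> octahedron (dom a) Y U (y \<cdot> a) d'"
  shows "right_triangulated_category C T tri"
proof -
  interpret additive_category C by (rule add)
  show ?thesis
  proof (unfold_locales, goal_cases)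
    case 1
    show ?case by (rule shift)
  next
    case (2 t)
    then show ?case by (rule tri_sextuple)
  next
    case (3 t t' u)
    then show ?case by (rule tri_iso)
  next
    case (4 N' A)
    have N: "N \<in> Ob C" "N' \<in> Ob C" using zero(1) 4(1) by (auto simp: zero_object_def)
    have "sextuple_iso C T (N, A, A, zerom C N A, idm C A, zerom C A (fob T N))
        (N', A, A, zerom C N' A, idm C A, zerom C A (fob T N')) (zerom C N N', idm C A, idm C A)"
      using N 4(2) iso_zero_objects [OF zero(1) 4(1)] by simp
    then show ?case by (rule tri_iso [OF zero(2) [OF 4(2)], rotated]) (use N 4(2) in simp)
  next
    case (5 A B f)
    then show ?case using cone [of f] by auto
  next
    case (6 A B X f g h)
    then show ?case using tri_rotate [OF cone 6] tri_sextuple [OF 6] by simp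
  next
    case (7 A B X f g h A' B' X' f' g' h' a b)
    then show ?case by (rule tri_mor)
  next
    case (8 X Y Z a b c U V d e f W g h)
    note ob = 8 [THEN tri_sextuple]
    obtain Y' U' y u d' where y: "iso_mor C Y Y' y" and u: "iso_mor C U U' u" "u \<cdot> d = d' \<cdot> y"
      and o: "octahedron X Y' U' (y \<cdot> a) d'"
      using oct [of a d] ob by auto
    obtain Z' b' c' V' e' f' W' g' h' l' i' where
      t: "(X, Y', Z', y \<cdot> a, b', c') \<in> tri" "(Y', U', V', d', e', f') \<in> tri"
        "(X, U', W', d' \<cdot> (y \<cdot> a), g', h') \<in> tri"
      and o: "l' \<cdot> b' = g' \<cdot> d'" "h' \<cdot> l' = c'" "i' \<cdot> g' = e'" "f' \<cdot> i' = fmor T (y \<cdot> a) \<cdot> h'"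
        "(Z', W', V', l', i', fmor T b' \<cdot> f') \<in> tri"
      using o unfolding octahedron_def by blast
    show ?case by (rule tri_octahedral [OF 8 t y refl u o])
  qed
qed

end

section \<open>Biproducts and the quotient by an ideal\<close>

context preadditive_category
begin

definition biproduct :: "'o \<Rightarrow> 'o \<Rightarrow> 'o \<Rightarrow> 'm \<Rightarrow> 'm \<Rightarrow> 'm \<Rightarrow> 'm \<Rightarrow> bool" where
  "biproduct A B X i j p q \<longleftrightarrow> A \<in> Ob C \<and> B \<in> Ob C \<and> X \<in> Ob C \<and>
    arr i \<and> dom i = A \<and> cod i = X \<and> arr j \<and> dom j = B \<and> cod j = X \<and>
    arr p \<and> dom p = X \<and> cod p = A \<and> arr q \<and> dom q = X \<and> cod q = B \<and>
    p \<cdot> i = idm C A \<and> q \<cdot> j = idm C B \<and> p \<cdot> j = zerom C B A \<and> q \<cdot> i = zerom C A B \<and>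
    i \<cdot> p \<boxplus> j \<cdot> q = idm C X"

end

context additive_category
begin

text \<open>The empty direct sum: its identity is an empty sum, hence zero, and closure under direct
  sums puts it into every subcategory.\<close>

lemma exists_zero_object:
  obtains N where "zero_object C N" "\<And>D. subcategory C D \<Longrightarrow> N \<in> D"
proof -
  obtain N i p where N: "direct_sum C 0 X N i p" for X
    using has_direct_sums [of 0] unfolding direct_sum_def by auto
  then have ob: "N \<in> Ob C" by (simp add: direct_sum_def)
  interpret ring "end_ring C N" by (rule ring_end_ring [OF ob])
  have "idm C N = zerom C N N"
    using N [of undefined] finsum_empty by (simp add: direct_sum_def) (simp add: end_ring_def)
  moreover have "N \<in> D" if "subcategory C D" for D
    using that N unfolding subcategory_def by blast
  ultimately show ?thesis using that zero_objectI [OF ob] by blast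
qed

lemma exists_biproduct:
  assumes "A \<in> Ob C" "B \<in> Ob C"
  obtains X i j p q where "biproduct A B X i j p q"
    "\<And>D. \<lbrakk>subcategory C D; A \<in> D; B \<in> D\<rbrakk> \<Longrightarrow> X \<in> D"
proof -
  define Y where "Y k = (if k = 0 then A else B)" for k :: nat
  have "Y k \<in> Ob C" for k using assms by (simp add: Y_def)
  then obtain X i p where s: "direct_sum C 2 Y X i p"
    using has_direct_sums [of 2 Y] by blast
  then have ob: "X \<in> Ob C" by (simp add: direct_sum_def)
  interpret ring "end_ring C X" by (rule ring_end_ring [OF ob])
  have k: "Y k \<in> Ob C \<and> i k \<in> Mor C (Y k) X \<and> p k \<in> Mor C X (Y k)" if "k < 2" for k
    using s that unfolding direct_sum_def by blast
  have ip: "arr (i 0)" "dom (i 0) = A" "cod (i 0) = X" "arr (i 1)" "dom (i 1) = B" "cod (i 1) = X"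
    "arr (p 0)" "dom (p 0) = X" "cod (p 0) = A" "arr (p 1)" "dom (p 1) = X" "cod (p 1) = B"
    using k [of 0] k [of 1] assms ob by (simp_all add: Y_def)
  have "finsum (end_ring C X) (\<lambda>k. i k \<cdot> p k) {..<2} = idm C X"
    using s by (simp add: direct_sum_def)
  moreover have "{..<2} = {0, 1::nat}" by auto
  moreover have "finsum (end_ring C X) (\<lambda>k. i k \<cdot> p k) {0, 1::nat} = i 0 \<cdot> p 0 \<boxplus> i 1 \<cdot> p 1"
  proof -
    have e: "carrier (end_ring C X) = Mor C X X" "add (end_ring C X) = addm C"
      "zero (end_ring C X) = zerom C X X"
      by (simp_all add: end_ring_def)
    show ?thesis using ip ob by (simp add: Pi_def e)
  qed
  ultimately have sum: "i 0 \<cdot> p 0 \<boxplus> i 1 \<cdot> p 1 = idm C X" by simp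
  have "p j \<cdot> i k = (if j = k then idm C (Y k) else zerom C (Y k) (Y j))" if "j < 2" "k < 2" for j k
    using s that unfolding direct_sum_def by blast
  from this [of 0 0] this [of 1 1] this [of 0 1] this [of 1 0]
  have "biproduct A B X (i 0) (i 1) (p 0) (p 1)"
    using ip sum assms ob by (simp add: biproduct_def Y_def)
  moreover have "X \<in> D" if "subcategory C D" "A \<in> D" "B \<in> D" for D
    using that(1) s that(2,3) unfolding subcategory_def by (metis Y_def)
  ultimately show ?thesis by (rule that)
qed

end

locale ideal_quotient = additive_category C
  for C :: "('o, 'm) addcat" (structure) +
  fixes Z D :: "'o set"
  assumes Z_sub: "subcategory C Z" and D_sub: "subcategory C D" and D_Z: "D \<subseteq> Z"
begin

section \<open>Morphisms factoring through \<open>D\<close>\<close>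

lemma Z_ob [simp]: "X \<in> Z \<Longrightarrow> X \<in> Ob C"
  using Z_sub by (auto simp: subcategory_def)

lemma D_in_Z [simp]: "X \<in> D \<Longrightarrow> X \<in> Z"
  using D_Z by auto

text \<open>Membership in the ideal \<open>fac\<close>, with source and target read off the
  morphism.\<close>

definition null :: "'m \<Rightarrow> bool" where
  "null f \<longleftrightarrow> (\<exists>s t. arr s \<and> arr t \<and> dom s = cod t \<and> cod t \<in> D \<and> f = s \<cdot> t)"

lemma nullI: "\<lbrakk>arr s; arr t; dom s = cod t; cod t \<in> D\<rbrakk> \<Longrightarrow> null (s \<cdot> t)"
  unfolding null_def by blast

lemma nullE:
  assumes "null f"
  obtains s t where "arr s" "arr t" "dom s = cod t" "cod t \<in> D" "f = s \<cdot> t" "dom t = dom f" "cod s = cod f"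
  using assms unfolding null_def by auto

lemma null_arr: "null f \<Longrightarrow> arr f"
  by (auto simp: null_def)

lemma fac_iff:
  assumes "X \<in> Ob C" "Y \<in> Ob C"
  shows "f \<in> fac C D X Y \<longleftrightarrow> null f \<and> dom f = X \<and> cod f = Y"
proof
  assume "f \<in> fac C D X Y"
  then show "null f \<and> dom f = X \<and> cod f = Y"
    using assms unfolding fac_def by (auto intro: nullI)
next
  assume f: "null f \<and> dom f = X \<and> cod f = Y"
  obtain s t where st: "arr s" "arr t" "dom s = cod t" "cod t \<in> D" "f = s \<cdot> t" "dom t = dom f" "cod s = cod f"
    by (rule nullE [of f]) (use f in simp)
  have "t \<in> Mor C X (cod t)" "s \<in> Mor C (cod t) Y"
    using f st(1-4,6,7) assms by simp_all
  then show "f \<in> fac C D X Y" unfolding fac_def using st(4,5) by blast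
qed

lemma null_cmp_left:
  assumes "null f" "arr g" "dom g = cod f" shows "null (g \<cdot> f)"
proof -
  obtain s t where f: "arr s" "arr t" "dom s = cod t" "cod t \<in> D" "f = s \<cdot> t" "cod s = cod f"
    by (rule nullE [OF assms(1)])
  have gs: "dom g = cod s" using f(6) assms by simp
  have "null ((g \<cdot> s) \<cdot> t)" by (rule nullI) (use f(1-4) gs assms(2) in simp_all)
  then show ?thesis unfolding f(5) using f(1-4) gs assms(2) by simp
qed

lemma null_cmp_right:
  assumes "null g" "arr f" "dom g = cod f" shows "null (g \<cdot> f)"
proof -
  obtain s t where g: "arr s" "arr t" "dom s = cod t" "cod t \<in> D" "g = s \<cdot> t" "dom t = dom g"
    by (rule nullE [OF assms(1)])
  have tf: "dom t = cod f" using g(6) assms by simp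
  have "null (s \<cdot> (t \<cdot> f))" by (rule nullI) (use g(1-4) tf assms(2) in simp_all)
  then show ?thesis unfolding g(5) using g(1-4) tf assms(2) by simp
qed

lemma null_zero [simp]:
  assumes "X \<in> Ob C" "Y \<in> Ob C" shows "null (zerom C X Y)"
proof -
  obtain N where N: "N \<in> D" using exists_zero_object D_sub by blast
  then have "zerom C X Y = zerom C N Y \<cdot> zerom C X N" using assms by simp
  then show ?thesis using assms N by (simp only:) (rule nullI; simp)
qed

text \<open>The sum factors through the biproduct of the two intermediate objects, which lies in
  \<open>D\<close>.\<close>

lemma null_add:
  assumes "null f" "null g" "dom f = dom g" "cod f = cod g"
  shows "null (f \<boxplus> g)"
proof -
  obtain s t where f: "arr s" "arr t" "dom s = cod t" "cod t \<in> D" "f = s \<cdot> t" "dom t = dom f" "cod s = cod f"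
    by (rule nullE [OF assms(1)])
  obtain s' t' where g: "arr s'" "arr t'" "dom s' = cod t'" "cod t' \<in> D" "g = s' \<cdot> t'" "dom t' = dom g" "cod s' = cod g"
    by (rule nullE [OF assms(2)])
  obtain X i j p q where b: "biproduct (cod t) (cod t') X i j p q" and "X \<in> D"
    by (rule exists_biproduct [of "cod t" "cod t'"]) (use f(1-4) g(1-4) D_sub in auto)
  have eqs: "dom t = dom t'" "cod s = cod s'" using f(6,7) g(6,7) assms(3,4) by simp_all
  note bi = b [unfolded biproduct_def]
  have bi': "p \<cdot> i = idm C (cod t)" "q \<cdot> j = idm C (cod t')" "p \<cdot> j = zerom C (cod t') (cod t)"
    "q \<cdot> i = zerom C (cod t) (cod t')" using bi by simp_all
  have "(s \<cdot> p \<boxplus> s' \<cdot> q) \<cdot> (i \<cdot> t \<boxplus> j \<cdot> t') = f \<boxplus> g"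
    unfolding f(5) g(5) using f(1-4) g(1-4) bi eqs
    by (simp add: cmp_reassoc [OF bi'(1)] cmp_reassoc [OF bi'(2)] cmp_reassoc [OF bi'(3)] cmp_reassoc [OF bi'(4)])
  moreover have "null ((s \<cdot> p \<boxplus> s' \<cdot> q) \<cdot> (i \<cdot> t \<boxplus> j \<cdot> t'))"
    by (rule nullI) (use f(1-4) g(1-4) bi eqs \<open>X \<in> D\<close> in simp_all)
  ultimately show ?thesis by simp
qed

lemma null_neg:
  assumes "null f" shows "null (neg f)"
proof -
  have "neg f = neg (idm C (cod f)) \<cdot> f" using null_arr [OF assms] by simp
  then show ?thesis
    using null_cmp_left [OF assms, of "neg (idm C (cod f))"] null_arr [OF assms] by simp
qed

section \<open>Classes modulo \<open>D\<close> and the quotient category\<close>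

abbreviation Q :: "('o, 'm set) addcat" where
  "Q \<equiv> quotient_cat C Z D"

lemma cls_eq: "arr f \<Longrightarrow> cls C D f = {f \<boxplus> d | d. null d \<and> dom d = dom f \<and> cod d = cod f}"
proof -
  assume f: "arr f"
  have "cls C D f = {f \<boxplus> d | d. d \<in> fac C D (dom f) (cod f)}"
  proof (intro equalityI subsetI)
    fix g assume "g \<in> cls C D f"
    then show "g \<in> {f \<boxplus> d | d. d \<in> fac C D (dom f) (cod f)}" unfolding cls_def by auto
  next
    fix g assume "g \<in> {f \<boxplus> d | d. d \<in> fac C D (dom f) (cod f)}"
    then show "g \<in> cls C D f" using arr_mor [OF f] arr_obj [OF f] unfolding cls_def by blast
  qed
  then show ?thesis using f by (simp add: fac_iff)
qed

lemma in_cls_iff: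
  assumes "arr f"
  shows "g \<in> cls C D f \<longleftrightarrow> arr g \<and> dom g = dom f \<and> cod g = cod f \<and> null (g \<boxminus> f)"
proof
  assume "g \<in> cls C D f"
  then obtain d where d: "null d" "dom d = dom f" "cod d = cod f" and g: "g = f \<boxplus> d"
    using assms by (auto simp: cls_eq)
  have "g \<boxminus> f = d"
    unfolding g using d null_arr [OF d(1)] assms by (subst minus_eq_iff) (simp_all add: add_comm)
  then show "arr g \<and> dom g = dom f \<and> cod g = cod f \<and> null (g \<boxminus> f)"
    using d null_arr [OF d(1)] assms by (simp add: g)
next
  assume g: "arr g \<and> dom g = dom f \<and> cod g = cod f \<and> null (g \<boxminus> f)"
  then have "g = f \<boxplus> (g \<boxminus> f)" using assms by simp
  then show "g \<in> cls C D f" using g assms unfolding cls_eq [OF assms] by force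
qed

lemma in_cls [simp]: "arr f \<Longrightarrow> f \<in> cls C D f"
  by (simp add: in_cls_iff)

lemma cls_eqI:
  assumes "arr f" "arr g" "dom f = dom g" "cod f = cod g" "null (f \<boxminus> g)"
  shows "cls C D f = cls C D g"
proof -
  have sub: "cls C D f \<subseteq> cls C D g"
    if "arr f" "arr g" "dom f = dom g" "cod f = cod g" "null (f \<boxminus> g)" for f g
  proof
    fix h assume "h \<in> cls C D f"
    then have h: "arr h" "dom h = dom f" "cod h = cod f" "null (h \<boxminus> f)"
      using that by (simp_all add: in_cls_iff)
    have "null ((h \<boxminus> f) \<boxplus> (f \<boxminus> g))" by (rule null_add) (use h that in simp_all)
    also have "(h \<boxminus> f) \<boxplus> (f \<boxminus> g) = h \<boxminus> g"
      using h that by (simp add: minusm_def add_assoc)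
    finally show "h \<in> cls C D g" using h that by (simp add: in_cls_iff)
  qed
  have "g \<boxminus> f = neg (f \<boxminus> g)"
    using assms add_comm [of g "neg f"] by (simp add: minusm_def)
  then have "null (g \<boxminus> f)" using null_neg assms(5) by simp
  then show ?thesis using sub [of f g] sub [of g f] assms by auto
qed

lemma cls_eq_iff:
  assumes "arr f" "arr g"
  shows "cls C D f = cls C D g \<longleftrightarrow> dom f = dom g \<and> cod f = cod g \<and> null (f \<boxminus> g)"
proof
  assume "cls C D f = cls C D g"
  then have "f \<in> cls C D g" using in_cls [OF assms(1)] by simp
  then show "dom f = dom g \<and> cod f = cod g \<and> null (f \<boxminus> g)" using assms(2) by (simp add: in_cls_iff)
qed (use assms cls_eqI in blast)

lemma null_iff_cls: "arr f \<Longrightarrow> cls C D f = cls C D (zerom C (dom f) (cod f)) \<longleftrightarrow> null f"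
  by (simp add: cls_eq_iff minusm_def)

text \<open>For other representatives, \<open>g' \<cdot> f' - g \<cdot> f\<close> equals
  \<open>g' \<cdot> (f' - f) + (g' - g) \<cdot> f\<close> and factors through \<open>D\<close>. The
  union over representatives is thus a union of equal classes over nonempty index sets.\<close>

lemma Q_cmp [simp]:
  assumes "arr f" "arr g" "dom g = cod f"
  shows "cmp Q (cls C D g) (cls C D f) = cls C D (g \<cdot> f)"
proof -
  have "cls C D (g' \<cdot> f') = cls C D (g \<cdot> f)" if "g' \<in> cls C D g" "f' \<in> cls C D f" for g' f'
  proof -
    have g': "arr g'" "dom g' = dom g" "cod g' = cod g" "null (g' \<boxminus> g)"
      and f': "arr f'" "dom f' = dom f" "cod f' = cod f" "null (f' \<boxminus> f)"
      using that assms by (simp_all add: in_cls_iff)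
    have "null (g' \<cdot> (f' \<boxminus> f) \<boxplus> (g' \<boxminus> g) \<cdot> f)"
      by (intro null_add null_cmp_left null_cmp_right) (use g' f' assms in simp_all)
    also have "g' \<cdot> (f' \<boxminus> f) \<boxplus> (g' \<boxminus> g) \<cdot> f = g' \<cdot> f' \<boxminus> g \<cdot> f"
      using g' f' assms by (simp add: minusm_def add_assoc)
    finally show ?thesis using g' f' assms by (intro cls_eqI) simp_all
  qed
  then have "(\<Union>g' \<in> cls C D g. \<Union>f' \<in> cls C D f. cls C D (g' \<cdot> f')) =
      (\<Union>g' \<in> cls C D g. \<Union>f' \<in> cls C D f. cls C D (g \<cdot> f))"
    by (intro SUP_cong refl)
  moreover have "cls C D g \<noteq> {}" "cls C D f \<noteq> {}" using assms in_cls by blast+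
  ultimately show ?thesis by (simp add: quotient_cat_def)
qed

lemma Q_add [simp]:
  assumes "arr f" "arr g" "dom f = dom g" "cod f = cod g"
  shows "addm Q (cls C D f) (cls C D g) = cls C D (f \<boxplus> g)"
proof -
  have "cls C D (f' \<boxplus> g') = cls C D (f \<boxplus> g)" if "g' \<in> cls C D g" "f' \<in> cls C D f" for g' f'
  proof -
    have g': "arr g'" "dom g' = dom g" "cod g' = cod g" "null (g' \<boxminus> g)"
      and f': "arr f'" "dom f' = dom f" "cod f' = cod f" "null (f' \<boxminus> f)"
      using that assms by (simp_all add: in_cls_iff)
    have "null ((f' \<boxminus> f) \<boxplus> (g' \<boxminus> g))"
      by (intro null_add) (use g' f' assms in simp_all)
    also have "(f' \<boxminus> f) \<boxplus> (g' \<boxminus> g) = (f' \<boxplus> g') \<boxminus> (f \<boxplus> g)"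
      using g' f' assms by (simp add: minusm_def add_assoc add_left_comm [of "neg f" g'])
    finally show ?thesis using g' f' assms by (intro cls_eqI) simp_all
  qed
  then have "(\<Union>f' \<in> cls C D f. \<Union>g' \<in> cls C D g. cls C D (f' \<boxplus> g')) =
      (\<Union>f' \<in> cls C D f. \<Union>g' \<in> cls C D g. cls C D (f \<boxplus> g))"
    by (intro SUP_cong refl)
  moreover have "cls C D g \<noteq> {}" "cls C D f \<noteq> {}" using assms in_cls by blast+
  ultimately show ?thesis by (simp add: quotient_cat_def)
qed

lemma Q_ob [simp]: "Ob Q = Z"
  and Q_id [simp]: "idm Q X = cls C D (idm C X)"
  and Q_zero [simp]: "zerom Q X Y = cls C D (zerom C X Y)"
  by (simp_all add: quotient_cat_def)

lemma Q_mor: "Mor Q X Y = cls C D ` Mor C X Y"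
  by (simp add: quotient_cat_def)

lemma Q_morE:
  assumes "F \<in> Mor Q X Y" "X \<in> Z" "Y \<in> Z"
  obtains f where "arr f" "dom f = X" "cod f = Y" "F = cls C D f"
  using assms by (auto simp: Q_mor)

lemma Q_morI: "\<lbrakk>arr f; dom f = X; cod f = Y\<rbrakk> \<Longrightarrow> cls C D f \<in> Mor Q X Y"
  unfolding Q_mor by (rule imageI) auto

lemma preadditive_Q: "preadditive_category Q"
proof (rule preadditive_category.intro, goal_cases)
  case (1 X Y X' Y' f)
  then show ?case by (auto elim!: Q_morE simp: cls_eq_iff)
next
  case (6 X Y Z W f g h)
  then show ?case by (auto elim!: Q_morE)
next
  case (7 X Y)
  show ?case
  proof (rule comm_groupI, goal_cases)
    case (6 F)
    with 7 obtain f where "arr f" "dom f = X" "cod f = Y" "F = cls C D f"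
      by (auto simp: hom_group_def elim!: Q_morE)
    then show ?case
      using 7 by (intro bexI [of _ "cls C D (neg f)"]) (auto simp: hom_group_def intro: Q_morI)
  next
    case (4 F G)
    then obtain f g where "arr f" "dom f = X" "cod f = Y" "F = cls C D f"
      "arr g" "dom g = X" "cod g = Y" "G = cls C D g"
      using 7 by (auto simp: hom_group_def elim!: Q_morE)
    then show ?case by (simp add: hom_group_def add_comm)
  qed (use 7 in \<open>auto simp: hom_group_def add_assoc elim!: Q_morE intro!: Q_morI\<close>)
qed (auto elim!: Q_morE intro!: Q_morI)

sublocale Q: preadditive_category Q
  by (rule preadditive_Q)

lemma Q_arrE:
  assumes "Q.arr F"
  obtains f where "arr f" "dom f \<in> Z" "cod f \<in> Z" "F = cls C D f"
    "Q.dom F = dom f" "Q.cod F = cod f"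
proof -
  have F: "F \<in> Mor Q (Q.dom F) (Q.cod F)" and Z: "Q.dom F \<in> Z" "Q.cod F \<in> Z"
    using Q.arr_mor [OF assms] Q.arr_obj [OF assms] by simp_all
  obtain f where "arr f" "dom f = Q.dom F" "cod f = Q.cod F" "F = cls C D f"
    by (rule Q_morE [OF F Z])
  then show ?thesis using that Z by metis
qed

lemma Q_cls [simp]:
  assumes "arr f" "dom f \<in> Z" "cod f \<in> Z"
  shows "Q.arr (cls C D f)" "Q.dom (cls C D f) = dom f" "Q.cod (cls C D f) = cod f"
proof -
  have "cls C D f \<in> Mor Q (dom f) (cod f)" using assms by (intro Q_morI) auto
  then show "Q.arr (cls C D f)" "Q.dom (cls C D f) = dom f" "Q.cod (cls C D f) = cod f"
    using assms by simp_all
qed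

lemma Q_neg [simp]:
  assumes "arr f" "dom f \<in> Z" "cod f \<in> Z"
  shows "Q.neg (cls C D f) = cls C D (neg f)"
  by (rule Q.neg_unique [symmetric]) (use assms in simp_all)

lemma Q_finsum:
  assumes "finite K" "\<And>k. k \<in> K \<Longrightarrow> arr (f k) \<and> dom (f k) = X \<and> cod (f k) = X" "X \<in> Z"
  shows "finsum (end_ring Q X) (\<lambda>k. cls C D (f k)) K = cls C D (finsum (end_ring C X) f K)"
proof -
  have X: "X \<in> Ob C" "X \<in> Ob Q" using assms(3) by simp_all
  interpret R: ring "end_ring C X" by (rule ring_end_ring [OF X(1)])
  interpret S: ring "end_ring Q X" by (rule Q.ring_end_ring [OF X(2)])
  have e: "carrier (end_ring C X) = Mor C X X" "add (end_ring C X) = addm C"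
    "zero (end_ring C X) = zerom C X X" "carrier (end_ring Q X) = Mor Q X X"
    "add (end_ring Q X) = addm Q" "zero (end_ring Q X) = zerom Q X X"
    by (simp_all add: end_ring_def)
  \<comment> \<open>The typing of the partial sums is carried along in the induction, since
    \<open>Q_add\<close> needs it.\<close>
  have "finsum (end_ring Q X) (\<lambda>k. cls C D (f k)) K = cls C D (finsum (end_ring C X) f K) \<and>
    arr (finsum (end_ring C X) f K) \<and> dom (finsum (end_ring C X) f K) = X \<and>
      cod (finsum (end_ring C X) f K) = X"
    using assms(1,2)
  proof (induction K rule: finite_induct)
    case empty
    show ?case using X by (simp add: e)
  next
    case (insert k K)
    then show ?case using X assms(3) by (simp add: e Pi_def)
  qed
  then show ?thesis by blast
qed

lemma additive_Q: "additive_category Q"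
proof unfold_locales
  fix n and X :: "nat \<Rightarrow> 'o"
  assume "\<And>k. k < n \<Longrightarrow> X k \<in> Ob Q"
  then have X: "X k \<in> Z" if "k < n" for k using that by simp
  then obtain B i p where B: "direct_sum C n X B i p" using has_direct_sums [of n X] by auto
  then have BZ: "B \<in> Z" using Z_sub X unfolding subcategory_def by blast
  have k: "X k \<in> Ob C \<and> i k \<in> Mor C (X k) B \<and> p k \<in> Mor C B (X k)" if "k < n" for k
    using B that unfolding direct_sum_def by blast
  have ip: "arr (i k)" "dom (i k) = X k" "cod (i k) = B" "arr (p k)" "dom (p k) = B" "cod (p k) = X k"
    if "k < n" for k using k [OF that] X [OF that] BZ by simp_all
  have pi: "p j \<cdot> i k = (if j = k then idm C (X k) else zerom C (X k) (X j))" if "j < n" "k < n" for j k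
    using B that unfolding direct_sum_def by blast
  have sum: "finsum (end_ring C B) (\<lambda>k. i k \<cdot> p k) {..<n} = idm C B"
    using B unfolding direct_sum_def by blast
  have "finsum (end_ring Q B) (\<lambda>k. cmp Q (cls C D (i k)) (cls C D (p k))) {..<n} =
      finsum (end_ring Q B) (\<lambda>k. cls C D (i k \<cdot> p k)) {..<n}"
  proof -
    interpret S: ring "end_ring Q B" by (rule Q.ring_end_ring) (use BZ in simp)
    show ?thesis
    proof (rule S.finsum_cong')
      show "(\<lambda>k. cls C D (i k \<cdot> p k)) \<in> {..<n} \<rightarrow> carrier (end_ring Q B)"
        using ip by (auto simp: end_ring_def intro!: Q_morI)
    qed (use ip in auto)
  qed
  also have "\<dots> = cls C D (idm C B)"
    using Q_finsum [of "{..<n}" "\<lambda>k. i k \<cdot> p k" B] ip BZ by (simp add: sum)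
  finally have "direct_sum Q n X B (\<lambda>k. cls C D (i k)) (\<lambda>k. cls C D (p k))"
    unfolding direct_sum_def using X BZ ip pi by (auto intro!: Q_morI)
  then show "\<exists>S i p. direct_sum Q n X S i p" by blast
qed

end

section \<open>Exactness in right triangulated categories\<close>

sublocale right_triangulated_category \<subseteq> shifted_category C T
  by unfold_locales (rule shift_additive)

context right_triangulated_category
begin

text \<open>TR4 compares the triangle with
  \<open>0 \<rightarrow> E \<rightarrow> E \<rightarrow> T 0\<close> on the target \<open>E\<close>
  of \<open>u\<close>; the third component is the factorization.\<close>

lemma weak_cokernel:
  assumes t: "(A, B, X, f, g, h) \<in> \<Sigma>" and u: "arr u" "dom u = B" "u \<cdot> f = zerom C A (cod u)"
  obtains x where "arr x" "dom x = X" "cod x = cod u" "u = x \<cdot> g"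
proof -
  note ob = sextuples [OF t]
  obtain N where N: "zero_object C N" by (rule exists_zero_object)
  then have N': "N \<in> Ob C" by (simp add: zero_object_def)
  have "zerom C A N \<in> Mor C A N" "u \<in> Mor C B (cod u)" "u \<cdot> f = zerom C N (cod u) \<cdot> zerom C A N"
    using ob u N' by simp_all
  from TR4 [OF t TR1 [OF N arr_obj(2) [OF u(1)]] this]
  obtain x where "sextuple_mor C T (A, B, X, f, g, h)
      (N, cod u, cod u, zerom C N (cod u), idm C (cod u), zerom C (cod u) (fob T N)) (zerom C A N, u, x)" ..
  then show ?thesis using ob u by (intro that [of x]) simp_all
qed

text \<open>Compare the rotated trivial triangle \<open>A \<rightarrow> A \<rightarrow> T 0\<close>
  with the given one along the identity of \<open>A\<close> and \<open>f\<close>: its second map is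
  zero.\<close>

lemma triangle_cmp_gf:
  assumes t: "(A, B, X, f, g, h) \<in> \<Sigma>" shows "g \<cdot> f = zerom C A X"
proof -
  note ob = sextuples [OF t]
  obtain N where N: "zero_object C N" by (rule exists_zero_object)
  then have N': "N \<in> Ob C" by (simp add: zero_object_def)
  have A: "A \<in> Ob C" using ob by simp
  have "idm C A \<in> Mor C A A" "f \<in> Mor C A B" "f \<cdot> idm C A = f \<cdot> idm C A" using ob by simp_all
  from TR4 [OF TR3 [OF TR1 [OF N A]] t this]
  obtain c where "sextuple_mor C T (A, A, fob T N, idm C A, zerom C A (fob T N),
      negm C (fob T N) (fob T A) (fmor T (zerom C N A))) (A, B, X, f, g, h) (idm C A, f, c)" ..
  then have c: "c \<in> Mor C (fob T N) X" "c \<cdot> zerom C A (fob T N) = g \<cdot> f" by simp_all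
  then show ?thesis using ob N' by simp
qed

lemma triangle_cmp_hg: "(A, B, X, f, g, h) \<in> \<Sigma> \<Longrightarrow> h \<cdot> g = zerom C B (fob T A)"
  by (drule TR3) (drule triangle_cmp_gf)

lemma triangle_cmp_Tf_h:
  assumes "(A, B, X, f, g, h) \<in> \<Sigma>" shows "fmor T f \<cdot> h = zerom C X (fob T B)"
proof -
  note ob = sextuples [OF assms]
  have "neg (fmor T f \<cdot> h) = zerom C X (fob T B)" using triangle_cmp_hg [OF TR3 [OF assms]] ob by simp
  then have "neg (neg (fmor T f \<cdot> h)) = neg (zerom C X (fob T B))" by simp
  then show ?thesis using ob by simp
qed

lemma weak_cokernel_2:
  assumes "(A, B, X, f, g, h) \<in> \<Sigma>" "arr u" "dom u = X" "u \<cdot> g = zerom C B (cod u)"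
  obtains x where "arr x" "dom x = fob T A" "cod x = cod u" "u = x \<cdot> h"
  by (rule weak_cokernel [OF TR3 [OF assms(1)] assms(2-4)])

lemma weak_cokernel_3:
  assumes t: "(A, B, X, f, g, h) \<in> \<Sigma>" and u: "arr u" "dom u = fob T A" "u \<cdot> h = zerom C X (cod u)"
  obtains x where "arr x" "dom x = fob T B" "cod x = cod u" "u = x \<cdot> fmor T f"
proof -
  note ob = sextuples [OF t]
  obtain x where x: "arr x" "dom x = fob T B" "cod x = cod u" "u = x \<cdot> negm C (fob T A) (fob T B) (fmor T f)"
    by (rule weak_cokernel_2 [OF TR3 [OF t] u])
  show ?thesis by (rule that [of "neg x"]) (use ob x in simp_all)
qed

text \<open>The trivial triangle on \<open>E\<close>, rotated twice, is mapped to the given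
  triangle, rotated three times, by \<open>v\<close> and zero. The third component is the lift, so
  it exists only after one application of \<open>T\<close>.\<close>

lemma lift_shifted:
  assumes t: "(A, B, X, f, g, h) \<in> \<Sigma>" and v: "arr v" "cod v = X" "h \<cdot> v = zerom C (dom v) (fob T A)"
  obtains u where "arr u" "dom u = fob T (dom v)" "cod u = fob T B" "fmor T v = fmor T g \<cdot> u"
proof -
  note ob = sextuples [OF t]
  let ?E = "dom v"
  obtain N where N: "zero_object C N" by (rule exists_zero_object)
  then have N': "N \<in> Ob C" by (simp add: zero_object_def)
  have "(?E, fob T N, fob T ?E, zerom C ?E (fob T N),
      negm C (fob T N) (fob T ?E) (fmor T (zerom C N ?E)), negm C (fob T ?E) (fob T ?E) (fmor T (idm C ?E))) \<in> \<Sigma>"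
    using v by (intro TR3 TR1 N) simp
  moreover have "(X, fob T A, fob T B, h, negm C (fob T A) (fob T B) (fmor T f), negm C (fob T B) (fob T X) (fmor T g)) \<in> \<Sigma>"
    by (intro TR3 t)
  moreover have "v \<in> Mor C ?E X" "zerom C (fob T N) (fob T A) \<in> Mor C (fob T N) (fob T A)"
    "zerom C (fob T N) (fob T A) \<cdot> zerom C ?E (fob T N) = h \<cdot> v"
    using ob v N' by simp_all
  ultimately obtain c where c: "c \<in> Mor C (fob T ?E) (fob T B)"
    "fmor T v \<cdot> negm C (fob T ?E) (fob T ?E) (fmor T (idm C ?E)) =
     negm C (fob T B) (fob T X) (fmor T g) \<cdot> c"
    using TR4 by fastforce
  then have "neg (fmor T v) = neg (fmor T g \<cdot> c)" using ob v by simp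
  then have "neg (neg (fmor T v)) = neg (neg (fmor T g \<cdot> c))" by simp
  then show ?thesis using ob v c by (intro that [of c]) simp_all
qed

text \<open>The cone \<open>X\<close> of \<open>i\<close> is compared with \<open>E\<close>. Since
  \<open>T p\<close> is a left inverse of \<open>T i\<close>, the relation
  \<open>T i \<cdot> h = 0\<close> gives \<open>h = 0\<close>; then the factorization
  \<open>q = s \<cdot> g\<close> has \<open>s\<close> invertible, with inverse
  \<open>g \<cdot> j\<close>.\<close>

lemma split_triangle:
  assumes b: "biproduct N E B i j p q"
  shows "(N, B, E, i, q, zerom C E (fob T N)) \<in> \<Sigma>"
proof -
  note bi = b [unfolded biproduct_def]
  obtain X g h where t: "(N, B, X, i, g, h) \<in> \<Sigma>" using TR2 [of N B i] bi by auto
  note ob = sextuples [OF t]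
  have q: "arr q" "dom q = B" "q \<cdot> i = zerom C N (cod q)" using bi by simp_all
  obtain s where "arr s" "dom s = X" "cod s = cod q" and s4: "q = s \<cdot> g"
    by (rule weak_cokernel [OF t q])
  then have s: "arr s" "dom s = X" "cod s = E" using bi by simp_all
  have "fmor T p \<cdot> (fmor T i \<cdot> h) = h"
    using cmp_reassoc [of "fmor T p" "fmor T i" "idm C (fob T N)" h] ob bi by (simp flip: T_cmp)
  then have h: "h = zerom C X (fob T N)" using triangle_cmp_Tf_h [OF t] ob bi by simp
  have "(g \<cdot> (j \<cdot> s)) \<cdot> g = g \<cdot> (j \<cdot> q)" unfolding s4 using ob bi s by simp
  also have "\<dots> = g \<cdot> (i \<cdot> p) \<boxplus> g \<cdot> (j \<cdot> q)"
    using ob bi cmp_reassoc [OF triangle_cmp_gf [OF t], of p] by simp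
  also have "\<dots> = g \<cdot> (i \<cdot> p \<boxplus> j \<cdot> q)"
    by (rule cmp_add(1) [symmetric]) (use ob bi in simp_all)
  also have "\<dots> = g" using ob bi by simp
  finally have gjsg: "(g \<cdot> (j \<cdot> s)) \<cdot> g = g" .
  \<comment> \<open>\<open>e\<close> kills \<open>g\<close>, hence factors through \<open>h\<close>,
    which is zero.\<close>
  define e where "e = g \<cdot> (j \<cdot> s) \<boxminus> idm C X"
  have e: "arr e" "dom e = X" "e \<cdot> g = zerom C B (cod e)" "cod e = X"
    using ob bi s gjsg by (simp_all add: e_def)
  obtain x where x: "arr x" "dom x = fob T N" "cod x = cod e" "e = x \<cdot> h"
    by (rule weak_cokernel_2 [OF t e(1-3)])
  have "e = zerom C X X" unfolding x(4) using x(1-3) ob h e(4) by simp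
  then have gjs: "g \<cdot> (j \<cdot> s) = idm C X" unfolding e_def using ob bi s by simp
  have "iso_mor C X E s"
  proof (rule iso_morI [where g = "g \<cdot> j"])
    show "s \<cdot> (g \<cdot> j) = idm C (cod s)"
      using ob bi s cmp_reassoc [OF s4 [symmetric], of j] by simp
  qed (use ob bi s gjs in simp_all)
  then have "sextuple_iso C T (N, B, X, i, g, h) (N, B, E, i, q, zerom C E (fob T N)) (idm C N, idm C B, s)"
    using ob bi s s4 h by simp
  then show ?thesis by (rule TR0 [OF t, rotated]) (use bi in simp)
qed

end

section \<open>The shift functor of the quotient category\<close>

locale mutation_category = right_triangulated_category C T \<Sigma> + ideal_quotient C Z D
  for C :: "('o, 'm) addcat" (structure) and T :: "('o, 'm) endo"
    and \<Sigma> :: "('o, 'm) sextuple set" and Z D :: "'o set" +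
  fixes S :: "('o, 'm) cone_choice"
  assumes unrotate: "\<And>A B X f g h. \<lbrakk>A \<in> Ob C; B \<in> Ob C; X \<in> Ob C;
      f \<in> Mor C A B; g \<in> Mor C B X; h \<in> Mor C X (fob T A);
      (B, X, fob T A, g, h, negm C (fob T A) (fob T B) (fmor T f)) \<in> \<Sigma>\<rbrakk>
    \<Longrightarrow> (A, B, X, f, g, h) \<in> \<Sigma>"
    and ext_closed: "extension_closed \<Sigma> Z"
    and mutation: "mutation_pair C \<Sigma> D Z Z"
    and full: "\<And>X Y u. \<lbrakk>X \<in> Z; Y \<in> Z; u \<in> Mor C (fob T X) (fob T Y)\<rbrakk>
      \<Longrightarrow> \<exists>f \<in> Mor C X Y. fmor T f = u"
    and choice: "valid_choice C \<Sigma> Z D S"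
begin

text \<open>By \<open>unrotate\<close>, any \<open>f\<close> with \<open>T f = 0\<close> may replace the zero map in a triangle
  on \<open>0\<close>, whose second map is a split monomorphism killing \<open>f\<close>.\<close>

lemma T_faithful_zero:
  assumes "arr f" "fmor T f = zerom C (fob T (dom f)) (fob T (cod f))"
  shows "f = zerom C (dom f) (cod f)"
proof -
  let ?A = "dom f" and ?B = "cod f"
  obtain X g h where t: "(?A, ?B, X, zerom C ?A ?B, g, h) \<in> \<Sigma>"
    using TR2 [of ?A ?B "zerom C ?A ?B"] assms by auto
  note ob = sextuples [OF t]
  have B: "arr (idm C ?B)" "dom (idm C ?B) = ?B"
    "idm C ?B \<cdot> zerom C ?A ?B = zerom C ?A (cod (idm C ?B))" using assms by simp_all
  obtain c where c: "arr c" "dom c = X" "cod c = cod (idm C ?B)" "idm C ?B = c \<cdot> g"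
    by (rule weak_cokernel [OF t B])
  have "(?A, ?B, X, f, g, h) \<in> \<Sigma>"
    by (rule unrotate) (use ob assms TR3 [OF t] in simp_all)
  from triangle_cmp_gf [OF this] have gf: "g \<cdot> f = zerom C ?A X" .
  have "f = idm C ?B \<cdot> f" using assms by simp
  also have "\<dots> = c \<cdot> (g \<cdot> f)" unfolding c(4) using c(1-3) ob assms by simp
  also have "\<dots> = zerom C ?A ?B" using gf c(1-3) ob assms(1) by simp
  finally show ?thesis .
qed

lemma T_faithful:
  assumes "arr f" "arr g" "dom f = dom g" "cod f = cod g" "fmor T f = fmor T g"
  shows "f = g"
  using T_faithful_zero [of "f \<boxminus> g"] assms by simp

lemma T_full:
  assumes "X \<in> Z" "Y \<in> Z" "arr u" "dom u = fob T X" "cod u = fob T Y"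
  obtains f where "arr f" "dom f = X" "cod f = Y" "fmor T f = u"
  using full [of X Y u] assms by auto

text \<open>\<open>lift_shifted\<close> lifts \<open>T v\<close>. Fullness writes this lift as
  \<open>T u\<close>, which is where \<open>B\<close> and the source of \<open>v\<close> must lie in
  \<open>Z\<close>, and faithfulness removes \<open>T\<close>.\<close>

lemma weak_kernel:
  assumes t: "(A, B, X, f, g, h) \<in> \<Sigma>" and B: "B \<in> Z"
    and v: "arr v" "dom v \<in> Z" "cod v = X" "h \<cdot> v = zerom C (dom v) (fob T A)"
  obtains u where "arr u" "dom u = dom v" "cod u = B" "v = g \<cdot> u"
proof -
  note ob = sextuples [OF t]
  obtain u' where u': "arr u'" "dom u' = fob T (dom v)" "cod u' = fob T B" "fmor T v = fmor T g \<cdot> u'"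
    by (rule lift_shifted [OF t v(1,3,4)])
  obtain u where u: "arr u" "dom u = dom v" "cod u = B" "fmor T u = u'"
    by (rule T_full [OF v(2) B u'(1-3)])
  have "v = g \<cdot> u" by (rule T_faithful) (use ob v u u'(4) in simp_all)
  then show ?thesis by (rule that [OF u(1-3)])
qed

abbreviation "\<alpha> \<equiv> calpha S"
abbreviation "\<beta> \<equiv> cbeta S"
abbreviation "\<gamma> \<equiv> cgamma S"
abbreviation "\<sigma> \<equiv> sigma C T Z D S"

section \<open>\<open>D\<close>-monic morphisms and approximation triangles\<close>

definition monic :: "'m \<Rightarrow> bool" where
  "monic m \<longleftrightarrow> arr m \<and> rel_monic C D (dom m) (cod m) m"

lemma rel_monic_iff:
  assumes "A \<in> Ob C" "B \<in> Ob C"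
  shows "rel_monic C D A B m \<longleftrightarrow> monic m \<and> dom m = A \<and> cod m = B"
proof -
  have "m \<in> Mor C A B" if "rel_monic C D A B m" using that by (simp add: rel_monic_def)
  then show ?thesis using assms unfolding monic_def by auto
qed

lemma monicE:
  assumes "monic m" "arr v" "dom v = dom m" "cod v \<in> D"
  obtains u where "arr u" "dom u = cod m" "cod u = cod v" "v = u \<cdot> m"
proof -
  have m: "arr m" "rel_monic C D (dom m) (cod m) m" using assms(1) by (simp_all add: monic_def)
  moreover have "v \<in> Mor C (dom m) (cod v)" using assms(2,3) m(1) by simp
  ultimately obtain u where "u \<in> Mor C (cod m) (cod v)" "u \<cdot> m = v"
    using assms(4) unfolding rel_monic_def by blast
  then show ?thesis using assms(2) m(1) by (intro that [of u]) auto
qed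

lemma monicI:
  assumes m: "arr m"
    and ext: "\<And>v. \<lbrakk>arr v; dom v = dom m; cod v \<in> D\<rbrakk>
      \<Longrightarrow> \<exists>u. arr u \<and> dom u = cod m \<and> cod u = cod v \<and> v = u \<cdot> m"
  shows "monic m"
proof -
  have "\<exists>u \<in> Mor C (cod m) E. u \<cdot> m = v" if E: "E \<in> D" and v: "v \<in> Mor C (dom m) E" for E v
  proof -
    have v': "arr v" "dom v = dom m" "cod v = E" using E v m by simp_all
    then obtain u where "arr u" "dom u = cod m" "cod u = E" "v = u \<cdot> m" using ext [of v] E by blast
    then show ?thesis using m E by (intro bexI [of _ u]) simp_all
  qed
  then show ?thesis using m arr_mor [OF m] unfolding monic_def rel_monic_def by blast
qed

lemma monic_arr: "monic m \<Longrightarrow> arr m"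
  by (simp add: monic_def)

lemma monic_cmp:
  assumes "monic m" "monic n" "dom n = cod m" shows "monic (n \<cdot> m)"
proof (rule monicI)
  note mn = monic_arr [OF assms(1)] monic_arr [OF assms(2)]
  show "arr (n \<cdot> m)" using assms mn by simp
  fix v assume v: "arr v" "dom v = dom (n \<cdot> m)" "cod v \<in> D"
  have v': "dom v = dom m" using v mn assms(3) by simp
  obtain u where u: "arr u" "dom u = cod m" "cod u = cod v" "v = u \<cdot> m"
    by (rule monicE [OF assms(1) v(1) v' v(3)])
  obtain u' where u': "arr u'" "dom u' = cod n" "cod u' = cod u" "u = u' \<cdot> n"
    by (rule monicE [OF assms(2) u(1)]) (use u(2,3) v assms(3) in simp_all)
  have "v = u' \<cdot> (n \<cdot> m)" unfolding u(4) u'(4) using u'(1-3) mn assms(3) by simp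
  then show "\<exists>u. arr u \<and> dom u = cod (n \<cdot> m) \<and> cod u = cod v \<and> v = u \<cdot> (n \<cdot> m)"
    using u(3) u'(1-3) mn assms(3) by (intro exI [of _ u']) simp
qed

lemma approx_triangleD:
  assumes "approx_triangle C \<Sigma> D X E Y f g h"
  shows "(X, E, Y, f, g, h) \<in> \<Sigma>" "E \<in> D" "monic f"
    "\<And>v. \<lbrakk>arr v; dom v \<in> D; cod v = Y\<rbrakk> \<Longrightarrow> \<exists>u. arr u \<and> dom u = dom v \<and> cod u = E \<and> v = g \<cdot> u"
proof -
  show t: "(X, E, Y, f, g, h) \<in> \<Sigma>" and E: "E \<in> D"
    using assms by (auto simp: approx_triangle_def left_approx_def)
  note ob = sextuples [OF t]
  have "rel_monic C D X E f" using assms by (auto simp: approx_triangle_def left_approx_def)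
  then show "monic f" using ob by (simp add: rel_monic_iff)
  fix v assume v: "arr v" "dom v \<in> D" "cod v = Y"
  have "rel_epic C D E Y g" using assms by (auto simp: approx_triangle_def right_approx_def)
  then obtain u where "u \<in> Mor C (dom v) E" "g \<cdot> u = v"
    using v ob unfolding rel_epic_def by (metis arr_mor)
  then show "\<exists>u. arr u \<and> dom u = dom v \<and> cod u = E \<and> v = g \<cdot> u" using v E by auto
qed

lemma chosen_approx:
  "M \<in> Z \<Longrightarrow> approx_triangle C \<Sigma> D M (capx S M) (cone S M) (\<alpha> M) (\<beta> M) (\<gamma> M)"
  using choice by (auto simp: valid_choice_def)

lemmas chosen_tri = chosen_approx [THEN approx_triangleD(1)]

lemma chosen_simps [simp]:
  assumes "M \<in> Z"
  shows "capx S M \<in> D" "cone S M \<in> Z" "arr (\<alpha> M)" "dom (\<alpha> M) = M" "cod (\<alpha> M) = capx S M"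
    "arr (\<beta> M)" "dom (\<beta> M) = capx S M" "cod (\<beta> M) = cone S M"
    "arr (\<gamma> M)" "dom (\<gamma> M) = cone S M" "cod (\<gamma> M) = fob T M" "monic (\<alpha> M)"
  using sextuples [OF chosen_tri [OF assms]] approx_triangleD(2,3) [OF chosen_approx [OF assms]]
    choice assms
  by (auto simp: valid_choice_def)

text \<open>The difference of \<open>u\<close> and \<open>v\<close> is killed by \<open>h\<close>,
  so it lifts to \<open>E\<close>, an object of \<open>D\<close>. Arbitrary approximation triangles
  are allowed because \<open>cone_iso_approx\<close> cancels at one that was not chosen.\<close>

lemma approx_cancel:
  assumes a: "approx_triangle C \<Sigma> D X E Y f g h"
    and u: "arr u" "dom u \<in> Z" "cod u = Y" and v: "arr v" "dom v = dom u" "cod v = Y"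
    and eq: "h \<cdot> u = h \<cdot> v"
  shows "cls C D u = cls C D v"
proof -
  note t = approx_triangleD(1) [OF a] and E = approx_triangleD(2) [OF a]
  note ob = sextuples [OF t]
  have EZ: "E \<in> Z" using E by simp
  have d: "arr (u \<boxminus> v)" "dom (u \<boxminus> v) \<in> Z" "cod (u \<boxminus> v) = Y"
    "h \<cdot> (u \<boxminus> v) = zerom C (dom (u \<boxminus> v)) (fob T X)"
    using u v eq ob by simp_all
  obtain w where w: "arr w" "dom w = dom (u \<boxminus> v)" "cod w = E" "u \<boxminus> v = g \<cdot> w"
    by (rule weak_kernel [OF t EZ d])
  have "null (u \<boxminus> v)" unfolding w(4) by (rule nullI) (use w(1,3) E ob in simp_all)
  then show ?thesis using u v by (intro cls_eqI) simp_all
qed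

lemmas gamma_cancel = approx_cancel [OF chosen_approx]

section \<open>The functor \<sigma> on classes\<close>

lemma sigma_ob [simp]: "fob \<sigma> M = cone S M"
  by (simp add: sigma_def)

definition shift_of :: "'m \<Rightarrow> 'm \<Rightarrow> bool" where
  "shift_of m m' \<longleftrightarrow> arr m \<and> dom m \<in> Z \<and> cod m \<in> Z \<and> arr m' \<and> dom m' = cone S (dom m) \<and>
    cod m' = cone S (cod m) \<and> \<gamma> (cod m) \<cdot> m' = fmor T m \<cdot> \<gamma> (dom m)"

lemma sextuple_mor_chosen:
  assumes "M \<in> Z" "N \<in> Z" "arr m" "dom m = M" "cod m = N"
  shows "\<exists>g m'. sextuple_mor C T (chosen S M) (chosen S N) (m, g, m')"
proof -
  have v: "monic (\<alpha> M)" "arr (\<alpha> N \<cdot> m)" "dom (\<alpha> N \<cdot> m) = dom (\<alpha> M)" "cod (\<alpha> N \<cdot> m) \<in> D"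
    using assms by simp_all
  obtain g where g: "arr g" "dom g = cod (\<alpha> M)" "cod g = cod (\<alpha> N \<cdot> m)" "\<alpha> N \<cdot> m = g \<cdot> \<alpha> M"
    by (rule monicE [OF v])
  have "m \<in> Mor C M N" "g \<in> Mor C (capx S M) (capx S N)" "g \<cdot> \<alpha> M = \<alpha> N \<cdot> m"
    using g(1-3) g(4) [symmetric] assms by simp_all
  from TR4 [OF chosen_tri [OF assms(1)] chosen_tri [OF assms(2)] this]
  show ?thesis unfolding chosen_def by blast
qed

lemma sextuple_mor_shift_of:
  assumes "M \<in> Z" "N \<in> Z" "m \<in> Mor C M N" "sextuple_mor C T (chosen S M) (chosen S N) (m, g, m')"
  shows "shift_of m m'"
  using assms by (simp add: shift_of_def chosen_def)

lemma shift_of_exists: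
  assumes "arr m" "dom m \<in> Z" "cod m \<in> Z"
  obtains m' where "shift_of m m'"
  using sextuple_mor_chosen [OF assms(2,3,1) refl refl] sextuple_mor_shift_of [OF assms(2,3)] assms
  by auto

text \<open>The part of \<open>d\<close> ending in \<open>D\<close> extends along the
  \<open>D\<close>-monic map \<alpha>. So \<open>T d\<close> factors through
  \<open>T \<alpha>\<close>, which kills \<gamma>.\<close>

lemma null_T_gamma:
  assumes "null d" "dom d \<in> Z" shows "fmor T d \<cdot> \<gamma> (dom d) = zerom C (cone S (dom d)) (fob T (cod d))"
proof -
  obtain s t where st: "arr s" "arr t" "dom s = cod t" "cod t \<in> D" "d = s \<cdot> t" "dom t = dom d" "cod s = cod d"
    by (rule nullE [OF assms(1)])
  have v: "monic (\<alpha> (dom d))" using assms by simp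
  have st6: "dom t = dom (\<alpha> (dom d))" using st(6) assms by simp
  obtain t' where t': "arr t'" "dom t' = cod (\<alpha> (dom d))" "cod t' = cod t" "t = t' \<cdot> \<alpha> (dom d)"
    by (rule monicE [OF v st(2) st6 st(4)])
  have d: "d = s \<cdot> (t' \<cdot> \<alpha> (dom d))" using st(5) unfolding t'(4) .
  have "fmor T d = fmor T s \<cdot> (fmor T t' \<cdot> fmor T (\<alpha> (dom d)))"
    by (subst d) (use st(1-4) t'(1-3) assms in simp)
  then show ?thesis
    using st(1-4,6,7) t'(1-3) assms triangle_cmp_Tf_h [OF chosen_tri [OF assms(2)]] by simp
qed

text \<open>Both lifts agree after \<gamma>, because \<open>m - n\<close> contributes nothing there
  by \<open>null_T_gamma\<close>. This is the uniqueness behind the \<open>THE\<close> in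
  \<open>sigma\<close>.\<close>

lemma shift_of_cls:
  assumes m: "shift_of m m'" and n: "shift_of n n'" and eq: "cls C D m = cls C D n"
  shows "cls C D m' = cls C D n'"
proof -
  note m = m [unfolded shift_of_def] and n = n [unfolded shift_of_def]
  have mn: "dom m = dom n" "cod m = cod n" "null (m \<boxminus> n)"
    using eq m n by (simp_all add: cls_eq_iff)
  have "fmor T (m \<boxminus> n) \<cdot> \<gamma> (dom (m \<boxminus> n)) = zerom C (cone S (dom (m \<boxminus> n))) (fob T (cod (m \<boxminus> n)))"
    by (rule null_T_gamma) (use mn m n in simp_all)
  then have "fmor T m \<cdot> \<gamma> (dom n) = fmor T n \<cdot> \<gamma> (dom n)" using m n mn by simp
  then show ?thesis using m n mn by (intro gamma_cancel [of "cod n"]) simp_all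
qed

lemma sigma_cls:
  assumes "shift_of m m'" shows "fmor \<sigma> (cls C D m) = cls C D m'"
proof -
  have m: "arr m" "dom m \<in> Z" "cod m \<in> Z" using assms by (simp_all add: shift_of_def)
  have "(THE G. \<exists>M \<in> Z. \<exists>N \<in> Z. \<exists>n \<in> Mor C M N. \<exists>g n'. cls C D m = cls C D n \<and>
    sextuple_mor C T (chosen S M) (chosen S N) (n, g, n') \<and> G = cls C D n') = cls C D m'"
  proof (rule the_equality)
    obtain g n' where "sextuple_mor C T (chosen S (dom m)) (chosen S (cod m)) (m, g, n')"
      using sextuple_mor_chosen [OF m(2,3,1)] by blast
    moreover from this have "cls C D m' = cls C D n'"
      by (intro shift_of_cls [OF assms sextuple_mor_shift_of [OF m(2,3)]]) (use m in simp_all)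
    ultimately show "\<exists>M \<in> Z. \<exists>N \<in> Z. \<exists>n \<in> Mor C M N. \<exists>g n'. cls C D m = cls C D n \<and>
      sextuple_mor C T (chosen S M) (chosen S N) (n, g, n') \<and> cls C D m' = cls C D n'"
      using m arr_mor [OF m(1)] by blast
  next
    fix G
    assume "\<exists>M \<in> Z. \<exists>N \<in> Z. \<exists>n \<in> Mor C M N. \<exists>g n'. cls C D m = cls C D n \<and>
      sextuple_mor C T (chosen S M) (chosen S N) (n, g, n') \<and> G = cls C D n'"
    then obtain M N n g n' where "M \<in> Z" "N \<in> Z" "n \<in> Mor C M N" "cls C D m = cls C D n"
      "sextuple_mor C T (chosen S M) (chosen S N) (n, g, n')" "G = cls C D n'" by blast
    then show "G = cls C D m'"
      using shift_of_cls [OF assms sextuple_mor_shift_of] by metis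
  qed
  then show ?thesis by (simp add: sigma_def)
qed

lemma shift_of_id: "M \<in> Z \<Longrightarrow> shift_of (idm C M) (idm C (cone S M))"
  by (simp add: shift_of_def)

lemma shift_of_cmp:
  assumes "shift_of m m'" "shift_of n n'" "dom n = cod m" shows "shift_of (n \<cdot> m) (n' \<cdot> m')"
proof -
  have eqs: "\<gamma> (cod m) \<cdot> m' = fmor T m \<cdot> \<gamma> (dom m)" "\<gamma> (cod n) \<cdot> n' = fmor T n \<cdot> \<gamma> (cod m)"
    using assms by (simp_all add: shift_of_def)
  show ?thesis
    using assms by (simp add: shift_of_def eqs cmp_reassoc [OF eqs(2)])
qed

lemma shift_of_add:
  assumes "shift_of m m'" "shift_of n n'" "dom n = dom m" "cod n = cod m"
  shows "shift_of (n \<boxplus> m) (n' \<boxplus> m')"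
  using assms by (simp add: shift_of_def)

lemma sigma_functor: "additive_endofunctor Q \<sigma>"
proof -
  have "\<forall>X \<in> Ob Q. fob \<sigma> X \<in> Ob Q \<and> fmor \<sigma> (idm Q X) = idm Q (fob \<sigma> X)"
    using sigma_cls [OF shift_of_id] by simp
  moreover have "fmor \<sigma> F \<in> Mor Q (fob \<sigma> X) (fob \<sigma> Y)"
    if XY: "X \<in> Z" "Y \<in> Z" and F: "F \<in> Mor Q X Y" for X Y F
  proof -
    obtain f where f: "arr f" "dom f = X" "cod f = Y" "F = cls C D f" by (rule Q_morE [OF F XY])
    obtain f' where f': "shift_of f f'" by (rule shift_of_exists [of f]) (use f XY in simp_all)
    then show ?thesis
      using sigma_cls [OF f'] f XY unfolding shift_of_def by (auto intro!: Q_morI)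
  qed
  moreover have "fmor \<sigma> (cmp Q G F) = cmp Q (fmor \<sigma> G) (fmor \<sigma> F)"
    if XY: "X \<in> Z" "Y \<in> Z" "W \<in> Z" and F: "F \<in> Mor Q X Y" and G: "G \<in> Mor Q Y W" for X Y W F G
  proof -
    obtain f where f: "arr f" "dom f = X" "cod f = Y" "F = cls C D f" by (rule Q_morE [OF F XY(1,2)])
    obtain g where g: "arr g" "dom g = Y" "cod g = W" "G = cls C D g" by (rule Q_morE [OF G XY(2,3)])
    obtain f' where f': "shift_of f f'" by (rule shift_of_exists [of f]) (use f XY in simp_all)
    obtain g' where g': "shift_of g g'" by (rule shift_of_exists [of g]) (use g XY in simp_all)
    have gf: "shift_of (g \<cdot> f) (g' \<cdot> f')" using f' g' f g by (intro shift_of_cmp) simp_all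
    have "arr f'" "arr g'" "dom g' = cod f'" using f' g' f g by (simp_all add: shift_of_def)
    then show ?thesis
      using f g sigma_cls [OF f'] sigma_cls [OF g'] sigma_cls [OF gf] by simp
  qed
  moreover have "fmor \<sigma> (addm Q F G) = addm Q (fmor \<sigma> F) (fmor \<sigma> G)"
    if XY: "X \<in> Z" "Y \<in> Z" and F: "F \<in> Mor Q X Y" and G: "G \<in> Mor Q X Y" for X Y F G
  proof -
    obtain f where f: "arr f" "dom f = X" "cod f = Y" "F = cls C D f" by (rule Q_morE [OF F XY])
    obtain g where g: "arr g" "dom g = X" "cod g = Y" "G = cls C D g" by (rule Q_morE [OF G XY])
    obtain f' where f': "shift_of f f'" by (rule shift_of_exists [of f]) (use f XY in simp_all)
    obtain g' where g': "shift_of g g'" by (rule shift_of_exists [of g]) (use g XY in simp_all)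
    have fg: "shift_of (f \<boxplus> g) (f' \<boxplus> g')" using f' g' f g by (intro shift_of_add) simp_all
    have "arr f'" "arr g'" "dom f' = dom g'" "cod f' = cod g'"
      using f' g' f g by (simp_all add: shift_of_def)
    then show ?thesis
      using f g sigma_cls [OF f'] sigma_cls [OF g'] sigma_cls [OF fg] by simp
  qed
  ultimately show ?thesis
    unfolding additive_endofunctor_def endofunctor_def by (simp del: Q.mor_iff)
qed


text \<open>\<open>E'\<close> lies in \<open>D\<close>, so \<open>f'\<close> extends along the
  \<open>D\<close>-monic map \<open>f\<close>; TR4 then supplies \<open>q\<close>.\<close>

lemma monic_compare:
  assumes t: "(X, E, Y, f, g, h) \<in> \<Sigma>" and f: "monic f"
    and t': "(X, E', Y', f', g', h') \<in> \<Sigma>" and E': "E' \<in> D"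
  obtains n q where "arr n" "dom n = E" "cod n = E'" "n \<cdot> f = f'" "arr q" "dom q = Y" "cod q = Y'"
    "q \<cdot> g = g' \<cdot> n" "h' \<cdot> q = h"
proof -
  note ob = sextuples [OF t] sextuples [OF t']
  have v: "arr f'" "dom f' = dom f" "cod f' \<in> D" using ob E' by simp_all
  obtain n where n: "arr n" "dom n = cod f" "cod n = cod f'" "f' = n \<cdot> f"
    by (rule monicE [OF f v])
  have "idm C X \<in> Mor C X X" "n \<in> Mor C E E'" "n \<cdot> f = f' \<cdot> idm C X"
    using n(1-3) n(4) [symmetric] ob by simp_all
  from TR4 [OF t t' this] obtain q where
    "sextuple_mor C T (X, E, Y, f, g, h) (X, E', Y', f', g', h') (idm C X, n, q)" ..
  then show ?thesis using ob by (intro that [of n q]) simp_all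
qed

section \<open>Approximation of objects of \<open>Z\<close>, and \<sigma> as an equivalence\<close>

lemma monic_from_zero:
  assumes N: "zero_object C N" and Y: "Y \<in> Ob C" shows "monic (zerom C N Y)"
proof (rule monicI)
  have ob: "N \<in> Ob C" using N by (simp add: zero_object_def)
  then show "arr (zerom C N Y)" using Y by simp
  fix v assume v: "arr v" "dom v = dom (zerom C N Y)" "cod v \<in> D"
  have "v = zerom C N (cod v)" by (rule zero_object_arr(1) [OF N]) (use v ob Y in simp_all)
  also have "\<dots> = zerom C Y (cod v) \<cdot> zerom C N Y" using v ob Y by simp
  finally show "\<exists>u. arr u \<and> dom u = cod (zerom C N Y) \<and> cod u = cod v \<and> v = u \<cdot> zerom C N Y"
    using v ob Y by (intro exI [of _ "zerom C Y (cod v)"]) simp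
qed

text \<open>For \<open>Y\<close> in \<open>D\<close>, membership in the mutation provides no
  triangle by itself; there the triangle
  \<open>0 \<rightarrow> Y \<rightarrow> Y \<rightarrow> T 0\<close> serves.\<close>

lemma exists_approx:
  assumes "Y \<in> Z"
  obtains X E f g h where "X \<in> Z" "approx_triangle C \<Sigma> D X E Y f g h"
proof (cases "Y \<in> D")
  case True
  obtain N where N: "zero_object C N" and ND: "N \<in> D" using exists_zero_object D_sub by blast
  have "monic (zerom C N Y)" by (rule monic_from_zero [OF N]) (use assms in simp)
  then have "rel_monic C D N Y (zerom C N Y)" using ND assms by (simp add: rel_monic_iff)
  moreover have "rel_epic C D Y Y (idm C Y)" using assms by (auto simp: rel_epic_def)
  ultimately have "approx_triangle C \<Sigma> D N Y Y (zerom C N Y) (idm C Y) (zerom C Y (fob T N))"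
    using TR1 [OF N, of Y] True by (simp add: approx_triangle_def left_approx_def right_approx_def)
  then show ?thesis by (rule that [OF D_in_Z [OF ND]])
next
  case False
  have "Y \<in> inv_mutation C \<Sigma> Z D" using mutation assms by (simp add: mutation_pair_def)
  then show ?thesis using that False unfolding inv_mutation_def by blast
qed

text \<open>Two approximation triangles on \<open>X\<close> compare in both directions over the
  identity of \<open>X\<close>. The composites preserve the maps to \<open>T X\<close>, so they are
  identities modulo \<open>D\<close>.\<close>

lemma cone_iso_approx:
  assumes X: "X \<in> Z" and Y: "Y \<in> Z" and a: "approx_triangle C \<Sigma> D X E Y f g h"
  shows "isomorphic Q (cone S X) Y"
proof -
  note t = approx_triangleD(1) [OF a] and c = chosen_tri [OF X]
  note ob = sextuples [OF t]
  have cD: "capx S X \<in> D" and m: "monic (\<alpha> X)" using X by simp_all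
  obtain q where q: "arr q" "dom q = Y" "cod q = cone S X" "\<gamma> X \<cdot> q = h"
    by (rule monic_compare [OF t approx_triangleD(3) [OF a] c cD])
  obtain q' where q': "arr q'" "dom q' = cone S X" "cod q' = Y" "h \<cdot> q' = \<gamma> X"
    by (rule monic_compare [OF c m t approx_triangleD(2) [OF a]])
  have "cls C D (q \<cdot> q') = cls C D (idm C (cone S X))"
    by (rule gamma_cancel [OF X]) (use X q q' ob cmp_reassoc [OF q(4), of q'] in simp_all)
  moreover have "cls C D (q' \<cdot> q) = cls C D (idm C Y)"
    by (rule approx_cancel [OF a]) (use X Y q q' ob cmp_reassoc [OF q'(4), of q] in simp_all)
  ultimately have "iso_mor Q (cone S X) Y (cls C D q')"
    by (intro Q.iso_morI [of _ "cls C D q"]) (use X Y q q' in simp_all)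
  then show ?thesis unfolding isomorphic_def by blast
qed

text \<open>As \<beta> of \<open>Y\<close> is a right approximation,
  \<open>g \<cdot> \<beta> X\<close> lifts through it and is killed by \<gamma> of \<open>Y\<close>.
  Hence \<open>\<gamma> Y \<cdot> g\<close> factors as \<open>y \<cdot> \<gamma> X\<close>, and
  \<open>y\<close> comes from some \<open>m\<close> by fullness of \<open>T\<close>.\<close>

lemma sigma_full:
  assumes X: "X \<in> Z" and Y: "Y \<in> Z" and g: "arr g" "dom g = cone S X" "cod g = cone S Y"
  obtains m where "shift_of m g" "dom m = X" "cod m = Y"
proof -
  have "\<exists>u. arr u \<and> dom u = dom (g \<cdot> \<beta> X) \<and> cod u = capx S Y \<and> g \<cdot> \<beta> X = \<beta> Y \<cdot> u"
    by (rule approx_triangleD(4) [OF chosen_approx [OF Y]]) (use X Y g in simp_all)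
  then obtain u where u: "arr u" "dom u = dom (g \<cdot> \<beta> X)" "cod u = capx S Y" "g \<cdot> \<beta> X = \<beta> Y \<cdot> u"
    by blast
  have "(\<gamma> Y \<cdot> g) \<cdot> \<beta> X = \<gamma> Y \<cdot> (g \<cdot> \<beta> X)" using X Y g by simp
  also have "\<dots> = \<gamma> Y \<cdot> (\<beta> Y \<cdot> u)" unfolding u(4) ..
  also have "\<dots> = zerom C (capx S X) (fob T Y)"
    using X Y g u(1-3) cmp_reassoc [OF triangle_cmp_hg [OF chosen_tri [OF Y]], of u] by simp
  finally have v: "arr (\<gamma> Y \<cdot> g)" "dom (\<gamma> Y \<cdot> g) = cone S X"
    "(\<gamma> Y \<cdot> g) \<cdot> \<beta> X = zerom C (capx S X) (cod (\<gamma> Y \<cdot> g))" using X Y g by simp_all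
  obtain y where y: "arr y" "dom y = fob T X" "cod y = cod (\<gamma> Y \<cdot> g)" "\<gamma> Y \<cdot> g = y \<cdot> \<gamma> X"
    by (rule weak_cokernel_2 [OF chosen_tri [OF X] v])
  have y3: "cod y = fob T Y" using y(3) Y g by simp
  obtain m where m: "arr m" "dom m = X" "cod m = Y" "fmor T m = y"
    by (rule T_full [OF X Y y(1,2) y3])
  have "shift_of m g" unfolding shift_of_def using X Y g m y(4) by simp
  then show ?thesis using m by (intro that)
qed

text \<open>A null difference \<open>m' - n'\<close> lifts through \<beta>, so it dies after
  \<gamma>, and \<open>T (m - n)\<close> kills \<gamma>. Then \<open>T (m - n)\<close> factors
  through \<open>T \<alpha>\<close>; cancelling \<open>T\<close> factors \<open>m - n\<close>
  through \<alpha>, whose target is in \<open>D\<close>.\<close>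

lemma sigma_faithful:
  assumes m: "shift_of m m'" and n: "shift_of n n'" and eq: "dom m = dom n" "cod m = cod n"
    and cls: "cls C D m' = cls C D n'"
  shows "cls C D m = cls C D n"
proof -
  note m = m [unfolded shift_of_def] and n = n [unfolded shift_of_def]
  let ?X = "dom n" and ?Y = "cod n"
  have X: "?X \<in> Z" and Y: "?Y \<in> Z" using n by simp_all
  have "null (m' \<boxminus> n')" using cls m n by (simp add: cls_eq_iff)
  then obtain s t where st: "arr s" "arr t" "dom s = cod t" "cod t \<in> D" "m' \<boxminus> n' = s \<cdot> t"
    "dom t = dom (m' \<boxminus> n')" "cod s = cod (m' \<boxminus> n')"
    by (rule nullE)
  have s: "dom s \<in> D" "cod s = cone S ?Y" using st(3,4,7) m n eq by simp_all
  obtain u where u: "arr u" "dom u = dom s" "cod u = capx S ?Y" "s = \<beta> ?Y \<cdot> u"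
    using approx_triangleD(4) [OF chosen_approx [OF Y] st(1) s] by blast
  have "\<gamma> ?Y \<cdot> (m' \<boxminus> n') = \<gamma> ?Y \<cdot> (\<beta> ?Y \<cdot> (u \<cdot> t))"
    unfolding st(5) u(4) using u(1-3) st(1-3) Y by simp
  also have "\<dots> = zerom C (dom t) (fob T ?Y)"
    using u(1-3) st(1-3) Y cmp_reassoc [OF triangle_cmp_hg [OF chosen_tri [OF Y]], of "u \<cdot> t"] by simp
  finally have "\<gamma> ?Y \<cdot> m' = \<gamma> ?Y \<cdot> n'" using m n eq st(6) by simp
  then have T: "fmor T m \<cdot> \<gamma> ?X = fmor T n \<cdot> \<gamma> ?X" using m n eq by simp
  define d where "d = m \<boxminus> n"
  have d: "arr d" "dom d = ?X" "cod d = ?Y" using m n eq by (simp_all add: d_def)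
  have v: "arr (fmor T d)" "dom (fmor T d) = fob T ?X"
    "fmor T d \<cdot> \<gamma> ?X = zerom C (cone S ?X) (cod (fmor T d))"
    using m n eq T by (simp_all add: d_def)
  obtain x where x: "arr x" "dom x = fob T (capx S ?X)" "cod x = cod (fmor T d)" "fmor T d = x \<cdot> fmor T (\<alpha> ?X)"
    by (rule weak_cokernel_3 [OF chosen_tri [OF X] v])
  have x3: "cod x = fob T ?Y" and cX: "capx S ?X \<in> Z" using x(3) d X by simp_all
  obtain y where y: "arr y" "dom y = capx S ?X" "cod y = ?Y" "fmor T y = x"
    by (rule T_full [OF cX Y x(1,2) x3])
  have "d = y \<cdot> \<alpha> ?X" by (rule T_faithful) (use d y X x(4) in simp_all)
  moreover have "null (y \<cdot> \<alpha> ?X)" by (rule nullI) (use y X in simp_all)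
  ultimately have "null (m \<boxminus> n)" by (simp add: d_def)
  then show ?thesis using m n eq by (intro cls_eqI) simp_all
qed

lemma sigma_equivalence: "equivalence_endo Q \<sigma>"
proof (rule Q.equivalence_endoI)
  show "endofunctor Q \<sigma>" using sigma_functor by (simp add: additive_endofunctor_def)
next
  fix X Y G assume XY: "X \<in> Ob Q" "Y \<in> Ob Q" and G: "Q.arr G" "Q.dom G = fob \<sigma> X" "Q.cod G = fob \<sigma> Y"
  obtain g where g: "arr g" "G = cls C D g" "Q.dom G = dom g" "Q.cod G = cod g"
    by (rule Q_arrE [OF G(1)])
  have g': "X \<in> Z" "Y \<in> Z" "dom g = cone S X" "cod g = cone S Y" using g G XY by simp_all
  obtain m where m: "shift_of m g" "dom m = X" "cod m = Y"
    by (rule sigma_full [OF g'(1,2) g(1) g'(3,4)])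
  have "arr m" using m(1) by (simp add: shift_of_def)
  then show "\<exists>F. Q.arr F \<and> Q.dom F = X \<and> Q.cod F = Y \<and> fmor \<sigma> F = G"
    using m g' g(2) sigma_cls [OF m(1)] by (intro exI [of _ "cls C D m"]) simp
next
  fix F G assume FG: "Q.arr F" "Q.arr G" "Q.dom F = Q.dom G" "Q.cod F = Q.cod G" "fmor \<sigma> F = fmor \<sigma> G"
  obtain f where f: "arr f" "dom f \<in> Z" "cod f \<in> Z" "F = cls C D f" "Q.dom F = dom f" "Q.cod F = cod f"
    by (rule Q_arrE [OF FG(1)])
  obtain g where g: "arr g" "dom g \<in> Z" "cod g \<in> Z" "G = cls C D g" "Q.dom G = dom g" "Q.cod G = cod g"
    by (rule Q_arrE [OF FG(2)])
  obtain f' where f': "shift_of f f'" by (rule shift_of_exists [OF f(1-3)])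
  obtain g' where g': "shift_of g g'" by (rule shift_of_exists [OF g(1-3)])
  show "F = G"
    unfolding f(4) g(4)
    by (rule sigma_faithful [OF f' g'])
      (use f(4-6) g(4-6) FG(3-5) sigma_cls [OF f'] sigma_cls [OF g'] in simp_all)
next
  fix Y assume "Y \<in> Ob Q"
  then have Y: "Y \<in> Z" by simp
  obtain X E f g h where X: "X \<in> Z" and a: "approx_triangle C \<Sigma> D X E Y f g h"
    by (rule exists_approx [OF Y])
  show "\<exists>X \<in> Ob Q. isomorphic Q (fob \<sigma> X) Y"
    using X cone_iso_approx [OF X Y a] by (intro bexI [of _ X]) simp_all
qed

end

section \<open>The triangulation of the quotient category\<close>

context mutation_category
begin

text \<open>The map \<open>w\<close> in \<open>C\<close> is kept next to its lift \<open>q\<close>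
  to the cone, since \<open>\<gamma> M \<cdot> q = w\<close> determines \<open>q\<close> modulo
  \<open>D\<close>.\<close>

definition standard :: "'o \<Rightarrow> 'o \<Rightarrow> 'o \<Rightarrow> 'm \<Rightarrow> 'm \<Rightarrow> 'm \<Rightarrow> 'm \<Rightarrow> bool" where
  "standard M N P m c w q \<longleftrightarrow> M \<in> Z \<and> N \<in> Z \<and> P \<in> Z \<and> (M, N, P, m, c, w) \<in> \<Sigma> \<and> monic m \<and>
    arr q \<and> dom q = P \<and> cod q = cone S M \<and> \<gamma> M \<cdot> q = w \<and>
    (\<exists>n. arr n \<and> dom n = N \<and> cod n = capx S M \<and> n \<cdot> m = \<alpha> M \<and> q \<cdot> c = \<beta> M \<cdot> n)"

abbreviation "std \<equiv> standard_triangles C T \<Sigma> Z D S"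

section \<open>Standard triangles as a presentation\<close>

lemma standard_ob:
  assumes "standard M N P m c w q"
  shows "M \<in> Z" "N \<in> Z" "P \<in> Z" "arr m" "dom m = M" "cod m = N" "arr c" "dom c = N" "cod c = P"
    "arr w" "dom w = P" "cod w = fob T M" "arr q" "dom q = P" "cod q = cone S M" "\<gamma> M \<cdot> q = w"
  using assms sextuples [of "(M, N, P, m, c, w)"] unfolding standard_def by simp_all

lemma standard_tri: "standard M N P m c w q \<Longrightarrow> (M, N, P, m, c, w) \<in> \<Sigma>"
  and standard_monic: "standard M N P m c w q \<Longrightarrow> monic m"
  by (simp_all add: standard_def)

lemma standardI:
  assumes "M \<in> Z" "N \<in> Z" "P \<in> Z" "(M, N, P, m, c, w) \<in> \<Sigma>" "monic m"
  obtains q where "standard M N P m c w q"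
proof -
  have cD: "capx S M \<in> D" using assms by simp
  obtain n q where "arr n" "dom n = N" "cod n = capx S M" "n \<cdot> m = \<alpha> M" "arr q" "dom q = P"
    "cod q = cone S M" "q \<cdot> c = \<beta> M \<cdot> n" "\<gamma> M \<cdot> q = w"
    by (rule monic_compare [OF assms(4,5) chosen_tri [OF assms(1)] cD])
  then have "standard M N P m c w q" unfolding standard_def using assms by blast
  then show ?thesis by (rule that)
qed

lemma std_iff:
  "t \<in> std \<longleftrightarrow> (\<exists>M N P m c w q. standard M N P m c w q \<and> t = (M, N, P, cls C D m, cls C D c, cls C D q))"
proof -
  have "(M \<in> Z \<and> N \<in> Z \<and> P \<in> Z \<and> (M, N, P, m, c, w) \<in> \<Sigma> \<and> rel_monic C D M N m \<and>
      sextuple_mor C T (M, N, P, m, c, w) (chosen S M) (idm C M, n, q)) \<longleftrightarrow>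
    (M \<in> Z \<and> N \<in> Z \<and> P \<in> Z \<and> (M, N, P, m, c, w) \<in> \<Sigma> \<and> monic m \<and>
    arr q \<and> dom q = P \<and> cod q = cone S M \<and> \<gamma> M \<cdot> q = w \<and>
    arr n \<and> dom n = N \<and> cod n = capx S M \<and> n \<cdot> m = \<alpha> M \<and> q \<cdot> c = \<beta> M \<cdot> n)"
    for M N P m c w n q
    using sextuples [of "(M, N, P, m, c, w)"] by (auto simp: rel_monic_iff chosen_def)
  then have "std = {(M, N, P, cls C D m, cls C D c, cls C D q) | M N P m c w n q.
    M \<in> Z \<and> N \<in> Z \<and> P \<in> Z \<and> (M, N, P, m, c, w) \<in> \<Sigma> \<and> monic m \<and>
    arr q \<and> dom q = P \<and> cod q = cone S M \<and> \<gamma> M \<cdot> q = w \<and>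
    arr n \<and> dom n = N \<and> cod n = capx S M \<and> n \<cdot> m = \<alpha> M \<and> q \<cdot> c = \<beta> M \<cdot> n}"
    unfolding standard_triangles_def by simp
  then show ?thesis unfolding standard_def by blast
qed

text \<open>The square commutes only up to some \<open>s0 \<cdot> t\<close> through
  \<open>D\<close>. As \<open>m\<close> is \<open>D\<close>-monic, \<open>t\<close> extends to
  \<open>t'\<close>; subtracting \<open>s0 \<cdot> t'\<close> from \<open>b\<close> keeps its class
  and makes the square commute in \<open>C\<close>, where TR4 applies.\<close>

lemma standard_mor:
  assumes s: "standard M N P m c w q" and s': "standard M' N' P' m' c' w' q'"
    and a: "shift_of a a'" "dom a = M" "cod a = M'" and b: "arr b" "dom b = N" "cod b = N'"
    and eq: "cls C D (b \<cdot> m) = cls C D (m' \<cdot> a)"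
  obtains p where "arr p" "dom p = P" "cod p = P'" "cls C D (p \<cdot> c) = cls C D (c' \<cdot> b)"
    "cls C D (a' \<cdot> q) = cls C D (q' \<cdot> p)"
proof -
  note o = standard_ob [OF s] and o' = standard_ob [OF s']
  have a': "arr a" "arr a'" "dom a' = cone S M" "cod a' = cone S M'" "\<gamma> M' \<cdot> a' = fmor T a \<cdot> \<gamma> M"
    using a by (simp_all add: shift_of_def)
  have "null (b \<cdot> m \<boxminus> m' \<cdot> a)" using eq o(1-9) o'(1-9) a(2,3) a'(1) b by (simp add: cls_eq_iff)
  then obtain s0 t where st: "arr s0" "arr t" "dom s0 = cod t" "cod t \<in> D" "b \<cdot> m \<boxminus> m' \<cdot> a = s0 \<cdot> t"
    "dom t = dom (b \<cdot> m \<boxminus> m' \<cdot> a)" "cod s0 = cod (b \<cdot> m \<boxminus> m' \<cdot> a)"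
    by (rule nullE)
  have t: "dom t = dom m" and s0: "cod s0 = N'"
    using st(6,7) o(1-9) o'(1-9) a(2,3) a'(1) b by simp_all
  obtain t' where t': "arr t'" "dom t' = cod m" "cod t' = cod t" "t = t' \<cdot> m"
    by (rule monicE [OF standard_monic [OF s] st(2) t st(4)])
  define b1 where "b1 = b \<boxminus> s0 \<cdot> t'"
  have b1: "arr b1" "dom b1 = N" "cod b1 = N'"
    using b st(1-3) s0 t'(1-3) o by (simp_all add: b1_def)
  have "b \<cdot> m = s0 \<cdot> (t' \<cdot> m) \<boxplus> m' \<cdot> a"
    using st(5) unfolding t'(4)
    by (subst (asm) minus_eq_iff) (use b st(1-3) s0 t'(1-3) o(1-9) o'(1-9) a(2,3) a'(1) in simp_all)
  then have "b1 \<cdot> m = m' \<cdot> a"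
    unfolding b1_def using b st(1-3) s0 t'(1-3) o(1-9) o'(1-9) a(2,3) a'(1)
    by (simp add: minusm_def add_comm [of "s0 \<cdot> (t' \<cdot> m)"] add_assoc)
  moreover have "a \<in> Mor C M M'" "b1 \<in> Mor C N N'" using a(2,3) a'(1) b1 o o' by simp_all
  ultimately obtain p where
    "sextuple_mor C T (M, N, P, m, c, w) (M', N', P', m', c', w') (a, b1, p)"
    using TR4 [OF standard_tri [OF s] standard_tri [OF s']] by blast
  then have p: "arr p" "dom p = P" "cod p = P'" "p \<cdot> c = c' \<cdot> b1" "fmor T a \<cdot> w = w' \<cdot> p"
    using o(1-3) o'(1-3) by simp_all
  have "cls C D (p \<cdot> c) = cls C D (c' \<cdot> b)"
  proof (rule cls_eqI)
    have "null (neg ((c' \<cdot> s0) \<cdot> t'))"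
      by (intro null_neg nullI) (use st(1-4) s0 t'(1-3) o'(1-9) in simp_all)
    moreover have "p \<cdot> c \<boxminus> c' \<cdot> b = neg ((c' \<cdot> s0) \<cdot> t')"
      unfolding p(4) b1_def
      by (subst minus_eq_iff)
        (use b st(1-4) s0 t'(1-3) o(1-9) o'(1-9) in \<open>simp_all add: minusm_def add_comm\<close>)
    ultimately show "null (p \<cdot> c \<boxminus> c' \<cdot> b)" by simp
  qed (use p(1-3) o(1-9) o'(1-9) b in simp_all)
  moreover have "cls C D (a' \<cdot> q) = cls C D (q' \<cdot> p)"
  proof (rule gamma_cancel [of M'])
    show "\<gamma> M' \<cdot> (a' \<cdot> q) = \<gamma> M' \<cdot> (q' \<cdot> p)"
      using o o' a(2,3) a' p cmp_reassoc [OF a'(5), of q] cmp_reassoc [OF o'(16), of p] by simp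
  qed (use o o' a' p(1-3) in simp_all)
  ultimately show ?thesis by (rule that [OF p(1-3)])
qed

text \<open>Only the class of \<open>u \<cdot> c\<close> vanishes, so \<open>u\<close> is corrected
  within its class until \<open>u \<cdot> c\<close> factors through \<open>n\<close> and the chosen
  triangle can be used.\<close>

lemma standard_exact:
  assumes s: "standard M N P m c w q" and u: "arr u" "dom u = P" "null (u \<cdot> c)"
  obtains x where "arr x" "dom x = cone S M" "cod x = cod u" "cls C D u = cls C D (x \<cdot> q)"
proof -
  note o = standard_ob [OF s] and tri = standard_tri [OF s]
  obtain n where n: "arr n" "dom n = N" "cod n = capx S M" "n \<cdot> m = \<alpha> M" "q \<cdot> c = \<beta> M \<cdot> n"
    using s unfolding standard_def by blast
  obtain r t where rt: "arr r" "arr t" "dom r = cod t" "cod t \<in> D" "u \<cdot> c = r \<cdot> t"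
    "dom t = dom (u \<cdot> c)" "cod r = cod (u \<cdot> c)"
    by (rule nullE [OF u(3)])
  have t: "dom t = N" and r: "cod r = cod u" using rt(6,7) u o by simp_all
  have v: "monic (\<alpha> M)" "arr (t \<cdot> m)" "dom (t \<cdot> m) = dom (\<alpha> M)" "cod (t \<cdot> m) \<in> D"
    using o t rt(1-4) by simp_all
  obtain t1 where t1: "arr t1" "dom t1 = cod (\<alpha> M)" "cod t1 = cod (t \<cdot> m)" "t \<cdot> m = t1 \<cdot> \<alpha> M"
    by (rule monicE [OF v])
  have t1': "dom t1 = capx S M" "cod t1 = cod t" using t1(2,3) o t rt(1-4) by simp_all
  \<comment> \<open>\<open>n \<cdot> m = \<alpha> M\<close>, so \<open>e\<close> kills
    \<open>m\<close> and factors through \<open>c\<close>.\<close>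
  define e where "e = t \<boxminus> t1 \<cdot> n"
  have e: "arr e" "dom e = N" "e \<cdot> m = zerom C M (cod e)" "cod e = cod t"
    unfolding e_def using o t rt(1-4) t1(1,4) t1' n by simp_all
  obtain t2 where t2: "arr t2" "dom t2 = P" "cod t2 = cod e" "e = t2 \<cdot> c"
    by (rule weak_cokernel [OF tri e(1-3)])
  \<comment> \<open>\<open>r \<cdot> t2\<close> factors through \<open>D\<close>, so
    \<open>u1\<close> has the class of \<open>u\<close>; what remains of \<open>u1 \<cdot> c\<close>
    is \<open>r \<cdot> t1 \<cdot> n\<close>.\<close>
  define u1 where "u1 = u \<boxminus> r \<cdot> t2"
  have u1: "arr u1" "dom u1 = P" "cod u1 = cod u"
    using u t2(1-3) e(4) r rt(1-3) by (simp_all add: u1_def)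
  define k where "k = r \<cdot> t1"
  have k: "arr k" "dom k = capx S M" "cod k = cod u" using r rt(1-3) t1(1) t1' by (simp_all add: k_def)
  have "u1 \<cdot> c = r \<cdot> t \<boxminus> r \<cdot> (t2 \<cdot> c)"
    unfolding u1_def using u(1,2) rt(1-5) r t2(1-3) e(4) o by simp
  also have "\<dots> = r \<cdot> t \<boxminus> r \<cdot> e" unfolding t2(4) ..
  also have "\<dots> = k \<cdot> n"
    by (subst minus_eq_iff)
      (use rt(1-3) r e t t1(1) t1' n o in \<open>simp_all add: k_def e_def\<close>)
  finally have u1c: "u1 \<cdot> c = k \<cdot> n" .
  have "k \<cdot> \<alpha> M = (u1 \<cdot> c) \<cdot> m"
    unfolding u1c n(4) [symmetric] using k n(1-3) o by simp
  also have "\<dots> = zerom C M (cod k)" using u1 o k triangle_cmp_gf [OF tri] by simp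
  finally have ka: "k \<cdot> \<alpha> M = zerom C M (cod k)" .
  \<comment> \<open>With \<open>\<beta> M \<cdot> n = q \<cdot> c\<close> this yields
    \<open>u1 \<cdot> c = x \<cdot> q \<cdot> c\<close>.\<close>
  obtain x where x: "arr x" "dom x = cone S M" "cod x = cod k" "k = x \<cdot> \<beta> M"
    by (rule weak_cokernel [OF chosen_tri [OF o(1)] k(1,2) ka])
  define d where "d = u1 \<boxminus> x \<cdot> q"
  have "u1 \<cdot> c = (x \<cdot> q) \<cdot> c"
    unfolding u1c x(4) using x(1-3) n o by simp
  then have d: "arr d" "dom d = P" "d \<cdot> c = zerom C N (cod d)" "cod d = cod u"
    unfolding d_def using u1 x(1-3) k(3) o by simp_all
  obtain y where y: "arr y" "dom y = fob T M" "cod y = cod d" "d = y \<cdot> w"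
    by (rule weak_cokernel_2 [OF tri d(1-3)])
  \<comment> \<open>The remaining difference kills \<open>c\<close>, so it is
    \<open>y \<cdot> w = y \<cdot> \<gamma> M \<cdot> q\<close> and is absorbed into
    \<open>x\<close>.\<close>
  define z where "z = x \<boxplus> y \<cdot> \<gamma> M"
  have z: "arr z" "dom z = cone S M" "cod z = cod u"
    using x(1-3) k(3) y(1-3) d(4) o by (simp_all add: z_def)
  have "z \<cdot> q = x \<cdot> q \<boxplus> d"
    unfolding z_def y(4) using x(1-3) k(3) y(1-3) d(4) o by simp
  also have "\<dots> = u1" unfolding d_def using u1 x(1-3) k(3) o by simp
  finally have zq: "z \<cdot> q = u1" .
  have "u \<boxminus> u1 = r \<cdot> t2"
    unfolding u1_def
    by (subst minus_eq_iff) (use u(1,2) rt(1-3) r t2(1-3) e(4) in simp_all)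
  moreover have "null (r \<cdot> t2)" by (rule nullI) (use rt(1-4) t2(1-3) e(4) in simp_all)
  ultimately have "cls C D u = cls C D u1" using u u1 by (intro cls_eqI) simp_all
  then show ?thesis using that [OF z] zq by simp
qed

sublocale QT: triangle_presentation Q \<sigma> std
proof (unfold_locales, goal_cases)
  case 1
  show ?case by (rule sigma_functor)
next
  case (2 t)
  then obtain M N P m c w q where s: "standard M N P m c w q"
    and t: "t = (M, N, P, cls C D m, cls C D c, cls C D q)" by (auto simp: std_iff)
  then show ?case using standard_ob [OF s] by (simp add: is_sextuple.simps del: Q.mor_iff) (auto intro: Q_morI)
next
  case (3 A B X f g h A' B' X' f' g' h' a b)
  obtain m c w q where s: "standard A B X m c w q" and t: "f = cls C D m" "g = cls C D c" "h = cls C D q"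
    using 3(1) by (auto simp: std_iff)
  obtain m' c' w' q' where s': "standard A' B' X' m' c' w' q'"
    and t': "f' = cls C D m'" "g' = cls C D c'" "h' = cls C D q'"
    using 3(2) by (auto simp: std_iff)
  note o = standard_ob [OF s] and o' = standard_ob [OF s']
  obtain a0 where a0: "arr a0" "dom a0 = A" "cod a0 = A'" "a = cls C D a0"
    by (rule Q_morE [OF 3(3) o(1) o'(1)])
  obtain b0 where b0: "arr b0" "dom b0 = B" "cod b0 = B'" "b = cls C D b0"
    by (rule Q_morE [OF 3(4) o(2) o'(2)])
  obtain a1 where a1: "shift_of a0 a1" by (rule shift_of_exists [of a0]) (use a0 o o' in simp_all)
  have eq: "cls C D (b0 \<cdot> m) = cls C D (m' \<cdot> a0)"
    using 3(5) a0 b0 t t' o o' by simp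
  obtain p where p: "arr p" "dom p = X" "cod p = X'" "cls C D (p \<cdot> c) = cls C D (c' \<cdot> b0)"
    "cls C D (a1 \<cdot> q) = cls C D (q' \<cdot> p)"
    by (rule standard_mor [OF s s' a1 a0(2,3) b0(1-3) eq])
  have a1': "arr a1" "dom a1 = cone S A" "cod a1 = cone S A'" using a1 a0 by (simp_all add: shift_of_def)
  have "sextuple_mor Q \<sigma> (A, B, X, f, g, h) (A', B', X', f', g', h') (a, b, cls C D p)"
    using 3(3-5) a0 b0 t t' o o' p a1' sigma_cls [OF a1] by simp
  then show ?case ..
next
  case (4 A B X f g h u)
  obtain m c w q where s: "standard A B X m c w q" and t: "f = cls C D m" "g = cls C D c" "h = cls C D q"
    using 4(1) by (auto simp: std_iff)
  note o = standard_ob [OF s]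
  obtain u0 where u0: "arr u0" "dom u0 \<in> Z" "cod u0 \<in> Z" "u = cls C D u0" "Q.dom u = dom u0" "Q.cod u = cod u0"
    by (rule Q_arrE [OF 4(2)])
  have u1: "dom u0 = X" using u0(5) 4(3) by simp
  have "cls C D (u0 \<cdot> c) = cls C D (zerom C (dom (u0 \<cdot> c)) (cod (u0 \<cdot> c)))"
    using 4(4) u0 u1 t o by simp
  then have "null (u0 \<cdot> c)" using null_iff_cls [of "u0 \<cdot> c"] u0(1) u1 o by simp
  then obtain x where x: "arr x" "dom x = cone S A" "cod x = cod u0" "cls C D u0 = cls C D (x \<cdot> q)"
    by (rule standard_exact [OF s u0(1) u1])
  show ?case using x u0 t o by (intro exI [of _ "cls C D x"]) simp
qed

lemma quotient_triangles_eq: "quotient_triangles C T \<Sigma> Z D S = QT.tri"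
  by (simp add: quotient_triangles_def QT.tri_def)


section \<open>Cones and octahedra in the quotient\<close>

lemma std_triI: "standard M N P m c w q \<Longrightarrow> (M, N, P, cls C D m, cls C D c, cls C D q) \<in> QT.tri"
  by (rule QT.std_tri) (auto simp: std_iff)

text \<open>The octahedral axiom for \<open>M \<longrightarrow> N \<oplus> D\<^sub>M \<longrightarrow> D\<^sub>M\<close>, with \<open>unrotate\<close> undoing the
  resulting shift, turns the cone \<open>P\<close> of \<open>(f, \<alpha>)\<close> into an extension of \<open>\<sigma> M\<close> by \<open>N\<close>.\<close>

lemma cone_standard:
  assumes M: "M \<in> Z" and N: "N \<in> Z" and f: "arr f" "dom f = M" "cod f = N"
  obtains B i j p r P k w l q where "biproduct N (capx S M) B i j p r" "B \<in> Z"
    "standard M B P (i \<cdot> f \<boxplus> j \<cdot> \<alpha> M) k w l"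
    "standard N P (cone S M) (k \<cdot> i) l (neg (fmor T f \<cdot> \<gamma> M)) q"
proof -
  let ?E = "capx S M"
  have ob: "N \<in> Ob C" "?E \<in> Ob C" and E: "?E \<in> Z" using M N by simp_all
  obtain B i j p r where b: "biproduct N ?E B i j p r"
    and BZ: "\<And>D. \<lbrakk>subcategory C D; N \<in> D; ?E \<in> D\<rbrakk> \<Longrightarrow> B \<in> D"
    using exists_biproduct [OF ob] by blast
  have BZ: "B \<in> Z" by (rule BZ [OF Z_sub N E])
  note bi = b [unfolded biproduct_def]
  have bi_arr: "arr i" "dom i = N" "cod i = B" "arr j" "dom j = ?E" "cod j = B"
    "arr p" "dom p = B" "cod p = N" "arr r" "dom r = B" "cod r = ?E" using bi by simp_all
  have bi_eq: "p \<cdot> i = idm C N" "r \<cdot> j = idm C ?E" "p \<cdot> j = zerom C ?E N" "r \<cdot> i = zerom C N ?E"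
    using bi by simp_all
  note re = cmp_reassoc [OF bi_eq(1)] cmp_reassoc [OF bi_eq(2)] cmp_reassoc [OF bi_eq(3)]
    cmp_reassoc [OF bi_eq(4)]
  define h where "h = i \<cdot> f \<boxplus> j \<cdot> \<alpha> M"
  have h: "arr h" "dom h = M" "cod h = B" "p \<cdot> h = f" "r \<cdot> h = \<alpha> M"
    using bi_arr f M N by (simp_all add: h_def re)
  have "M \<in> Ob C" "B \<in> Ob C" "h \<in> Mor C M B" using h M BZ by simp_all
  then obtain P k w where t: "(M, B, P, h, k, w) \<in> \<Sigma>" using TR2 by blast
  note to = sextuples [OF t]
  \<comment> \<open>The split triangle of the biproduct, rotated once, is the triangle on the second
    map \<open>r\<close> of the octahedron.\<close>
  have t2: "(B, ?E, fob T N, r, zerom C ?E (fob T N), negm C (fob T N) (fob T B) (fmor T i)) \<in> \<Sigma>"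
    by (rule TR3 [OF split_triangle [OF b]])
  have t3: "(M, ?E, cone S M, r \<cdot> h, \<beta> M, \<gamma> M) \<in> \<Sigma>" unfolding h(5) by (rule chosen_tri [OF M])
  obtain l g where l: "l \<in> Mor C P (cone S M)" "g \<in> Mor C (cone S M) (fob T N)"
      "l \<cdot> k = \<beta> M \<cdot> r" "\<gamma> M \<cdot> l = w"
      "negm C (fob T N) (fob T B) (fmor T i) \<cdot> g = fmor T h \<cdot> \<gamma> M"
    and t4: "(P, cone S M, fob T N, l, g, fmor T k \<cdot> negm C (fob T N) (fob T B) (fmor T i)) \<in> \<Sigma>"
    using TR5 [OF t t2 t3] by blast
  have la: "arr l" "dom l = P" "cod l = cone S M" "arr g" "dom g = cone S M" "cod g = fob T N"
    using l(1,2) to M N by simp_all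
  have Tpi: "fmor T p \<cdot> fmor T i = idm C (fob T N)"
    using bi_arr bi_eq(1) N by (simp flip: T_cmp)
  \<comment> \<open>Composing with \<open>T p\<close>, a left inverse of \<open>T i\<close>,
    isolates \<open>g\<close>.\<close>
  have "fmor T p \<cdot> neg (fmor T i \<cdot> g) = fmor T p \<cdot> (fmor T h \<cdot> \<gamma> M)"
    using l(5) la bi_arr by simp
  moreover have "fmor T p \<cdot> neg (fmor T i \<cdot> g) = neg g"
    using la bi_arr N cmp_reassoc [OF Tpi, of g] by simp
  moreover have "fmor T p \<cdot> (fmor T h \<cdot> \<gamma> M) = fmor T f \<cdot> \<gamma> M"
  proof -
    have "fmor T p \<cdot> fmor T h = fmor T f" using h bi_arr by (simp flip: T_cmp)
    from cmp_reassoc [OF this, of "\<gamma> M"] show ?thesis using h(1-3) bi_arr M by simp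
  qed
  ultimately have "neg (neg g) = neg (fmor T f \<cdot> \<gamma> M)" by simp
  then have g: "g = neg (fmor T f \<cdot> \<gamma> M)" using la by simp
  \<comment> \<open>The last map of \<open>t4\<close> is \<open>- T (k \<cdot> i)\<close>, so
    \<open>t4\<close> is the rotation of this triangle.\<close>
  have "(N, P, cone S M, k \<cdot> i, l, g) \<in> \<Sigma>"
    by (rule unrotate) (use t4 la to bi_arr M N in simp_all)
  then have t5: "(N, P, cone S M, k \<cdot> i, l, neg (fmor T f \<cdot> \<gamma> M)) \<in> \<Sigma>" unfolding g .
  have P: "P \<in> Z" using ext_closed t5 N chosen_simps(2) [OF M] unfolding extension_closed_def by blast
  have "monic h"
  proof (rule monicI)
    fix v assume v: "arr v" "dom v = dom h" "cod v \<in> D"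
    have v': "monic (\<alpha> M)" "dom v = dom (\<alpha> M)" using v h M by simp_all
    obtain v1 where v1: "arr v1" "dom v1 = cod (\<alpha> M)" "cod v1 = cod v" "v = v1 \<cdot> \<alpha> M"
      by (rule monicE [OF v'(1) v(1) v'(2) v(3)])
    have "v = (v1 \<cdot> r) \<cdot> h"
      unfolding v1(4) using v1(1-3) bi_arr h M by simp
    then show "\<exists>u. arr u \<and> dom u = cod h \<and> cod u = cod v \<and> v = u \<cdot> h"
      using v1(1-3) bi_arr h(1-3) M by (intro exI [of _ "v1 \<cdot> r"]) simp
  qed (rule h(1))
  \<comment> \<open>The required \<open>n\<close> is the projection \<open>r\<close>, and the
    octahedral map \<open>l\<close> is already a lift of \<open>w\<close> along
    \<open>\<gamma> M\<close>.\<close>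
  then have s1: "standard M B P h k w l"
    unfolding standard_def using M BZ P t la l bi_arr h by auto
  have "monic (k \<cdot> i)"
  proof (rule monicI)
    show "arr (k \<cdot> i)" using to bi_arr by simp
    fix v assume "arr v" "dom v = dom (k \<cdot> i)" "cod v \<in> D"
    then have v: "arr v" "dom v = N" "cod v \<in> D" using to bi_arr by simp_all
    have v': "monic (\<alpha> M)" "arr (v \<cdot> f)" "dom (v \<cdot> f) = dom (\<alpha> M)" "cod (v \<cdot> f) \<in> D"
      using v f M by simp_all
    obtain v1 where v1: "arr v1" "dom v1 = cod (\<alpha> M)" "cod v1 = cod (v \<cdot> f)" "v \<cdot> f = v1 \<cdot> \<alpha> M"
      by (rule monicE [OF v'])
    have v1': "dom v1 = ?E" "cod v1 = cod v" using v1(2,3) v f M by simp_all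
    \<comment> \<open>\<open>v1\<close> extends \<open>v \<cdot> f\<close> along \<alpha>, so
      \<open>e\<close> kills \<open>h\<close> and factors through \<open>k\<close>; restriction
      along \<open>i\<close> recovers \<open>v\<close>.\<close>
    define e where "e = v \<cdot> p \<boxminus> v1 \<cdot> r"
    have e: "arr e" "dom e = B" "e \<cdot> h = zerom C M (cod e)" "cod e = cod v"
      unfolding e_def using v v1(1,4) v1' bi_arr h f M by simp_all
    obtain v2 where v2: "arr v2" "dom v2 = P" "cod v2 = cod e" "e = v2 \<cdot> k"
      by (rule weak_cokernel [OF t e(1-3)])
    have "v = e \<cdot> i" unfolding e_def using v v1(1) v1' bi_arr bi_eq N by (simp add: minusm_def)
    also have "\<dots> = v2 \<cdot> (k \<cdot> i)" unfolding v2(4) using v2(1-3) to bi_arr by simp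
    finally show "\<exists>u. arr u \<and> dom u = cod (k \<cdot> i) \<and> cod u = cod v \<and> v = u \<cdot> (k \<cdot> i)"
      using v2(1-3) e(4) to bi_arr by (intro exI [of _ v2]) simp
  qed
  moreover have "cone S M \<in> Z" using M by simp
  ultimately obtain q where s2: "standard N P (cone S M) (k \<cdot> i) l (neg (fmor T f \<cdot> \<gamma> M)) q"
    using standardI [OF N P _ t5] by blast
  show ?thesis by (rule that [OF b BZ s1 [unfolded h_def] s2])
qed

text \<open>The complement \<open>j \<cdot> r\<close> of \<open>i \<cdot> p\<close> factors through
  \<open>E\<close>, so \<open>i\<close> and \<open>p\<close> become mutually inverse.\<close>

lemma biproduct_quotient_iso:
  assumes b: "biproduct N E B i j p r" and E: "E \<in> D" and N: "N \<in> Z" and B: "B \<in> Z"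
  shows "iso_mor Q N B (cls C D i)" "iso_mor Q B N (cls C D p)"
    "cls C D (i \<cdot> p) = cls C D (idm C B)"
proof -
  note bi = b [unfolded biproduct_def]
  have arr: "arr i" "dom i = N" "cod i = B" "arr j" "dom j = E" "cod j = B"
    "arr p" "dom p = B" "cod p = N" "arr r" "dom r = B" "cod r = E" using bi by simp_all
  have "idm C B \<boxminus> i \<cdot> p = j \<cdot> r"
    by (subst minus_eq_iff) (use bi arr B add_comm [of "i \<cdot> p" "j \<cdot> r"] in simp_all)
  moreover have "null (j \<cdot> r)" by (rule nullI) (use arr E in simp_all)
  ultimately have "cls C D (idm C B) = cls C D (i \<cdot> p)" using arr B by (intro cls_eqI) simp_all
  then show ip: "cls C D (i \<cdot> p) = cls C D (idm C B)" by simp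
  show "iso_mor Q N B (cls C D i)"
    by (rule Q.iso_morI [of _ "cls C D p"]) (use bi arr N B ip in simp_all)
  show "iso_mor Q B N (cls C D p)"
    by (rule Q.iso_morI [of _ "cls C D i"]) (use bi arr N B ip in simp_all)
qed

text \<open>The projection \<open>p\<close> carries the standard triangle on
  \<open>(f, \<alpha>)\<close> to a triangle on \<open>F\<close>; the second triangle of
  \<open>cone_standard\<close> is its rotation.\<close>

lemma quotient_cone:
  assumes "Q.arr F"
  shows "\<exists>X G H. (Q.dom F, Q.cod F, X, F, G, H) \<in> QT.tri \<and>
    (Q.cod F, X, fob \<sigma> (Q.dom F), G, H, Q.neg (fmor \<sigma> F)) \<in> QT.tri"
proof -
  obtain f where f: "arr f" "dom f \<in> Z" "cod f \<in> Z" "F = cls C D f" "Q.dom F = dom f" "Q.cod F = cod f"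
    by (rule Q_arrE [OF assms])
  let ?M = "dom f" and ?N = "cod f"
  obtain B i j p r P k w l q where b: "biproduct ?N (capx S ?M) B i j p r" and B: "B \<in> Z"
    and s1: "standard ?M B P (i \<cdot> f \<boxplus> j \<cdot> \<alpha> ?M) k w l"
    and s2: "standard ?N P (cone S ?M) (k \<cdot> i) l (neg (fmor T f \<cdot> \<gamma> ?M)) q"
    by (rule cone_standard [OF f(2,3,1) refl refl])
  note o1 = standard_ob [OF s1] and o2 = standard_ob [OF s2]
  note bi = b [unfolded biproduct_def]
  have E: "capx S ?M \<in> D" using f by simp
  note iso = biproduct_quotient_iso [OF b E f(3) B]
  have pi: "p \<cdot> i = idm C ?N" and pj: "p \<cdot> j = zerom C (capx S ?M) ?N" using bi by simp_all
  have ph: "p \<cdot> (i \<cdot> f \<boxplus> j \<cdot> \<alpha> ?M) = f"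
    using bi f by (simp add: cmp_reassoc [OF pi] cmp_reassoc [OF pj])
  have "cls C D ((k \<cdot> i) \<cdot> p) = cmp Q (cls C D k) (cls C D (i \<cdot> p))"
    using bi o1 f B by simp
  also have "\<dots> = cls C D k" unfolding iso(3) using o1 B by simp
  finally have kip: "cls C D ((k \<cdot> i) \<cdot> p) = cls C D k" .
  have "sextuple_iso Q \<sigma> (?M, B, P, cls C D (i \<cdot> f \<boxplus> j \<cdot> \<alpha> ?M), cls C D k, cls C D l)
      (?M, ?N, P, F, cls C D (k \<cdot> i), cls C D l) (cls C D (idm C ?M), cls C D p, cls C D (idm C P))"
  proof -
    have "arr (i \<cdot> f \<boxplus> j \<cdot> \<alpha> ?M)" "dom (i \<cdot> f \<boxplus> j \<cdot> \<alpha> ?M) = ?M" "cod (i \<cdot> f \<boxplus> j \<cdot> \<alpha> ?M) = B"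
      using o1 by simp_all
    moreover have "arr p" "dom p = B" "cod p = ?N" "arr i" "dom i = ?N" "cod i = B" using bi by simp_all
    moreover have "iso_mor Q ?M ?M (cls C D (idm C ?M))" "iso_mor Q P P (cls C D (idm C P))"
      using Q.iso_id [of ?M] Q.iso_id [of P] f o1 by simp_all
    moreover have "fmor \<sigma> (cls C D (idm C ?M)) = cls C D (idm C (cone S ?M))"
      using f by (intro sigma_cls shift_of_id)
    ultimately show ?thesis using f o1(1-3,7-15) o2(4-6) B ph kip iso(2) by (simp del: cmp_add)
  qed
  then have "(?M, ?N, P, F, cls C D (k \<cdot> i), cls C D l) \<in> QT.tri"
    by (rule QT.tri_iso [OF std_triI [OF s1], rotated]) (use f o1 o2 in simp)
  moreover have "(?N, P, cone S ?M, cls C D (k \<cdot> i), cls C D l, Q.neg (fmor \<sigma> F)) \<in> QT.tri"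
  proof -
    obtain f' where f': "shift_of f f'" by (rule shift_of_exists [OF f(1-3)])
    have f'': "arr f'" "dom f' = cone S ?M" "cod f' = cone S ?N" "\<gamma> ?N \<cdot> f' = fmor T f \<cdot> \<gamma> ?M"
      using f' by (simp_all add: shift_of_def)
    \<comment> \<open>After \<gamma> both maps become \<open>- T f \<cdot> \<gamma>\<close>, which
      identifies the connecting map with \<open>- \<sigma> F\<close>.\<close>
    have "cls C D q = cls C D (neg f')"
      by (rule gamma_cancel [OF f(3)]) (use f f'' o2 in simp_all)
    also have "\<dots> = Q.neg (fmor \<sigma> F)" using f f'' sigma_cls [OF f'] by simp
    finally show ?thesis using std_triI [OF s2] by simp
  qed
  ultimately show ?thesis unfolding f(5,6) by auto
qed


text \<open>The octahedron of \<open>C\<close> is used as it stands: extension-closedness puts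
  \<open>W\<close> into \<open>Z\<close>, so the point is that \<open>l\<close> is
  \<open>D\<close>-monic, which makes the fourth triangle standard.\<close>

lemma standard_octahedron:
  assumes s1: "standard X Y P a b w q" and s2: "standard Y U V d e v r"
  shows "QT.octahedron X Y U (cls C D a) (cls C D d)"
proof -
  note o1 = standard_ob [OF s1] and o2 = standard_ob [OF s2]
  have da: "arr (d \<cdot> a)" "dom (d \<cdot> a) = X" "cod (d \<cdot> a) = U" using o1 o2 by simp_all
  have "X \<in> Ob C" "U \<in> Ob C" "d \<cdot> a \<in> Mor C X U" using da o1 o2 by simp_all
  then obtain W g h where t3: "(X, U, W, d \<cdot> a, g, h) \<in> \<Sigma>" using TR2 by blast
  obtain l i where li: "l \<in> Mor C P W" "i \<in> Mor C W V" and
    oct: "l \<cdot> b = g \<cdot> d" "h \<cdot> l = w" "i \<cdot> g = e" "v \<cdot> i = fmor T a \<cdot> h"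
    and t4: "(P, W, V, l, i, fmor T b \<cdot> v) \<in> \<Sigma>"
    using TR5 [OF standard_tri [OF s1] standard_tri [OF s2] t3] by blast
  have W: "W \<in> Z" using ext_closed t4 o1(3) o2(3) unfolding extension_closed_def by blast
  have "monic (d \<cdot> a)"
    by (rule monic_cmp [OF standard_monic [OF s1] standard_monic [OF s2]]) (use o1 o2 in simp)
  then obtain q3 where s3: "standard X U W (d \<cdot> a) g h q3"
    using standardI [OF o1(1) o2(2) W t3] by blast
  note o3 = standard_ob [OF s3]
  have lia: "arr l" "dom l = P" "cod l = W" "arr i" "dom i = W" "cod i = V"
    using li o1(3) o2(3) W by simp_all
  have "monic l"
  proof (rule monicI [OF lia(1)])
    fix x assume "arr x" "dom x = dom l" "cod x \<in> D"
    then have x: "arr x" "dom x = P" "cod x \<in> D" using lia by simp_all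
    have xb: "arr (x \<cdot> b)" "dom (x \<cdot> b) = dom d" "cod (x \<cdot> b) \<in> D" using x o1 o2 by simp_all
    \<comment> \<open>\<open>x \<cdot> b\<close> extends along \<open>d\<close> to
      \<open>x1\<close>. Since \<open>x1\<close> kills \<open>d \<cdot> a\<close>, it factors as
      \<open>x2 \<cdot> g\<close>, so that \<open>x\<close> and \<open>x2 \<cdot> l\<close> agree
      after \<open>b\<close>.\<close>
    obtain x1 where x1: "arr x1" "dom x1 = cod d" "cod x1 = cod (x \<cdot> b)" "x \<cdot> b = x1 \<cdot> d"
      by (rule monicE [OF standard_monic [OF s2] xb])
    have x1': "dom x1 = U" "cod x1 = cod x" using x1(2,3) x o1 o2 by simp_all
    have "x1 \<cdot> (d \<cdot> a) = x \<cdot> (b \<cdot> a)"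
      using x x1(1) x1' o1 o2 cmp_reassoc [OF x1(4), of a] by simp
    also have "\<dots> = zerom C X (cod x1)"
      using triangle_cmp_gf [OF standard_tri [OF s1]] x x1' o1 by simp
    finally have x1z: "x1 \<cdot> (d \<cdot> a) = zerom C X (cod x1)" .
    obtain x2 where x2: "arr x2" "dom x2 = W" "cod x2 = cod x1" "x1 = x2 \<cdot> g"
      by (rule weak_cokernel [OF t3 x1(1) x1'(1) x1z])
    have "x \<cdot> b = x2 \<cdot> (g \<cdot> d)" unfolding x1(4) x2(4) using x2(1-3) o2 o3 by simp
    also have "\<dots> = (x2 \<cdot> l) \<cdot> b" unfolding oct(1) [symmetric] using x2(1-3) lia o1 by simp
    finally have xb2: "x \<cdot> b = (x2 \<cdot> l) \<cdot> b" .
    \<comment> \<open>The error kills \<open>b\<close>, so it is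
      \<open>z \<cdot> w = z \<cdot> h \<cdot> l\<close> and factors through \<open>l\<close>
      too.\<close>
    define y where "y = x \<boxminus> x2 \<cdot> l"
    have y: "arr y" "dom y = P" "y \<cdot> b = zerom C Y (cod y)" "cod y = cod x"
      unfolding y_def using x x2(1-3) x1' lia o1 xb2 by simp_all
    obtain z where z: "arr z" "dom z = fob T X" "cod z = cod y" "y = z \<cdot> w"
      by (rule weak_cokernel_2 [OF standard_tri [OF s1] y(1-3)])
    have "x = x2 \<cdot> l \<boxplus> y" unfolding y_def using x x2(1-3) x1' lia by simp
    also have "y = (z \<cdot> h) \<cdot> l" unfolding z(4) oct(2) [symmetric] using z(1-3) o3 lia by simp
    also have "x2 \<cdot> l \<boxplus> (z \<cdot> h) \<cdot> l = (x2 \<boxplus> z \<cdot> h) \<cdot> l"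
      using z(1-3) y(4) x2(1-3) x1' o3 lia by simp
    finally have xl: "x = (x2 \<boxplus> z \<cdot> h) \<cdot> l" .
    have "arr (x2 \<boxplus> z \<cdot> h)" "dom (x2 \<boxplus> z \<cdot> h) = cod l" "cod (x2 \<boxplus> z \<cdot> h) = cod x"
      using z(1-3) y(4) x2(1-3) x1' o3 lia by simp_all
    then show "\<exists>u. arr u \<and> dom u = cod l \<and> cod u = cod x \<and> x = u \<cdot> l" using xl by blast
  qed
  then obtain q4 where s4: "standard P W V l i (fmor T b \<cdot> v) q4"
    using standardI [OF o1(3) W o2(3) t4] by blast
  note o4 = standard_ob [OF s4]
  obtain a' where a: "shift_of a a'" by (rule shift_of_exists [of a]) (use o1 in simp_all)
  have a': "arr a'" "dom a' = cone S X" "cod a' = cone S Y" "\<gamma> Y \<cdot> a' = fmor T a \<cdot> \<gamma> X"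
    using a o1(4-6) by (simp_all add: shift_of_def)
  obtain b' where b: "shift_of b b'" by (rule shift_of_exists [of b]) (use o1 in simp_all)
  have b': "arr b'" "dom b' = cone S Y" "cod b' = cone S P" "\<gamma> P \<cdot> b' = fmor T b \<cdot> \<gamma> Y"
    using b o1(7-9) by (simp_all add: shift_of_def)
  \<comment> \<open>Composed with \<gamma>, these three identities become relations of the
    octahedron in \<open>C\<close>.\<close>
  have e1: "cls C D (q3 \<cdot> l) = cls C D q"
    by (rule gamma_cancel [OF o1(1)])
      (use o1 o3 lia oct(2) cmp_reassoc [OF o3(16), of l] in simp_all)
  have e2: "cls C D (r \<cdot> i) = cls C D (a' \<cdot> q3)"
    by (rule gamma_cancel [OF o2(1)])
      (use o1 o2 o3 lia oct(4) a' cmp_reassoc [OF o2(16), of i] cmp_reassoc [OF a'(4), of q3] in simp_all)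
  have e3: "cls C D q4 = cls C D (b' \<cdot> r)"
    by (rule gamma_cancel [OF o1(3)])
      (use o1 o2 o4 b' cmp_reassoc [OF b'(4), of r] in simp_all)
  have Qda: "cmp Q (cls C D d) (cls C D a) = cls C D (d \<cdot> a)" using o1 o2 by simp
  have "(P, W, V, cls C D l, cls C D i, cmp Q (fmor \<sigma> (cls C D b)) (cls C D r)) \<in> QT.tri"
    using std_triI [OF s4] o2 b' by (simp add: e3 sigma_cls [OF b])
  moreover have "cmp Q (cls C D l) (cls C D b) = cmp Q (cls C D g) (cls C D d)"
    using oct(1) lia o1 o2 o3 by simp
  moreover have "cmp Q (cls C D q3) (cls C D l) = cls C D q" using e1 lia o3 by simp
  moreover have "cmp Q (cls C D i) (cls C D g) = cls C D e" using oct(3) lia o3 by simp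
  moreover have "cmp Q (cls C D r) (cls C D i) = cmp Q (fmor \<sigma> (cls C D a)) (cls C D q3)"
    using e2 lia o2 o3 a' by (simp add: sigma_cls [OF a])
  ultimately show ?thesis
    unfolding QT.octahedron_def Qda using std_triI [OF s1] std_triI [OF s2] std_triI [OF s3] by blast
qed

text \<open>Both maps are made \<open>D\<close>-monic, the second starting at the enlarged target
  \<open>B\<close> of the first. The injections \<open>i\<close> and \<open>i'\<close> give the
  required isomorphisms, since the added components factor through \<open>D\<close>.\<close>

lemma quotient_octahedron:
  assumes AD: "Q.arr A" "Q.arr F" "Q.dom F = Q.cod A"
  shows "\<exists>Y U y u F'. iso_mor Q (Q.cod A) Y y \<and> iso_mor Q (Q.cod F) U u \<and>
    cmp Q u F = cmp Q F' y \<and> QT.octahedron (Q.dom A) Y U (cmp Q y A) F'"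
proof -
  obtain a where a: "arr a" "dom a \<in> Z" "cod a \<in> Z" "A = cls C D a" "Q.dom A = dom a" "Q.cod A = cod a"
    by (rule Q_arrE [OF AD(1)])
  obtain d where d: "arr d" "dom d \<in> Z" "cod d \<in> Z" "F = cls C D d" "Q.dom F = dom d" "Q.cod F = cod d"
    by (rule Q_arrE [OF AD(2)])
  have da: "dom d = cod a" using AD(3) a d by simp
  let ?X = "dom a"
  obtain B i j p r P k w l q where b: "biproduct (cod a) (capx S ?X) B i j p r" and B: "B \<in> Z"
    and s: "standard ?X B P (i \<cdot> a \<boxplus> j \<cdot> \<alpha> ?X) k w l"
    by (rule cone_standard [OF a(2,3,1) refl refl])
  have bi: "arr i" "dom i = cod a" "cod i = B" "arr j" "dom j = capx S ?X" "cod j = B"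
    "arr p" "dom p = B" "cod p = cod a" "p \<cdot> i = idm C (cod a)"
    using b by (simp_all add: biproduct_def)
  \<comment> \<open>\<open>d\<close> starts at \<open>cod a\<close>, not at \<open>B\<close>; the
    projection \<open>p\<close> makes it composable.\<close>
  have dp: "arr (d \<cdot> p)" "dom (d \<cdot> p) = B" "cod (d \<cdot> p) = cod d" using d da bi by simp_all
  obtain B' i' j' p' r' P' k' w' l' q' where b': "biproduct (cod d) (capx S B) B' i' j' p' r'"
    and B': "B' \<in> Z" and s': "standard B B' P' (i' \<cdot> (d \<cdot> p) \<boxplus> j' \<cdot> \<alpha> B) k' w' l'"
    by (rule cone_standard [OF B d(3) dp])
  have bi': "arr i'" "dom i' = cod d" "cod i' = B'" "arr j'" "dom j' = capx S B" "cod j' = B'"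
    using b' by (simp_all add: biproduct_def)
  let ?a = "i \<cdot> a \<boxplus> j \<cdot> \<alpha> ?X" and ?d = "i' \<cdot> (d \<cdot> p) \<boxplus> j' \<cdot> \<alpha> B"
  have E: "capx S ?X \<in> D" "capx S B \<in> D" using a B by simp_all
  have "?a \<boxminus> i \<cdot> a = j \<cdot> \<alpha> ?X"
    by (subst minus_eq_iff) (use a bi add_comm [of "i \<cdot> a" "j \<cdot> \<alpha> ?X"] in simp_all)
  moreover have "null (j \<cdot> \<alpha> ?X)" by (rule nullI) (use a bi in simp_all)
  ultimately have "cls C D ?a = cls C D (i \<cdot> a)" using a bi by (intro cls_eqI) simp_all
  then have ya: "cmp Q (cls C D i) A = cls C D ?a" using a bi by simp
  have di: "?d \<cdot> i = i' \<cdot> d \<boxplus> j' \<cdot> (\<alpha> B \<cdot> i)" using d da bi bi' B by simp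
  have "?d \<cdot> i \<boxminus> i' \<cdot> d = j' \<cdot> (\<alpha> B \<cdot> i)"
    unfolding di
    by (subst minus_eq_iff)
      (use d da bi bi' B add_comm [of "i' \<cdot> d" "j' \<cdot> (\<alpha> B \<cdot> i)"] in simp_all)
  moreover have "null (j' \<cdot> (\<alpha> B \<cdot> i))" by (rule nullI) (use bi bi' B in simp_all)
  ultimately have "cls C D (?d \<cdot> i) = cls C D (i' \<cdot> d)"
    using d da bi bi' B by (intro cls_eqI) simp_all
  then have "cmp Q (cls C D i') F = cmp Q (cls C D ?d) (cls C D i)"
    using d da bi bi' B by (simp del: cmp_add)
  moreover have "QT.octahedron ?X B B' (cmp Q (cls C D i) A) (cls C D ?d)"
    unfolding ya by (rule standard_octahedron [OF s s'])
  moreover have "iso_mor Q (cod a) B (cls C D i)"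
    by (rule biproduct_quotient_iso(1) [OF b E(1) a(3) B])
  moreover have "iso_mor Q (cod d) B' (cls C D i')"
    by (rule biproduct_quotient_iso(1) [OF b' E(2) d(3) B'])
  ultimately show ?thesis unfolding a(5,6) d(6) by blast
qed

lemma quotient_trivial_triangle:
  assumes N: "zero_object C N" "N \<in> Z" and A: "A \<in> Z"
  shows "(N, A, A, zerom Q N A, idm Q A, zerom Q A (fob \<sigma> N)) \<in> QT.tri"
proof -
  have ob: "A \<in> Ob C" using A by simp
  obtain q where s: "standard N A A (zerom C N A) (idm C A) (zerom C A (fob T N)) q"
    by (rule standardI [OF N(2) A A TR1 [OF N(1) ob] monic_from_zero [OF N(1) ob]])
  note o = standard_ob [OF s]
  have "cls C D q = cls C D (zerom C A (cone S N))"
    by (rule gamma_cancel [OF N(2)]) (use o in simp_all)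
  then show ?thesis using std_triI [OF s] by simp
qed

lemma quotient_triangulated: "triangulated_category Q \<sigma> QT.tri"
proof -
  obtain N where N: "zero_object C N" "N \<in> Z" using exists_zero_object Z_sub by blast
  have "idm C N = zerom C N N"
    using zero_object_arr(1) [OF N(1), of "idm C N"] N(2) by simp
  then have zN: "zero_object Q N" using N(2) by (intro Q.zero_objectI) simp_all
  have "right_triangulated_category Q \<sigma> QT.tri"
    by (rule QT.right_triangulatedI [OF additive_Q zN _ quotient_cone quotient_octahedron])
      (use quotient_trivial_triangle [OF N] in auto)
  then show ?thesis
    by (intro triangulated_category.intro triangulated_category_axioms.intro sigma_equivalence)
qed

end

theorem theorem3p11:
  fixes C :: "('o, 'm) addcat" and T :: "('o, 'm) endo" and \<Sigma> :: "('o, 'm) sextuple set"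
    and Z D :: "'o set" and S :: "('o, 'm) cone_choice"
  assumes "right_triangulated_category C T \<Sigma>"
    and "krull_schmidt C"
    and "\<And>A B X f g h. \<lbrakk>A \<in> Ob C; B \<in> Ob C; X \<in> Ob C;
        f \<in> Mor C A B; g \<in> Mor C B X; h \<in> Mor C X (fob T A);
        (B, X, fob T A, g, h, negm C (fob T A) (fob T B) (fmor T f)) \<in> \<Sigma>\<rbrakk>
      \<Longrightarrow> (A, B, X, f, g, h) \<in> \<Sigma>"
    and "subcategory C Z" and "subcategory C D" and "D \<subseteq> Z"
    and "factor_through_epic C T D"
    and "extension_closed \<Sigma> Z"
    and "mutation_pair C \<Sigma> D Z Z"
    and "\<And>X Y u. \<lbrakk>X \<in> Z; Y \<in> Z; u \<in> Mor C (fob T X) (fob T Y)\<rbrakk>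
      \<Longrightarrow> \<exists>f \<in> Mor C X Y. fmor T f = u"
    and "valid_choice C \<Sigma> Z D S"
  shows "triangulated_category (quotient_cat C Z D) (sigma C T Z D S)
    (quotient_triangles C T \<Sigma> Z D S)"
proof -
  interpret right_triangulated_category C T \<Sigma> by (rule assms(1))
  interpret mutation_category C T \<Sigma> Z D S
    by unfold_locales (fact assms)+
  show ?thesis unfolding quotient_triangles_eq by (rule quotient_triangulated)
qed

end
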